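(* Let $s,t\in\mathbb N_0$. For any $f\in D_S\cap D_{T^*}$ it holds that $$\|T^*f\|^2_{L^2_{(s,t)}(\ell^2,P_r)}+\|Sf\|^2_{L^2_{(s,t+2)}(\ell^2,P_r)}\ge\frac{t+1}{2r^2}\,\|f\|^2_{L^2_{(s,t+1)}(\ell^2,P_r)} .$$
   Context: Fix $r>0$ and positive numbers $(a_i)_{i\ge1}$ with $\sum_ia_i<\infty$. Here $\ell^2$ is the space of complex sequences $\mathbf z=(z_i)_{i\in\mathbb N}$, $z_i=x_i+\sqrt{-1}y_i$, with $\sum|z_i|^2<\infty$. $P_r$ is the Borel probability measure on $\ell^2$ obtained by restricting to $\ell^2$ the product measure $\prod_i(\mathcal N_{ra_i}\times\mathcal N_{ra_i})$ on $\mathbb C^{\mathbb N}$ (real and imaginary parts), where $\mathcal N_a(dx)=\frac1{\sqrt{2\pi a^2}}e^{-x^2/(2a^2)}dx$. $\mathscr C_c^\infty$ is the union over $n$ of the complex-valued $C_c^\infty$ functions on $\mathbb C^n$, viewed as cylinder functions on $\ell^2$ of $(z_1,\dots,z_n)$. $\partial_i=\frac12(D_{x_i}-\sqrt{-1}D_{y_i})$ and $\delta_i\varphi=\partial_i\varphi-\frac{\overline{z_i}}{2r^2a_i^2}\varphi$. For strictly increasing multi-indices $I=(i_1,\dots,i_s)$, $J=(j_1,\dots,j_t)$ put $\mathbf a^{I,J}=\prod_la_{i_l}^2\prod_la_{j_l}^2$. An $(s,t)$-form is a formal sum $f=\sum'_{|I|=s}\sum'_{|J|=t}f_{I,J}\,dz_I\wedge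 d\overline{z_J}$ over strictly increasing multi-indices, i.e. a family of coefficient functions on $\ell^2$. $L^2_{(s,t)}(\ell^2,P_r)$ is the Hilbert space of such forms with $f_{I,J}\in L^2(\ell^2,P_r)$ and $\|f\|^2=\sum'_{I,J}\mathbf a^{I,J}\int|f_{I,J}|^2dP_r<\infty$. For $j\in\mathbb N$ and strictly increasing $J,K$ with $|J|=t,|K|=t+1$: $\varepsilon^K_{j,J}=0$ unless $K=J\cup\{j\}$ as sets, in which case it is the sign of the permutation taking $(j,j_1,\dots,j_t)$ to $K$. $f\in L^2_{(s,t)}(\ell^2,P_r)$ is in $D_{\overline\partial}$ if for all $I,K$ ($|I|=s,|K|=t+1$) there is $g_{I,K}\in L^2(\ell^2,P_r)$ with $\int g_{I,K}\overline\varphi\,dP_r=-\int\sum_{i\ge1}\sum'_{|J|=t}\varepsilon^K_{i,J}f_{I,J}\,\overline{\delta_i\varphi}\,dP_r$ for all $\varphi\in\mathscr C_c^\infty$, and $\sum'_{I,K}\mathbf a^{I,K}\int|g_{I,K}|^2dP_r<\infty$; then $\overline\partial f=(-1)^s\sum'_{I,K}g_{I,K}\,dz_I\wedge d\overline{z_K}$. $T$ is $\overline\partial$ as a (densely defined, closed) operator $L^2_{(s,t)}\to L^2_{(s,t+1)}$ with domain $D_T$, $S$ is $\overline\partial$ as an operator $L^2_{(s,t+1)}\to L^2_{(s,t+2)}$ with domain $D_S$; $T^*$ is the Hilbert space adjoint of $T$ with domain $D_{T^*}$. *)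

theory Defs
  imports "HOL-Probability.Probability" "HOL-Combinatorics.Permutations"
begin

text \<open>
  Sequences are indexed by \<open>nat\<close> starting at 0.  The space \<open>\<ell>\<^sup>2\<close> is the set \<open>ell2\<close> inside the
  type of all complex sequences, which carries the topology of pointwise convergence.
\<close>

definition ell2 :: "(nat \<Rightarrow> complex) set" where
  "ell2 = {z. summable (\<lambda>i. (cmod (z i))\<^sup>2)}"

definition ell2_dist :: "(nat \<Rightarrow> complex) \<Rightarrow> (nat \<Rightarrow> complex) \<Rightarrow> real" where
  "ell2_dist w z = sqrt (\<Sum>i. (cmod (w i - z i))\<^sup>2)"

definition ell2_open :: "(nat \<Rightarrow> complex) set \<Rightarrow> bool" where
  "ell2_open U \<longleftrightarrow> U \<subseteq> ell2 \<and> (\<forall>z\<in>U. \<exists>e>0. \<forall>w\<in>ell2. ell2_dist w z < e \<longrightarrow> w \<in> U)"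


subsection \<open>The Gaussian measure\<close>

definition gauss1 :: "real \<Rightarrow> real measure" where
  "gauss1 \<sigma> = density lborel (\<lambda>x. ennreal (normal_density 0 \<sigma> x))"

definition gauss_complex :: "real \<Rightarrow> complex measure" where
  "gauss_complex \<sigma> = distr (gauss1 \<sigma> \<Otimes>\<^sub>M gauss1 \<sigma>) borel (\<lambda>(x, y). Complex x y)"

definition gauss_prod :: "real \<Rightarrow> (nat \<Rightarrow> real) \<Rightarrow> (nat \<Rightarrow> complex) measure" where
  "gauss_prod r a = Pi\<^sub>M UNIV (\<lambda>i. gauss_complex (r * a i))"

text \<open>
  The underlying sigma-algebra is the trace of the product sigma-algebra; it is the Borel
  sigma-algebra of the norm topology by \<open>sets_gauss_ell2\<close> below.
\<close>

definition gauss_ell2 :: "real \<Rightarrow> (nat \<Rightarrow> real) \<Rightarrow> (nat \<Rightarrow> complex) measure" where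
  "gauss_ell2 r a = restrict_space (gauss_prod r a) ell2"


lemma prob_space_gauss1: "\<sigma> > 0 \<Longrightarrow> prob_space (gauss1 \<sigma>)"
  unfolding gauss1_def by (rule prob_space_normal_density)

lemma sets_gauss1 [measurable_cong, simp]: "sets (gauss1 \<sigma>) = sets borel"
  by (simp add: gauss1_def)

lemma sets_gauss_complex [measurable_cong, simp]: "sets (gauss_complex \<sigma>) = sets borel"
  by (simp add: gauss_complex_def)

lemma measurable_Complex_pair: "(\<lambda>(x, y). Complex x y) \<in> borel \<Otimes>\<^sub>M borel \<rightarrow>\<^sub>M borel"
proof -
  have "continuous_on UNIV (\<lambda>p::real \<times> real. Complex (fst p) (snd p))"
    unfolding Complex_eq by (intro continuous_intros)
  then have "(\<lambda>p::real \<times> real. Complex (fst p) (snd p)) \<in> borel_measurable borel"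
    by (rule borel_measurable_continuous_onI)
  then show ?thesis by (simp add: borel_prod split_beta')
qed

lemma measurable_Complex_gauss1:
  "(\<lambda>(x, y). Complex x y) \<in> gauss1 \<sigma> \<Otimes>\<^sub>M gauss1 \<sigma> \<rightarrow>\<^sub>M borel"
  using measurable_Complex_pair
  by (subst measurable_cong_sets[OF sets_pair_measure_cong[OF sets_gauss1 sets_gauss1] refl])

lemma prob_space_gauss_complex:
  assumes "\<sigma> > 0" shows "prob_space (gauss_complex \<sigma>)"
proof -
  interpret g: prob_space "gauss1 \<sigma>" by (rule prob_space_gauss1[OF assms])
  interpret pair_prob_space "gauss1 \<sigma>" "gauss1 \<sigma>" ..
  show ?thesis
    unfolding gauss_complex_def by (rule prob_space_distr[OF measurable_Complex_gauss1])
qed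

lemma sets_gauss_prod: "sets (gauss_prod r a) = sets borel"
proof -
  have "sets (gauss_prod r a) = sets (Pi\<^sub>M UNIV (\<lambda>i::nat. borel :: complex measure))"
    unfolding gauss_prod_def by (intro sets_PiM_cong) auto
  then show ?thesis by (simp add: sets_PiM_equal_borel)
qed

lemma ell2_borel: "ell2 \<in> sets borel"
proof -
  have [measurable]: "(\<lambda>z::nat \<Rightarrow> complex. z i) \<in> borel_measurable borel" for i
    by (intro borel_measurable_continuous_onI continuous_on_product_coordinates)
  have "{z \<in> space borel. (\<Sum>i. ennreal ((cmod (z i))\<^sup>2)) < top} \<in> sets borel"
    by measurable
  moreover have eqv: "summable (\<lambda>i. (cmod (z i))\<^sup>2) \<longleftrightarrow> (\<Sum>i. ennreal ((cmod (z i))\<^sup>2)) < top"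
    for z :: "nat \<Rightarrow> complex"
  proof
    assume "summable (\<lambda>i. (cmod (z i))\<^sup>2)"
    then show "(\<Sum>i. ennreal ((cmod (z i))\<^sup>2)) < top"
      by (simp add: ennreal_suminf_neq_top less_top)
  next
    assume "(\<Sum>i. ennreal ((cmod (z i))\<^sup>2)) < top"
    then show "summable (\<lambda>i. (cmod (z i))\<^sup>2)"
      by (intro summable_suminf_not_top) (auto simp: less_top)
  qed
  ultimately show ?thesis unfolding ell2_def eqv space_borel by (simp only: UNIV_I simp_thms)
qed

lemma nn_integral_gauss1_sq:
  assumes "\<sigma> > 0"
  shows "(\<integral>\<^sup>+x. ennreal (x\<^sup>2) \<partial>gauss1 \<sigma>) = ennreal (\<sigma>\<^sup>2)"
proof -
  have "has_bochner_integral lborel (\<lambda>x. normal_density 0 \<sigma> x * (x - 0) ^ (2 * 1))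
          (fact (2 * 1) / ((2 / \<sigma>\<^sup>2) ^ 1 * fact 1))"
    using normal_moment_even[OF assms, of 0 1] by simp
  then have h: "has_bochner_integral lborel (\<lambda>x. normal_density 0 \<sigma> x * x\<^sup>2) (\<sigma>\<^sup>2)"
    by (simp add: fact_numeral)
  have "(\<integral>\<^sup>+x. ennreal (x\<^sup>2) \<partial>gauss1 \<sigma>) = (\<integral>\<^sup>+x. ennreal (normal_density 0 \<sigma> x * x\<^sup>2) \<partial>lborel)"
    unfolding gauss1_def by (subst nn_integral_density) (auto simp: ennreal_mult')
  also have "\<dots> = ennreal (\<sigma>\<^sup>2)"
    using h has_bochner_integral_integral_eq[OF h]
    by (subst nn_integral_eq_integral) (auto simp: has_bochner_integral_iff)
  finally show ?thesis .
qed

lemma nn_integral_gauss_complex_sq: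
  assumes "\<sigma> > 0"
  shows "(\<integral>\<^sup>+z. ennreal ((cmod z)\<^sup>2) \<partial>gauss_complex \<sigma>) = ennreal (2 * \<sigma>\<^sup>2)"
proof -
  interpret g: prob_space "gauss1 \<sigma>" by (rule prob_space_gauss1[OF assms])
  have "(\<integral>\<^sup>+z. ennreal ((cmod z)\<^sup>2) \<partial>gauss_complex \<sigma>)
      = (\<integral>\<^sup>+p. ennreal ((fst p)\<^sup>2) + ennreal ((snd p)\<^sup>2) \<partial>(gauss1 \<sigma> \<Otimes>\<^sub>M gauss1 \<sigma>))"
    unfolding gauss_complex_def
    by (subst nn_integral_distr[OF measurable_Complex_gauss1])
       (auto simp: split_beta' cmod_power2 ennreal_plus intro!: nn_integral_cong)
  also have "\<dots> = (\<integral>\<^sup>+x. \<integral>\<^sup>+y. ennreal (x\<^sup>2) + ennreal (y\<^sup>2) \<partial>gauss1 \<sigma> \<partial>gauss1 \<sigma>)"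
    by (subst g.nn_integral_fst[symmetric]) auto
  also have "\<dots> = ennreal (\<sigma>\<^sup>2) + ennreal (\<sigma>\<^sup>2)"
    by (simp add: nn_integral_add nn_integral_gauss1_sq[OF assms] g.emeasure_space_1)
  finally show ?thesis by (simp add: ennreal_plus[symmetric] del: ennreal_plus)
qed

lemma AE_gauss_prod_ell2:
  assumes "r > 0" and "\<And>i. a i > 0" and "summable a"
  shows "AE z in gauss_prod r a. z \<in> ell2"
proof -
  have ps: "prob_space (gauss_complex (r * a i))" for i
    using assms by (intro prob_space_gauss_complex) auto
  have m: "(\<lambda>z. z i) \<in> gauss_prod r a \<rightarrow>\<^sub>M gauss_complex (r * a i)" for i
    unfolding gauss_prod_def by measurable
  have m2: "(\<lambda>z. z i) \<in> borel_measurable (gauss_prod r a)" for i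
    using m[of i] by (subst measurable_cong_sets[OF refl sets_gauss_complex[symmetric]])
  have sqm: "(\<lambda>w. (cmod w)\<^sup>2) \<in> borel_measurable (gauss_complex (r * a i))" for i
    by measurable
  have m3: "(\<lambda>z. ennreal ((cmod (z i))\<^sup>2)) \<in> borel_measurable (gauss_prod r a)" for i
    by (intro measurable_compose[OF m2]) measurable
  have one: "(\<integral>\<^sup>+z. ennreal ((cmod (z i))\<^sup>2) \<partial>gauss_prod r a) = ennreal (2 * (r * a i)\<^sup>2)" for i
  proof -
    have "gauss_complex (r * a i) = distr (gauss_prod r a) (gauss_complex (r * a i)) (\<lambda>z. z i)"
      unfolding gauss_prod_def by (rule distr_PiM_component[symmetric]) (use ps in auto)
    then have "(\<integral>\<^sup>+z. ennreal ((cmod (z i))\<^sup>2) \<partial>gauss_prod r a)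
        = (\<integral>\<^sup>+w. ennreal ((cmod w)\<^sup>2) \<partial>gauss_complex (r * a i))"
      using nn_integral_distr[OF m, of "\<lambda>w. ennreal ((cmod w)\<^sup>2)" i] sqm by simp
    then show ?thesis using assms by (simp add: nn_integral_gauss_complex_sq)
  qed
  have sa: "summable (\<lambda>i. 2 * (r * a i)\<^sup>2)"
  proof -
    have "eventually (\<lambda>i. a i < 1) sequentially"
      using summable_LIMSEQ_zero[OF assms(3)] by (rule order_tendstoD) simp
    then have "eventually (\<lambda>i. norm ((a i)\<^sup>2) \<le> a i) sequentially"
      by eventually_elim (use assms(2) in \<open>auto simp: power2_eq_square less_imp_le mult_left_le\<close>)
    then have "summable (\<lambda>i. (a i)\<^sup>2)" using assms(3) by (rule summable_comparison_test_ev)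
    then show ?thesis by (auto simp: power_mult_distrib intro!: summable_mult)
  qed
  have "(\<integral>\<^sup>+z. (\<Sum>i. ennreal ((cmod (z i))\<^sup>2)) \<partial>gauss_prod r a) = (\<Sum>i. ennreal (2 * (r * a i)\<^sup>2))"
    by (subst nn_integral_suminf) (simp_all add: one m3)
  also have "\<dots> = ennreal (\<Sum>i. 2 * (r * a i)\<^sup>2)"
    by (rule suminf_ennreal2[OF _ sa]) simp
  also have "\<dots> \<noteq> \<infinity>"
    by (rule ennreal_neq_top[folded infinity_ennreal_def])
  finally have "AE z in gauss_prod r a. (\<Sum>i. ennreal ((cmod (z i))\<^sup>2)) \<noteq> \<infinity>"
    by (rule nn_integral_PInf_AE[OF borel_measurable_suminf_order[OF m3]])
  then show ?thesis
  proof eventually_elim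
    case (elim z)
    have "summable (\<lambda>i. (cmod (z i))\<^sup>2)"
      using elim by (intro summable_suminf_not_top) auto
    then show ?case by (simp add: ell2_def)
  qed
qed

lemma prob_space_gauss_prod:
  assumes "r > 0" and "\<And>i. a i > 0"
  shows "prob_space (gauss_prod r a)"
  unfolding gauss_prod_def
  by (intro prob_space_PiM prob_space_gauss_complex) (use assms in auto)

lemma prob_space_gauss_ell2:
  assumes "r > 0" and "\<And>i. a i > 0" and "summable a"
  shows "prob_space (gauss_ell2 r a)"
proof -
  interpret prob_space "gauss_prod r a" using assms(1,2) by (rule prob_space_gauss_prod)
  have "space (gauss_prod r a) = UNIV"
    using sets_eq_imp_space_eq[OF sets_gauss_prod[of r a]] by simp
  moreover have "emeasure (gauss_prod r a) ell2 = 1"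
    using AE_gauss_prod_ell2[OF assms] ell2_borel sets_gauss_prod[of r a]
    by (intro emeasure_eq_1_AE) auto
  ultimately show ?thesis
    unfolding gauss_ell2_def using ell2_borel sets_gauss_prod[of r a]
    by (intro prob_spaceI) (simp add: space_restrict_space emeasure_restrict_space)
qed

lemma ell2_diff_summable:
  assumes "w \<in> ell2" "z \<in> ell2"
  shows "summable (\<lambda>i. (cmod (w i - z i))\<^sup>2)"
    and "(\<Sum>i. (cmod (w i - z i))\<^sup>2) \<ge> 0"
proof -
  have le: "(cmod (w i - z i))\<^sup>2 \<le> 2 * (cmod (w i))\<^sup>2 + 2 * (cmod (z i))\<^sup>2" for i
  proof -
    have "(cmod (w i - z i))\<^sup>2 \<le> (cmod (w i) + cmod (z i))\<^sup>2"
      by (intro power_mono norm_triangle_ineq4) auto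
    also have "\<dots> \<le> 2 * (cmod (w i))\<^sup>2 + 2 * (cmod (z i))\<^sup>2"
      using sum_squares_bound[of "cmod (w i)" "cmod (z i)"] by (simp add: power2_sum)
    finally show ?thesis .
  qed
  show "summable (\<lambda>i. (cmod (w i - z i))\<^sup>2)"
  proof (rule summable_comparison_test')
    show "summable (\<lambda>i. 2 * (cmod (w i))\<^sup>2 + 2 * (cmod (z i))\<^sup>2)"
      using assms by (intro summable_add summable_mult) (auto simp: ell2_def)
  qed (use le in auto)
  then show "(\<Sum>i. (cmod (w i - z i))\<^sup>2) \<ge> 0" by (intro suminf_nonneg) auto
qed

lemma ell2_quasi_triangle:
  assumes "w \<in> ell2" "q \<in> ell2" "z \<in> ell2"
  shows "(\<Sum>i. (cmod (w i - z i))\<^sup>2)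
       \<le> 2 * (\<Sum>i. (cmod (w i - q i))\<^sup>2) + 2 * (\<Sum>i. (cmod (z i - q i))\<^sup>2)"
proof -
  have le: "(cmod (w i - z i))\<^sup>2 \<le> 2 * (cmod (w i - q i))\<^sup>2 + 2 * (cmod (z i - q i))\<^sup>2" for i
  proof -
    have "(cmod (w i - z i))\<^sup>2 \<le> (cmod (w i - q i) + cmod (z i - q i))\<^sup>2"
      using norm_triangle_ineq4[of "w i - q i" "z i - q i"] by (intro power_mono) auto
    also have "\<dots> \<le> 2 * (cmod (w i - q i))\<^sup>2 + 2 * (cmod (z i - q i))\<^sup>2"
      using sum_squares_bound[of "cmod (w i - q i)" "cmod (z i - q i)"] by (simp add: power2_sum)
    finally show ?thesis .
  qed
  have s1: "summable (\<lambda>i. (cmod (w i - q i))\<^sup>2)" and s2: "summable (\<lambda>i. (cmod (z i - q i))\<^sup>2)"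
    using ell2_diff_summable assms by auto
  have "(\<Sum>i. (cmod (w i - z i))\<^sup>2) \<le> (\<Sum>i. 2 * (cmod (w i - q i))\<^sup>2 + 2 * (cmod (z i - q i))\<^sup>2)"
    using assms ell2_diff_summable le by (intro suminf_le summable_add summable_mult) auto
  also have "\<dots> = 2 * (\<Sum>i. (cmod (w i - q i))\<^sup>2) + 2 * (\<Sum>i. (cmod (z i - q i))\<^sup>2)"
    using s1 s2 by (simp add: suminf_add[symmetric] suminf_mult summable_mult)
  finally show ?thesis .
qed

lemma ell2_separable:
  obtains Q :: "(nat \<Rightarrow> complex) set"
  where "countable Q" "Q \<subseteq> ell2"
    "\<And>z e. z \<in> ell2 \<Longrightarrow> e > 0 \<Longrightarrow> \<exists>q\<in>Q. (\<Sum>i. (cmod (z i - q i))\<^sup>2) < e"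
proof -
  obtain D :: "complex set" where D: "countable D" "\<And>X. open X \<Longrightarrow> X \<noteq> {} \<Longrightarrow> \<exists>d\<in>D. d \<in> X"
    using countable_dense_exists by blast
  define ext :: "complex list \<Rightarrow> nat \<Rightarrow> complex"
    where "ext xs = (\<lambda>i. if i < length xs then xs ! i else 0)" for xs
  define Q where "Q = ext ` lists D"
  have ext_ell2: "ext xs \<in> ell2" for xs
    unfolding ell2_def mem_Collect_eq
    by (rule summable_finite[of "{..<length xs}"]) (auto simp: ext_def)
  show thesis
  proof (rule that)
    show "countable Q" unfolding Q_def using D(1) by auto
    show "Q \<subseteq> ell2" using ext_ell2 by (auto simp: Q_def)
    fix z and e :: real assume z: "z \<in> ell2" and e: "e > 0"
    have sz: "summable (\<lambda>i. (cmod (z i))\<^sup>2)" using z by (simp add: ell2_def)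
    obtain n where n: "norm (\<Sum>i. (cmod (z (i + n)))\<^sup>2) < e / 2"
      using suminf_exist_split[of "e/2", OF _ sz] e by auto
    define \<rho> where "\<rho> = sqrt (e / (2 * (real n + 1)))"
    have \<rho>: "\<rho> > 0" "\<rho>\<^sup>2 = e / (2 * (real n + 1))" using e by (auto simp: \<rho>_def)
    have "\<forall>i. \<exists>d\<in>D. d \<in> ball (z i) \<rho>" using D(2)[of "ball (z _) \<rho>"] \<rho> by (metis open_ball ball_eq_empty not_le)
    then obtain d where d: "\<And>i. d i \<in> D" "\<And>i. dist (z i) (d i) < \<rho>" by (metis mem_ball)
    define xs where "xs = map d [0..<n]"
    have "xs \<in> lists D" using d by (auto simp: xs_def)
    then have "ext xs \<in> Q" unfolding Q_def by (rule imageI)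
    moreover have "(\<Sum>i. (cmod (z i - ext xs i))\<^sup>2) < e"
    proof -
      have "(\<Sum>i. (cmod (z i - ext xs i))\<^sup>2)
          = (\<Sum>i. (cmod (z (i + n) - ext xs (i + n)))\<^sup>2) + (\<Sum>i<n. (cmod (z i - ext xs i))\<^sup>2)"
        by (rule suminf_split_initial_segment[OF ell2_diff_summable(1)[OF z ext_ell2]])
      also have "(\<Sum>i. (cmod (z (i + n) - ext xs (i + n)))\<^sup>2) = (\<Sum>i. (cmod (z (i + n)))\<^sup>2)"
        by (simp add: ext_def xs_def)
      also have "(\<Sum>i<n. (cmod (z i - ext xs i))\<^sup>2) \<le> (\<Sum>i<n. \<rho>\<^sup>2)"
      proof (rule sum_mono)
        fix i assume "i \<in> {..<n}"
        then show "(cmod (z i - ext xs i))\<^sup>2 \<le> \<rho>\<^sup>2"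
          using d(2)[of i] by (intro power_mono) (auto simp: ext_def xs_def dist_norm)
      qed
      also have "(\<Sum>i<n. \<rho>\<^sup>2) \<le> e / 2"
        using e by (simp add: \<rho> field_simps)
      finally show ?thesis using n by simp
    qed
    ultimately show "\<exists>q\<in>Q. (\<Sum>i. (cmod (z i - q i))\<^sup>2) < e" by blast
  qed
qed

lemma ell2_open_borel:
  assumes "ell2_open U" shows "U \<in> sets borel"
proof -
  have [measurable]: "(\<lambda>z::nat \<Rightarrow> complex. z i) \<in> borel_measurable borel" for i
    by (intro borel_measurable_continuous_onI continuous_on_product_coordinates)
  obtain Q where Q: "countable Q" "Q \<subseteq> ell2"
    "\<And>z e. z \<in> ell2 \<Longrightarrow> e > 0 \<Longrightarrow> \<exists>q\<in>Q. (\<Sum>i. (cmod (z i - q i))\<^sup>2) < e"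
    using ell2_separable by blast
  define B where "B q \<rho> = {w \<in> ell2. (\<Sum>i. (cmod (w i - q i))\<^sup>2) < \<rho>}"
    for q :: "nat \<Rightarrow> complex" and \<rho> :: real
  have B: "B q \<rho> \<in> sets borel" for q \<rho>
  proof -
    have "{w \<in> space borel. (\<Sum>i. (cmod (w i - q i))\<^sup>2) < \<rho>} \<in> sets borel" by measurable
    then have "ell2 \<inter> {w \<in> space borel. (\<Sum>i. (cmod (w i - q i))\<^sup>2) < \<rho>} \<in> sets borel"
      using ell2_borel by blast
    then show ?thesis by (simp add: B_def Int_def)
  qed
  define C where "C = {(q, \<rho>). q \<in> Q \<and> \<rho> \<in> \<rat> \<and> B q \<rho> \<subseteq> U}"
  have "C \<subseteq> Q \<times> \<rat>" by (auto simp: C_def)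
  then have "countable C" using Q(1) countable_rat by (meson countable_SIGMA countable_subset)
  moreover have "U = (\<Union>(q, \<rho>)\<in>C. B q \<rho>)"
  proof
    show "U \<subseteq> (\<Union>(q, \<rho>)\<in>C. B q \<rho>)"
    proof
      fix z assume z: "z \<in> U"
      then obtain e where e: "e > 0" "\<And>w. w \<in> ell2 \<Longrightarrow> ell2_dist w z < e \<Longrightarrow> w \<in> U"
        using assms unfolding ell2_open_def by blast
      have z2: "z \<in> ell2" using z assms by (auto simp: ell2_open_def)
      obtain q where q: "q \<in> Q" "(\<Sum>i. (cmod (z i - q i))\<^sup>2) < e\<^sup>2 / 4"
        using Q(3)[OF z2, of "e\<^sup>2 / 4"] e by auto
      obtain \<rho> where \<rho>: "\<rho> \<in> \<rat>" "(\<Sum>i. (cmod (z i - q i))\<^sup>2) < \<rho>" "\<rho> < e\<^sup>2 / 4"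
        using Rats_dense_in_real[OF q(2)] by auto
      have "B q \<rho> \<subseteq> U"
      proof
        fix w assume w: "w \<in> B q \<rho>"
        then have w2: "w \<in> ell2" by (simp add: B_def)
        have "(\<Sum>i. (cmod (w i - z i))\<^sup>2) < e\<^sup>2"
          using ell2_quasi_triangle[OF w2 _ z2, of q] q Q(2) w \<rho> by (auto simp: B_def)
        then have "ell2_dist w z < e"
          unfolding ell2_dist_def using e(1) by (simp add: real_less_lsqrt)
        then show "w \<in> U" using e(2) w2 by blast
      qed
      then show "z \<in> (\<Union>(q, \<rho>)\<in>C. B q \<rho>)" using q \<rho> z2 by (auto simp: C_def B_def)
    qed
    show "(\<Union>(q, \<rho>)\<in>C. B q \<rho>) \<subseteq> U" by (auto simp: C_def)
  qed
  ultimately show ?thesis using B by (auto intro!: sets.countable_UN')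
qed

lemma sets_gauss_ell2: "sets (gauss_ell2 r a) = sigma_sets ell2 {U. ell2_open U}"
proof
  have eq: "sets (gauss_ell2 r a) = (\<inter>) ell2 ` sets borel"
    unfolding gauss_ell2_def by (simp add: sets_restrict_space sets_gauss_prod)
  have sub: "{U. ell2_open U} \<subseteq> Pow ell2" by (auto simp: ell2_open_def)
  show "sigma_sets ell2 {U. ell2_open U} \<subseteq> sets (gauss_ell2 r a)"
  proof -
    have sp: "space (gauss_ell2 r a) = ell2"
      using sets_eq_imp_space_eq[OF sets_gauss_prod[of r a]]
      by (simp add: gauss_ell2_def space_restrict_space)
    have "U \<in> sets (gauss_ell2 r a)" if "ell2_open U" for U
    proof -
      have "U = ell2 \<inter> U" using that by (auto simp: ell2_open_def)
      then show ?thesis using ell2_open_borel[OF that] unfolding eq by blast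
    qed
    then show ?thesis using sets.sigma_sets_subset[of "{U. ell2_open U}" "gauss_ell2 r a"]
      unfolding sp by blast
  qed
  show "sets (gauss_ell2 r a) \<subseteq> sigma_sets ell2 {U. ell2_open U}"
  proof -
    define N where "N = sigma ell2 {U. ell2_open U}"
    have sN: "sets N = sigma_sets ell2 {U. ell2_open U}" and spN: "space N = ell2"
      using sub by (auto simp: N_def)
    have coord: "(\<lambda>z. z i) \<in> N \<rightarrow>\<^sub>M borel" for i
    proof (rule borel_measurableI)
      fix S :: "complex set" assume S: "open S"
      have "ell2_open ((\<lambda>z. z i) -` S \<inter> ell2)"
        unfolding ell2_open_def
      proof (intro conjI ballI)
        fix z assume z: "z \<in> (\<lambda>z. z i) -` S \<inter> ell2"
        then obtain e where e: "e > 0" "ball (z i) e \<subseteq> S"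
          using S by (auto elim: openE)
        have "w i \<in> S" if w: "w \<in> ell2" "ell2_dist w z < e" for w
        proof -
          have s: "summable (\<lambda>i. (cmod (w i - z i))\<^sup>2)" using ell2_diff_summable z w by auto
          have "(\<Sum>j\<in>{i}. (cmod (w j - z j))\<^sup>2) \<le> (\<Sum>i. (cmod (w i - z i))\<^sup>2)"
            by (rule sum_le_suminf[OF s]) auto
          then have "cmod (w i - z i) \<le> ell2_dist w z"
            unfolding ell2_dist_def by (simp add: real_le_rsqrt)
          then have "w i \<in> ball (z i) e" using w by (simp add: dist_norm norm_minus_commute)
          then show ?thesis using e by blast
        qed
        then show "\<exists>e>0. \<forall>w\<in>ell2. ell2_dist w z < e \<longrightarrow> w \<in> (\<lambda>z. z i) -` S \<inter> ell2"
          using e(1) by auto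
      qed auto
      then show "(\<lambda>z. z i) -` S \<inter> space N \<in> sets N" unfolding sN spN by auto
    qed
    have "(\<lambda>z. z) \<in> N \<rightarrow>\<^sub>M Pi\<^sub>M UNIV (\<lambda>i::nat. borel :: complex measure)"
      by (rule measurable_PiM_single') (use coord in auto)
    then have "(\<lambda>z. z) \<in> N \<rightarrow>\<^sub>M borel"
      by (subst measurable_cong_sets[OF refl sets_PiM_equal_borel[symmetric]])
    then have "ell2 \<inter> A \<in> sets N" if "A \<in> sets borel" for A
      using measurable_sets[OF _ that, of "\<lambda>z. z" N] by (simp add: spN Int_commute)
    then show ?thesis unfolding eq sN[symmetric] by blast
  qed
qed


subsection \<open>Smooth compactly supported cylinder functions\<close>

text \<open>
  \<open>pderiv_dir i 1\<close> is the partial derivative in \<open>x\<^sub>i\<close> and \<open>pderiv_dir i \<i>\<close> the one in \<open>y\<^sub>i\<close>.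
\<close>

definition pderiv_dir ::
    "nat \<Rightarrow> complex \<Rightarrow> ((nat \<Rightarrow> complex) \<Rightarrow> complex) \<Rightarrow> (nat \<Rightarrow> complex) \<Rightarrow> complex" where
  "pderiv_dir i c \<phi> z = vector_derivative (\<lambda>h::real. \<phi> (z(i := z i + of_real h * c))) (at 0)"

definition pderivs ::
    "(nat \<times> complex) list \<Rightarrow> ((nat \<Rightarrow> complex) \<Rightarrow> complex) \<Rightarrow> (nat \<Rightarrow> complex) \<Rightarrow> complex" where
  "pderivs ds \<phi> = foldr (\<lambda>(i, c). pderiv_dir i c) ds \<phi>"

text \<open>
  Functions on \<open>\<complex>\<^sup>n\<close> are represented as functions of a sequence depending only on its first \<open>n\<close>
  entries, and \<open>\<complex>\<^sup>n\<close> itself as the sequences vanishing from position \<open>n\<close> on.  For such functions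
  continuity in the topology of pointwise convergence is continuity on \<open>\<complex>\<^sup>n\<close>.  Smoothness is
  existence and continuity of all iterated partial derivatives.
\<close>

definition smooth_cyl :: "nat \<Rightarrow> ((nat \<Rightarrow> complex) \<Rightarrow> complex) \<Rightarrow> bool" where
  "smooth_cyl n \<phi> \<longleftrightarrow>
     (\<forall>z w. (\<forall>i<n. z i = w i) \<longrightarrow> \<phi> z = \<phi> w) \<and>
     (\<forall>ds. set ds \<subseteq> {..<n} \<times> {1, \<i>} \<longrightarrow>
        continuous_on UNIV (pderivs ds \<phi>) \<and>
        (\<forall>z. \<forall>i<n. \<forall>c\<in>{1, \<i>}.
           (\<lambda>h::real. pderivs ds \<phi> (z(i := z i + of_real h * c))) differentiable (at 0)))"

definition compact_supp_cyl :: "nat \<Rightarrow> ((nat \<Rightarrow> complex) \<Rightarrow> complex) \<Rightarrow> bool" where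
  "compact_supp_cyl n \<phi> \<longleftrightarrow> compact (closure {z. (\<forall>i\<ge>n. z i = 0) \<and> \<phi> z \<noteq> 0})"

definition test_funs :: "((nat \<Rightarrow> complex) \<Rightarrow> complex) set" where
  "test_funs = (\<Union>n\<in>{1..}. {\<phi>. smooth_cyl n \<phi> \<and> compact_supp_cyl n \<phi>})"

definition dz :: "nat \<Rightarrow> ((nat \<Rightarrow> complex) \<Rightarrow> complex) \<Rightarrow> (nat \<Rightarrow> complex) \<Rightarrow> complex" where
  "dz i \<phi> z = (pderiv_dir i 1 \<phi> z - \<i> * pderiv_dir i \<i> \<phi> z) / 2"

definition delta_op :: "real \<Rightarrow> (nat \<Rightarrow> real) \<Rightarrow> nat \<Rightarrow> ((nat \<Rightarrow> complex) \<Rightarrow> complex) \<Rightarrow>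
    (nat \<Rightarrow> complex) \<Rightarrow> complex" where
  "delta_op r a i \<phi> z = dz i \<phi> z - cnj (z i) / of_real (2 * r\<^sup>2 * (a i)\<^sup>2) * \<phi> z"


subsection \<open>Forms\<close>

definition multi_indices :: "nat \<Rightarrow> nat list set" where
  "multi_indices s = {I. sorted_wrt (<) I \<and> length I = s}"

text \<open>
  A form is its family of coefficients \<open>f I J\<close>; for an \<open>(s, t)\<close>-form only those with \<open>I\<close> in
  \<open>multi_indices s\<close> and \<open>J\<close> in \<open>multi_indices t\<close> are ever used.
\<close>

type_synonym form = "nat list \<Rightarrow> nat list \<Rightarrow> (nat \<Rightarrow> complex) \<Rightarrow> complex"

definition weight :: "(nat \<Rightarrow> real) \<Rightarrow> nat list \<Rightarrow> nat list \<Rightarrow> real" where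
  "weight a I J = (\<Prod>i\<leftarrow>I. (a i)\<^sup>2) * (\<Prod>j\<leftarrow>J. (a j)\<^sup>2)"

definition eps :: "nat list \<Rightarrow> nat \<Rightarrow> nat list \<Rightarrow> int" where
  "eps K j J =
     (if set K = set J \<union> {j}
      then sign (THE p. p permutes {..<length K} \<and> permute_list p (j # J) = K) else 0)"

lemma eps_perm_ex1:
  assumes "J \<in> multi_indices t" and "K \<in> multi_indices (t + 1)" and "set K = set J \<union> {j}"
  shows "\<exists>!p. p permutes {..<length K} \<and> permute_list p (j # J) = K"
proof -
  have dK: "distinct K" and lK: "length K = length (j # J)"
    using assms by (auto simp: multi_indices_def strict_sorted_iff)
  have "card (set (j # J)) = length (j # J)"
    using assms(3) distinct_card[OF dK] lK by simp
  then have d: "distinct (j # J)" by (rule card_distinct)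
  have "mset K = mset (j # J)"
    using d dK assms(3) set_eq_iff_mset_eq_distinct[OF dK d] by auto
  then obtain p where p: "p permutes {..<length (j # J)}" "permute_list p (j # J) = K"
    using mset_eq_permutation by metis
  show ?thesis
  proof (rule ex1I[of _ p])
    show "p permutes {..<length K} \<and> permute_list p (j # J) = K" using p lK by simp
    fix q assume q: "q permutes {..<length K} \<and> permute_list q (j # J) = K"
    show "q = p"
    proof
      fix i
      show "q i = p i"
      proof (cases "i < length K")
        case True
        then have "(j # J) ! q i = (j # J) ! p i"
          using p q lK permute_list_nth[of p "j # J" i] permute_list_nth[of q "j # J" i] by auto
        moreover have "q i < length (j # J)" "p i < length (j # J)"
          using p(1) q lK True permutes_in_image[of p _ i] permutes_in_image[of q _ i] by auto
        ultimately show ?thesis using d nth_eq_iff_index_eq by blast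
      next
        case False
        then show ?thesis using p q lK by (simp add: permutes_def)
      qed
    qed
  qed
qed

definition L2_fun :: "'a measure \<Rightarrow> ('a \<Rightarrow> complex) set" where
  "L2_fun M = {g \<in> borel_measurable M. integrable M (\<lambda>x. (cmod (g x))\<^sup>2)}"

text \<open>
  Elements of the Hilbert spaces are handled through representatives: no quotient by almost
  everywhere equality is taken.
\<close>

definition L2_form :: "real \<Rightarrow> (nat \<Rightarrow> real) \<Rightarrow> nat \<Rightarrow> nat \<Rightarrow> form set" where
  "L2_form r a s t =
     {f. (\<forall>I\<in>multi_indices s. \<forall>J\<in>multi_indices t. f I J \<in> L2_fun (gauss_ell2 r a)) \<and>
         (\<lambda>(I, J). weight a I J * (LINT z|gauss_ell2 r a. (cmod (f I J z))\<^sup>2))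
           summable_on (multi_indices s \<times> multi_indices t)}"

definition form_inner :: "real \<Rightarrow> (nat \<Rightarrow> real) \<Rightarrow> nat \<Rightarrow> nat \<Rightarrow> form \<Rightarrow> form \<Rightarrow> complex" where
  "form_inner r a s t f g =
     (\<Sum>\<^sub>\<infinity>(I, J)\<in>multi_indices s \<times> multi_indices t.
        of_real (weight a I J) * (LINT z|gauss_ell2 r a. f I J z * cnj (g I J z)))"

definition form_norm :: "real \<Rightarrow> (nat \<Rightarrow> real) \<Rightarrow> nat \<Rightarrow> nat \<Rightarrow> form \<Rightarrow> real" where
  "form_norm r a s t f =
     sqrt (\<Sum>\<^sub>\<infinity>(I, J)\<in>multi_indices s \<times> multi_indices t.
        weight a I J * (LINT z|gauss_ell2 r a. (cmod (f I J z))\<^sup>2))"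


subsection \<open>The operator and its adjoint\<close>

text \<open>
  For fixed \<open>K\<close> the double sum over \<open>i\<close> and \<open>J\<close> has only finitely many nonzero terms.
\<close>

definition dbar_coeffs ::
    "real \<Rightarrow> (nat \<Rightarrow> real) \<Rightarrow> nat \<Rightarrow> nat \<Rightarrow> form \<Rightarrow> form \<Rightarrow> bool" where
  "dbar_coeffs r a s t f g \<longleftrightarrow>
     g \<in> L2_form r a s (t + 1) \<and>
     (\<forall>I\<in>multi_indices s. \<forall>K\<in>multi_indices (t + 1). \<forall>\<phi>\<in>test_funs.
        (LINT z|gauss_ell2 r a. g I K z * cnj (\<phi> z)) =
        - (LINT z|gauss_ell2 r a.
             (\<Sum>\<^sub>\<infinity>i. \<Sum>\<^sub>\<infinity>J\<in>multi_indices t.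
                of_int (eps K i J) * f I J z * cnj (delta_op r a i \<phi> z))))"

definition dom_dbar :: "real \<Rightarrow> (nat \<Rightarrow> real) \<Rightarrow> nat \<Rightarrow> nat \<Rightarrow> form set" where
  "dom_dbar r a s t = {f \<in> L2_form r a s t. \<exists>g. dbar_coeffs r a s t f g}"

text \<open>
  The choices below are made among representatives of one element: \<open>g\<close> is determined almost
  everywhere because the test functions are dense, and the value of the adjoint because the
  domain of the operator is dense.
\<close>

definition dbar :: "real \<Rightarrow> (nat \<Rightarrow> real) \<Rightarrow> nat \<Rightarrow> nat \<Rightarrow> form \<Rightarrow> form" where
  "dbar r a s t f = (\<lambda>I K z. (-1) ^ s * (SOME g. dbar_coeffs r a s t f g) I K z)"

definition is_dbar_adj ::
    "real \<Rightarrow> (nat \<Rightarrow> real) \<Rightarrow> nat \<Rightarrow> nat \<Rightarrow> form \<Rightarrow> form \<Rightarrow> bool" where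
  "is_dbar_adj r a s t f h \<longleftrightarrow>
     h \<in> L2_form r a s t \<and>
     (\<forall>u\<in>dom_dbar r a s t.
        form_inner r a s (t + 1) (dbar r a s t u) f = form_inner r a s t u h)"

definition dom_dbar_adj :: "real \<Rightarrow> (nat \<Rightarrow> real) \<Rightarrow> nat \<Rightarrow> nat \<Rightarrow> form set" where
  "dom_dbar_adj r a s t = {f \<in> L2_form r a s (t + 1). \<exists>h. is_dbar_adj r a s t f h}"

definition dbar_adj :: "real \<Rightarrow> (nat \<Rightarrow> real) \<Rightarrow> nat \<Rightarrow> nat \<Rightarrow> form \<Rightarrow> form" where
  "dbar_adj r a s t f = (SOME h. is_dbar_adj r a s t f h)"

end

theory Submission
  imports Defs
begin

text \<open>
  The operator \<open>- \<delta>\<^sub>i\<close> is the adjoint of the derivative in the conjugate of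
  \<open>z\<^sub>i\<close>, and the complex Hermite polynomials obtained by applying \<open>- \<delta>\<^sub>i\<close> repeatedly to powers of
  \<open>z\<^sub>i\<close> are orthogonal: \<open>- \<delta>\<^sub>i\<close> raises their conjugate degree and the derivative lowers it.  Their
  products \<open>H(\<alpha>, \<beta>)\<close> are total in \<open>L\<^sup>2\<close>.  In terms of Hermite coefficients both operators are
  finite sums which preserve the index \<open>I\<close>, the degree \<open>\<alpha>\<close> and the combination \<open>\<gamma> = \<beta> + 1\<^sub>J\<close>.  On
  each such finite block they form a weighted Koszul complex, whose Laplacian is the scalar
  \<open>(\<Sum>\<gamma>) / (2 r\<^sup>2)\<close>, because the weight \<open>a\<^sub>i\<^sup>2\<close> cancels the variance; and \<open>\<Sum>\<gamma> \<ge> card J = t + 1\<close>.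
  Summing over the blocks, by Bessel's inequality for the two images and Parseval's identity for
  \<open>f\<close>, gives the estimate.
\<close>

subsection \<open>Bessel, completeness and Parseval\<close>

text \<open>The domain conditions are weak identities, so everything depends on what they are paired
  with. Hermite polynomials are not compactly supported; the identity defining the image of f is
  carried over to them by dilated cutoffs (\<open>weak_extend\<close>). The adjoint is paired with
  forms having one Hermite coefficient, whose image is explicit (\<open>gform\<close>); as
  \<open>dbar\<close> picks an arbitrary representative, this uses uniqueness almost everywhere, a
  second application of totality. The constant comes from two ratios. Lowering \<beta>_i by one
  multiplies the squared norm of a Hermite polynomial by v_i / \<beta>_i with v_i = 2 r^2 a_i^2, and
  adding i to J multiplies the weight by a_i^2. Inside a block the coefficient at J therefore
  carries \<kappa> (\<Prod>i\<in>J. \<gamma>_i) / (2 r^2)^(card J) with \<kappa> independent of J: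
  only powers of 2 r^2 separate consecutive degrees. The signs cancel the mixed terms of the two
  squares; each J keeps the \<gamma>_i with i in J from one square and those with i outside J from
  the other, and together these form the scalar.\<close>

definition L2_inner :: "'a measure \<Rightarrow> ('a \<Rightarrow> complex) \<Rightarrow> ('a \<Rightarrow> complex) \<Rightarrow> complex" where
  "L2_inner M f g = (LINT x|M. f x * cnj (g x))"

lemma L2_fun_measurable: "f \<in> L2_fun M \<Longrightarrow> f \<in> borel_measurable M"
  and L2_fun_integrable: "f \<in> L2_fun M \<Longrightarrow> integrable M (\<lambda>x. (cmod (f x))\<^sup>2)"
  by (auto simp: L2_fun_def)

lemma L2_fun_bound:
  assumes "g \<in> borel_measurable M" "integrable M h" "\<And>x. x \<in> space M \<Longrightarrow> (cmod (g x))\<^sup>2 \<le> h x"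
  shows "g \<in> L2_fun M"
  unfolding L2_fun_def
proof (intro CollectI conjI)
  show "integrable M (\<lambda>x. (cmod (g x))\<^sup>2)"
  proof (rule Bochner_Integration.integrable_bound[OF assms(2)])
    show "(\<lambda>x. (cmod (g x))\<^sup>2) \<in> borel_measurable M" using assms(1) by measurable
    show "AE x in M. norm ((cmod (g x))\<^sup>2) \<le> norm (h x)"
      using assms(3) by (intro AE_I2) (simp, meson abs_ge_self order_trans)
  qed
qed (use assms in auto)

lemma L2_fun_cmult [intro]: "f \<in> L2_fun M \<Longrightarrow> (\<lambda>x. c * f x) \<in> L2_fun M"
  by (auto simp: L2_fun_def norm_mult power_mult_distrib)

lemma L2_fun_add [intro]:
  assumes "f \<in> L2_fun M" "g \<in> L2_fun M" shows "(\<lambda>x. f x + g x) \<in> L2_fun M"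
proof (rule L2_fun_bound)
  show "(\<lambda>x. f x + g x) \<in> borel_measurable M" using assms by (auto simp: L2_fun_def)
  show "integrable M (\<lambda>x. 2 * (cmod (f x))\<^sup>2 + 2 * (cmod (g x))\<^sup>2)"
    using assms by (auto simp: L2_fun_def)
  fix x
  have "(cmod (f x + g x))\<^sup>2 \<le> (cmod (f x) + cmod (g x))\<^sup>2"
    by (intro power_mono norm_triangle_ineq) auto
  also have "\<dots> \<le> 2 * (cmod (f x))\<^sup>2 + 2 * (cmod (g x))\<^sup>2"
    using sum_squares_bound[of "cmod (f x)" "cmod (g x)"] by (simp add: power2_sum)
  finally show "(cmod (f x + g x))\<^sup>2 \<le> 2 * (cmod (f x))\<^sup>2 + 2 * (cmod (g x))\<^sup>2" .
qed

lemma L2_fun_diff [intro]: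
  "f \<in> L2_fun M \<Longrightarrow> g \<in> L2_fun M \<Longrightarrow> (\<lambda>x. f x - g x) \<in> L2_fun M"
  using L2_fun_add[of f M "\<lambda>x. -1 * g x"] L2_fun_cmult[of g M "-1"] by simp

lemma L2_fun_zero [simp, intro]: "(\<lambda>x. 0) \<in> L2_fun M"
  by (auto simp: L2_fun_def)

lemma L2_fun_sum [intro]:
  "(\<And>i. i \<in> F \<Longrightarrow> f i \<in> L2_fun M) \<Longrightarrow> (\<lambda>x. \<Sum>i\<in>F. f i x) \<in> L2_fun M"
  by (induction F rule: infinite_finite_induct) auto

lemma L2_fun_cnj [intro]: "f \<in> L2_fun M \<Longrightarrow> (\<lambda>x. cnj (f x)) \<in> L2_fun M"
  by (auto simp: L2_fun_def
      intro: borel_measurable_continuous_on[OF continuous_on_cnj[OF continuous_on_id], simplified])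

lemma L2_fun_mult_integrable:
  assumes "f \<in> L2_fun M" "g \<in> L2_fun M" shows "integrable M (\<lambda>x. f x * g x)"
proof (rule Bochner_Integration.integrable_bound)
  show "integrable M (\<lambda>x. (cmod (f x))\<^sup>2 + (cmod (g x))\<^sup>2)"
    using assms by (auto simp: L2_fun_def)
  show "(\<lambda>x. f x * g x) \<in> borel_measurable M" using assms by (auto simp: L2_fun_def)
  have "cmod (f x) * cmod (g x) \<le> (cmod (f x))\<^sup>2 + (cmod (g x))\<^sup>2" for x
  proof -
    have "0 \<le> cmod (f x) * cmod (g x)" by simp
    with sum_squares_bound[of "cmod (f x)" "cmod (g x)"] show ?thesis by linarith
  qed
  then show "AE x in M. norm (f x * g x) \<le> norm ((cmod (f x))\<^sup>2 + (cmod (g x))\<^sup>2)"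
    by (auto simp: norm_mult)
qed

lemma L2_inner_integrable:
  "f \<in> L2_fun M \<Longrightarrow> g \<in> L2_fun M \<Longrightarrow> integrable M (\<lambda>x. f x * cnj (g x))"
  by (intro L2_fun_mult_integrable L2_fun_cnj)

lemma L2_inner_diff_left:
  "f \<in> L2_fun M \<Longrightarrow> g \<in> L2_fun M \<Longrightarrow> h \<in> L2_fun M \<Longrightarrow>
   L2_inner M (\<lambda>x. f x - g x) h = L2_inner M f h - L2_inner M g h"
  unfolding L2_inner_def by (simp add: left_diff_distrib L2_inner_integrable)

lemma L2_inner_cmult_left: "L2_inner M (\<lambda>x. c * f x) h = c * L2_inner M f h"
  unfolding L2_inner_def by (simp add: mult.assoc)

lemma L2_inner_cmult_right: "L2_inner M f (\<lambda>x. c * h x) = cnj c * L2_inner M f h"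
  unfolding L2_inner_def by (simp add: mult.left_commute)

lemma L2_inner_cnj: "cnj (L2_inner M f h) = L2_inner M h f"
  unfolding L2_inner_def
  by (subst Bochner_Integration.integral_cnj[symmetric]) (simp add: mult.commute)

lemma L2_inner_sum_left:
  assumes "\<And>i. i \<in> F \<Longrightarrow> f i \<in> L2_fun M" "h \<in> L2_fun M"
  shows "L2_inner M (\<lambda>x. \<Sum>i\<in>F. f i x) h = (\<Sum>i\<in>F. L2_inner M (f i) h)"
  unfolding L2_inner_def sum_distrib_right
  by (rule Bochner_Integration.integral_sum) (use assms L2_inner_integrable in auto)

lemma L2_inner_self: "L2_inner M f f = of_real (LINT x|M. (cmod (f x))\<^sup>2)"
  unfolding L2_inner_def
  by (simp only: complex_norm_square[symmetric] of_real_power[symmetric] integral_complex_of_real)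

text \<open>Pythagoras: the finite sum \<open>s\<close> has the same coefficients as
  \<open>f\<close>, so \<open>f - s\<close> is orthogonal to every \<open>e p\<close> and hence to
  \<open>s\<close>. The \<open>e p\<close> are orthogonal but not normalised, with squared norms
  \<open>N p\<close>: in this scaling the ladder relations of the Hermite polynomials contain no
  square roots.\<close>

lemma L2_sum_expansion:
  fixes e :: "'i \<Rightarrow> 'a \<Rightarrow> complex"
  assumes f: "f \<in> L2_fun M" and F: "finite F"
    and e: "\<And>p. p \<in> F \<Longrightarrow> e p \<in> L2_fun M" and N: "\<And>p. p \<in> F \<Longrightarrow> N p > (0::real)"
    and orth: "\<And>p q. p \<in> F \<Longrightarrow> q \<in> F \<Longrightarrow> L2_inner M (e p) (e q) = (if p = q then of_real (N p) else 0)"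
  shows "(LINT x|M. (cmod (f x - (\<Sum>p\<in>F. L2_inner M f (e p) / of_real (N p) * e p x)))\<^sup>2)
       = (LINT x|M. (cmod (f x))\<^sup>2) - (\<Sum>p\<in>F. (cmod (L2_inner M f (e p)))\<^sup>2 / N p)"
proof -
  define c where "c p = L2_inner M f (e p) / of_real (N p)" for p
  define s where "s = (\<lambda>x. \<Sum>p\<in>F. c p * e p x)"
  define Q where "Q = (\<Sum>p\<in>F. (cmod (L2_inner M f (e p)))\<^sup>2 / N p)"
  have s: "s \<in> L2_fun M" unfolding s_def by (intro L2_fun_sum L2_fun_cmult e)
  have d: "(\<lambda>x. f x - s x) \<in> L2_fun M" using f s by auto
  have ip: "L2_inner M s (e p) = L2_inner M f (e p)" if "p \<in> F" for p
  proof -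
    have "L2_inner M s (e p) = (\<Sum>q\<in>F. L2_inner M (\<lambda>x. c q * e q x) (e p))"
      unfolding s_def by (rule L2_inner_sum_left) (use e that in auto)
    also have "\<dots> = (\<Sum>q\<in>F. if q = p then c p * of_real (N p) else 0)"
      by (rule sum.cong) (use orth that in \<open>auto simp: L2_inner_cmult_left\<close>)
    also have "\<dots> = c p * of_real (N p)" using F that by simp
    also have "\<dots> = L2_inner M f (e p)" using N[OF that] by (simp add: c_def)
    finally show ?thesis .
  qed
  have os: "L2_inner M (\<lambda>x. f x - s x) s = 0"
  proof -
    have "L2_inner M s (\<lambda>x. f x - s x) = (\<Sum>q\<in>F. L2_inner M (\<lambda>x. c q * e q x) (\<lambda>x. f x - s x))"
      unfolding s_def by (rule L2_inner_sum_left) (use e d in \<open>auto simp: s_def\<close>)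
    also have "\<dots> = 0"
    proof (rule sum.neutral, rule ballI)
      fix q assume q: "q \<in> F"
      have "L2_inner M (\<lambda>x. f x - s x) (e q) = 0"
        using L2_inner_diff_left[OF f s e[OF q]] ip[OF q] by simp
      then have "L2_inner M (e q) (\<lambda>x. f x - s x) = 0" using L2_inner_cnj by (metis complex_cnj_zero)
      then show "L2_inner M (\<lambda>x. c q * e q x) (\<lambda>x. f x - s x) = 0" by (simp add: L2_inner_cmult_left)
    qed
    finally show ?thesis using L2_inner_cnj by (metis complex_cnj_zero)
  qed
  have fs: "L2_inner M f s = of_real Q"
  proof -
    have "L2_inner M s f = (\<Sum>q\<in>F. L2_inner M (\<lambda>x. c q * e q x) f)"
      unfolding s_def by (rule L2_inner_sum_left) (use e f in auto)
    also have "\<dots> = (\<Sum>q\<in>F. of_real ((cmod (L2_inner M f (e q)))\<^sup>2 / N q))"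
    proof (rule sum.cong)
      fix q assume "q \<in> F"
      have "L2_inner M (e q) f = cnj (L2_inner M f (e q))" by (simp add: L2_inner_cnj)
      then show "L2_inner M (\<lambda>x. c q * e q x) f = of_real ((cmod (L2_inner M f (e q)))\<^sup>2 / N q)"
        unfolding L2_inner_cmult_left by (simp add: c_def complex_norm_square del: of_real_power)
    qed simp
    finally have "L2_inner M s f = of_real Q" by (simp add: Q_def)
    then show ?thesis using L2_inner_cnj by (metis complex_cnj_complex_of_real)
  qed
  have "L2_inner M (\<lambda>x. f x - s x) (\<lambda>x. f x - s x) = cnj (L2_inner M f (\<lambda>x. f x - s x))
          - cnj (L2_inner M s (\<lambda>x. f x - s x))"
    using L2_inner_diff_left[OF f s d] by (metis L2_inner_cnj complex_cnj_diff)
  also have "\<dots> = L2_inner M (\<lambda>x. f x - s x) f"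
    using os by (simp add: L2_inner_cnj)
  also have "\<dots> = L2_inner M f f - cnj (L2_inner M f s)"
    using L2_inner_diff_left[OF f s f] by (simp add: L2_inner_cnj)
  also have "\<dots> = of_real ((LINT x|M. (cmod (f x))\<^sup>2) - Q)"
    unfolding fs L2_inner_self by simp
  finally show ?thesis
    unfolding L2_inner_self of_real_eq_iff Q_def s_def c_def .
qed

lemma L2_bessel:
  fixes e :: "'i \<Rightarrow> 'a \<Rightarrow> complex"
  assumes "f \<in> L2_fun M" "finite F" "\<And>p. p \<in> F \<Longrightarrow> e p \<in> L2_fun M" "\<And>p. p \<in> F \<Longrightarrow> N p > (0::real)"
    "\<And>p q. p \<in> F \<Longrightarrow> q \<in> F \<Longrightarrow> L2_inner M (e p) (e q) = (if p = q then of_real (N p) else 0)"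
  shows "(\<Sum>p\<in>F. (cmod (L2_inner M f (e p)))\<^sup>2 / N p) \<le> (LINT x|M. (cmod (f x))\<^sup>2)"
proof -
  have "0 \<le> (LINT x|M. (cmod (f x - (\<Sum>p\<in>F. L2_inner M f (e p) / of_real (N p) * e p x)))\<^sup>2)"
    by simp
  also note L2_sum_expansion[OF assms]
  finally show ?thesis by simp
qed

text \<open>The rate (1/4)^n for squared norms makes consecutive distances at most (1/2)^n. The
  increments then have summable L1 norms, so the sequence converges almost everywhere, and Fatou's
  lemma carries the rate over to the limit.\<close>

lemma L2_complete:
  fixes u :: "nat \<Rightarrow> 'a \<Rightarrow> complex"
  assumes "prob_space M" and u: "\<And>n. u n \<in> L2_fun M"
    and cauchy: "\<And>m n. n \<le> m \<Longrightarrow> (LINT x|M. (cmod (u m x - u n x))\<^sup>2) \<le> (1/4) ^ n"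
  obtains w where "w \<in> L2_fun M" "\<And>n. (LINT x|M. (cmod (w x - u n x))\<^sup>2) \<le> (1/4) ^ n"
proof -
  interpret prob_space M by fact
  have [measurable]: "u n \<in> borel_measurable M" for n using u L2_fun_measurable by auto
  have i2: "integrable M (\<lambda>x. (cmod (u m x - u n x))\<^sup>2)" for m n
    by (intro L2_fun_integrable L2_fun_diff u)
  have nn2: "(\<integral>\<^sup>+x. ennreal ((cmod (u m x - u n x))\<^sup>2) \<partial>M) \<le> ennreal ((1/4)^n)" if "n \<le> m" for m n
    using cauchy[OF that] by (subst nn_integral_eq_integral[OF i2]) auto
  have l1: "(\<integral>\<^sup>+x. ennreal (cmod (u (Suc n) x - u n x)) \<partial>M) \<le> ennreal ((1/2)^n)" for n
  proof -
    let ?d = "\<lambda>x. cmod (u (Suc n) x - u n x)"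
    \<comment> \<open>This is (c t - 1)^2 / c \<ge> 0 with c = 2^n. It bounds the L1 norm by the
      squared norm, with both terms balanced at (1/2)^n.\<close>
    have am: "t \<le> (2^n * t\<^sup>2 + (1/2)^n) / 2" for t :: real
    proof -
      define c :: real where "c = 2 ^ n"
      have c: "c > 0" "(1/2) ^ n = 1 / c" by (auto simp: c_def power_one_over)
      have "0 \<le> (c * t - 1)\<^sup>2 / c" using c by simp
      also have "\<dots> = c * t\<^sup>2 - 2 * t + 1 / c"
        using c(1) by (simp add: power2_eq_square field_simps)
      finally show ?thesis unfolding c(2) c_def[symmetric] by simp
    qed
    have "(\<integral>\<^sup>+x. ennreal (?d x) \<partial>M) \<le> (\<integral>\<^sup>+x. ennreal ((2^n * (?d x)\<^sup>2 + (1/2)^n) / 2) \<partial>M)"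
      by (intro nn_integral_mono ennreal_leI am)
    also have "\<dots> = ennreal (LINT x|M. (2^n * (?d x)\<^sup>2 + (1/2)^n) / 2)"
      by (rule nn_integral_eq_integral) (use i2 in auto)
    also have "(LINT x|M. (2^n * (?d x)\<^sup>2 + (1/2)^n) / 2) = (2^n * (LINT x|M. (?d x)\<^sup>2) + (1/2)^n) / 2"
      using i2 by (simp add: prob_space)
    also have "ennreal \<dots> \<le> ennreal ((1/2)^n)"
    proof (rule ennreal_leI)
      have "2^n * (LINT x|M. (?d x)\<^sup>2) \<le> 2^n * (1/4)^n"
        using cauchy[of n "Suc n"] by (intro mult_left_mono) auto
      also have "\<dots> = (1/2::real)^n" by (simp add: power_mult_distrib[symmetric])
      finally show "(2^n * (LINT x|M. (?d x)\<^sup>2) + (1/2)^n) / 2 \<le> (1/2)^n" by simp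
    qed
    finally show ?thesis .
  qed
  have "(\<integral>\<^sup>+x. (\<Sum>n. ennreal (cmod (u (Suc n) x - u n x))) \<partial>M)
      = (\<Sum>n. \<integral>\<^sup>+x. ennreal (cmod (u (Suc n) x - u n x)) \<partial>M)"
    by (rule nn_integral_suminf) measurable
  also have "\<dots> \<le> (\<Sum>n. ennreal ((1/2)^n))" by (intro suminf_le l1) auto
  also have "\<dots> = ennreal (\<Sum>n. (1/2)^n)" by (rule suminf_ennreal2) (auto intro: summable_geometric)
  also have "\<dots> < \<infinity>" by simp
  finally have "(\<integral>\<^sup>+x. (\<Sum>n. ennreal (cmod (u (Suc n) x - u n x))) \<partial>M) \<noteq> \<infinity>" by simp
  then have "AE x in M. (\<Sum>n. ennreal (cmod (u (Suc n) x - u n x))) \<noteq> \<infinity>"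
    by (rule nn_integral_PInf_AE[rotated]) measurable
  then have conv: "AE x in M. convergent (\<lambda>n. u n x)"
  proof eventually_elim
    case (elim x)
    have "summable (\<lambda>n. cmod (u (Suc n) x - u n x))"
      using elim by (intro summable_suminf_not_top) auto
    then have "summable (\<lambda>n. u (Suc n) x - u n x)" by (rule summable_norm_cancel)
    then have "convergent (\<lambda>n. \<Sum>i<n. u (Suc i) x - u i x)"
      by (rule summable_iff_convergent[THEN iffD1])
    then have "convergent (\<lambda>n. u n x - u 0 x)"
      by (rule back_subst[of convergent]) (rule ext, rule sum_lessThan_telescope)
    from convergent_add[OF this convergent_const[of "u 0 x"]] show ?case
      by (simp only: diff_add_cancel)
  qed
  define w where "w = (\<lambda>x. lim (\<lambda>n. u n x))"
  have [measurable]: "w \<in> borel_measurable M" unfolding w_def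
    by (rule borel_measurable_lim_metric) measurable
  have lim: "AE x in M. (\<lambda>n. u n x) \<longlonglongrightarrow> w x"
    using conv by eventually_elim (simp add: w_def convergent_LIMSEQ_iff)
  have fatou: "(\<integral>\<^sup>+x. ennreal ((cmod (w x - u n x))\<^sup>2) \<partial>M) \<le> ennreal ((1/4)^n)" for n
  proof -
    have "(\<integral>\<^sup>+x. ennreal ((cmod (w x - u n x))\<^sup>2) \<partial>M)
        = (\<integral>\<^sup>+x. liminf (\<lambda>m. ennreal ((cmod (u m x - u n x))\<^sup>2)) \<partial>M)"
    proof (rule nn_integral_cong_AE, use lim in eventually_elim)
      case (elim x)
      have "(\<lambda>m. ennreal ((cmod (u m x - u n x))\<^sup>2)) \<longlonglongrightarrow> ennreal ((cmod (w x - u n x))\<^sup>2)"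
        by (intro tendsto_intros elim)
      then show ?case by (rule lim_imp_Liminf[OF trivial_limit_sequentially, symmetric])
    qed
    also have "\<dots> \<le> liminf (\<lambda>m. \<integral>\<^sup>+x. ennreal ((cmod (u m x - u n x))\<^sup>2) \<partial>M)"
      by (rule nn_integral_liminf) measurable
    also have "\<dots> \<le> limsup (\<lambda>m. \<integral>\<^sup>+x. ennreal ((cmod (u m x - u n x))\<^sup>2) \<partial>M)"
      by (rule Liminf_le_Limsup) simp
    also have "\<dots> \<le> ennreal ((1/4)^n)"
      by (rule Limsup_bounded) (use nn2 in \<open>auto simp: eventually_sequentially\<close>)
    finally show ?thesis .
  qed
  have i3: "integrable M (\<lambda>x. (cmod (w x - u n x))\<^sup>2)" for n
    by (rule integrableI_bounded) (use fatou[of n] in \<open>auto intro: le_less_trans\<close>)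
  show thesis
  proof
    have "(\<lambda>x. w x - u 0 x) \<in> L2_fun M" using i3 by (auto simp: L2_fun_def)
    from L2_fun_add[OF this u[of 0]] show "w \<in> L2_fun M" by simp
    show "(LINT x|M. (cmod (w x - u n x))\<^sup>2) \<le> (1/4) ^ n" for n
      using fatou[of n] nn_integral_eq_integral[OF i3[of n]] by simp
  qed
qed

text \<open>One inequality is Bessel's. For the other, the projections on an increasing chain of
  finite index sets converge to some \<open>w\<close>, and \<open>f - w\<close> is orthogonal to
  every \<open>e p\<close>; totality gives \<open>f = w\<close> almost everywhere, so the residuals
  \<open>B - sum q (F n)\<close> tend to 0. The index set is arbitrary: the chain may miss part of
  it, and the coefficients there are shown to vanish.\<close>

lemma L2_parseval:
  fixes e :: "'i \<Rightarrow> 'a \<Rightarrow> complex"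
  assumes M: "prob_space M" and f: "f \<in> L2_fun M"
    and e: "\<And>p. p \<in> A \<Longrightarrow> e p \<in> L2_fun M" and N: "\<And>p. p \<in> A \<Longrightarrow> N p > (0::real)"
    and orth: "\<And>p q. p \<in> A \<Longrightarrow> q \<in> A \<Longrightarrow> L2_inner M (e p) (e q) = (if p = q then of_real (N p) else 0)"
    and total: "\<And>h. h \<in> L2_fun M \<Longrightarrow> (\<And>p. p \<in> A \<Longrightarrow> L2_inner M h (e p) = 0) \<Longrightarrow> AE x in M. h x = 0"
  shows "((\<lambda>p. (cmod (L2_inner M f (e p)))\<^sup>2 / N p) has_sum (LINT x|M. (cmod (f x))\<^sup>2)) A"
proof -
  define q where "q p = (cmod (L2_inner M f (e p)))\<^sup>2 / N p" for p
  define B where "B = (LINT x|M. (cmod (f x))\<^sup>2)"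
  have q0: "q p \<ge> 0" if "p \<in> A" for p using N[OF that] by (simp add: q_def)
  have bes: "sum q F \<le> B" if "finite F" "F \<subseteq> A" for F
    unfolding q_def B_def using that by (intro L2_bessel f e N orth) auto
  have sq: "q summable_on A"
    by (rule nonneg_bounded_partial_sums_imp_summable_on[where C = B])
       (use q0 bes in \<open>auto intro!: eventually_finite_subsets_at_top_weakI\<close>)
  define S where "S = infsum q A"
  have Sge: "sum q F \<le> S" if "finite F" "F \<subseteq> A" for F
    unfolding S_def using that q0 sq by (intro finite_sum_le_infsum) auto
  have "\<exists>F. finite F \<and> F \<subseteq> A \<and> S - (1/4)^n \<le> sum q F" for n :: nat
  proof -
    have "\<exists>F. finite F \<and> F \<subseteq> A \<and> dist (sum q F) S \<le> (1/4)^n"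
      unfolding S_def by (rule infsum_finite_approximation[OF sq]) simp
    then show ?thesis by (auto simp: dist_real_def abs_le_iff algebra_simps)
  qed
  then obtain F0 where F0: "\<And>n. finite (F0 n)" "\<And>n. F0 n \<subseteq> A" "\<And>n. S - (1/4)^n \<le> sum q (F0 n)"
    by metis
  \<comment> \<open>Unions make the chain increasing, so that \<open>u n\<close> is the projection
    of \<open>u m\<close> for n \<le> m; enlarging the sets only brings the sums closer to
    \<open>S\<close>.\<close>
  define F where "F n = (\<Union>k\<le>n. F0 k)" for n :: nat
  have F: "finite (F n)" "F n \<subseteq> A" "S - (1/4)^n \<le> sum q (F n)" for n
  proof -
    show fin: "finite (F n)" and sub: "F n \<subseteq> A" using F0 by (auto simp: F_def)
    have "sum q (F0 n) \<le> sum q (F n)"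
      by (rule sum_mono2[OF fin]) (use sub q0 in \<open>auto simp: F_def\<close>)
    then show "S - (1/4)^n \<le> sum q (F n)" using F0(3)[of n] by simp
  qed
  have eF: "p \<in> A" if "p \<in> F n" for p n using F(2) that by blast
  have Fmono: "F n \<subseteq> F m" if "n \<le> m" for n m using that unfolding F_def by (intro UN_mono) auto
  define u where "u n = (\<lambda>x. \<Sum>p\<in>F n. L2_inner M f (e p) / of_real (N p) * e p x)" for n
  have u: "u n \<in> L2_fun M" for n unfolding u_def using F(2) e by (intro L2_fun_sum L2_fun_cmult) auto
  have uip: "L2_inner M (u n) (e p) = (if p \<in> F n then L2_inner M f (e p) else 0)" if "p \<in> A" for n p
  proof -
    have "L2_inner M (u n) (e p) = (\<Sum>i\<in>F n. L2_inner M (\<lambda>x. L2_inner M f (e i) / of_real (N i) * e i x) (e p))"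
      unfolding u_def by (intro L2_inner_sum_left L2_fun_cmult e that) (rule eF)
    also have "\<dots> = (\<Sum>i\<in>F n. if i = p then L2_inner M f (e p) / of_real (N p) * of_real (N p) else 0)"
      unfolding L2_inner_cmult_left by (rule sum.cong) (use that eF in \<open>auto simp: orth\<close>)
    also have "\<dots> = (if p \<in> F n then L2_inner M f (e p) else 0)"
      using F(1) N[OF that] by simp
    finally show ?thesis .
  qed
  have uipm: "L2_inner M (u m) (e p) = L2_inner M f (e p)" if "n \<le> m" "p \<in> F n" for m n p
    using uip[OF eF[OF that(2)], of m] Fmono[OF that(1)] that(2) by auto
  have resid: "(LINT x|M. (cmod (f x - u n x))\<^sup>2) = B - sum q (F n)" for n
    unfolding u_def q_def B_def by (intro L2_sum_expansion f F e N orth) (use F(2) in blast)+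
  have cauchy: "(LINT x|M. (cmod (u m x - u n x))\<^sup>2) \<le> (1/4) ^ n" if "n \<le> m" for m n
  proof -
    have "u n x = (\<Sum>p\<in>F n. L2_inner M (u m) (e p) / of_real (N p) * e p x)" for x
      unfolding u_def[of n] by (intro sum.cong refl) (simp add: uipm[OF that])
    then have "(LINT x|M. (cmod (u m x - u n x))\<^sup>2)
       = (LINT x|M. (cmod (u m x - (\<Sum>p\<in>F n. L2_inner M (u m) (e p) / of_real (N p) * e p x)))\<^sup>2)"
      by simp
    also have "\<dots> = (LINT x|M. (cmod (u m x))\<^sup>2) - (\<Sum>p\<in>F n. (cmod (L2_inner M (u m) (e p)))\<^sup>2 / N p)"
      by (intro L2_sum_expansion u F e N orth) (use F(2) in blast)+
    also have "(\<Sum>p\<in>F n. (cmod (L2_inner M (u m) (e p)))\<^sup>2 / N p) = sum q (F n)"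
      unfolding q_def by (intro sum.cong refl) (simp add: uipm[OF that])
    also have "(LINT x|M. (cmod (u m x))\<^sup>2) = sum q (F m)"
    proof -
      have "(LINT x|M. (cmod (u m x - (\<Sum>p\<in>F m. L2_inner M (u m) (e p) / of_real (N p) * e p x)))\<^sup>2)
        = (LINT x|M. (cmod (u m x))\<^sup>2) - (\<Sum>p\<in>F m. (cmod (L2_inner M (u m) (e p)))\<^sup>2 / N p)"
        by (intro L2_sum_expansion u F e N orth) (use F(2) in blast)+
      moreover have "(\<Sum>p\<in>F m. L2_inner M (u m) (e p) / of_real (N p) * e p x) = u m x" for x
        unfolding u_def[of m, THEN fun_cong] by (rule sum.cong[OF refl]) (simp only: uipm[OF order_refl, unfolded u_def])
      moreover have "(\<Sum>p\<in>F m. (cmod (L2_inner M (u m) (e p)))\<^sup>2 / N p) = sum q (F m)"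
        unfolding q_def by (intro sum.cong refl) (simp add: uipm[OF order_refl])
      ultimately show ?thesis by simp
    qed
    finally show ?thesis using F(3)[of n] Sge[OF F(1,2), of m] by simp
  qed
  obtain w where w: "w \<in> L2_fun M" "\<And>n. (LINT x|M. (cmod (w x - u n x))\<^sup>2) \<le> (1/4) ^ n"
    using L2_complete[OF M u cauchy] by blast
  have pw: "(\<lambda>n. (1/4::real)^n) \<longlonglongrightarrow> 0" by (rule LIMSEQ_realpow_zero) auto
  have "L2_inner M (\<lambda>x. f x - w x) (e p) = 0" if p: "p \<in> A" for p
  proof -
    \<comment> \<open>Bessel's inequality for a single vector serves as the Cauchy-Schwarz
      inequality.\<close>
    have cs: "(cmod (L2_inner M (\<lambda>x. w x - u n x) (e p)))\<^sup>2 \<le> N p * (1/4)^n" for n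
    proof -
      have "(\<Sum>p\<in>{p}. (cmod (L2_inner M (\<lambda>x. w x - u n x) (e p)))\<^sup>2 / N p) \<le> (LINT x|M. (cmod (w x - u n x))\<^sup>2)"
        by (rule L2_bessel) (use p w u e N orth in auto)
      also have "\<dots> \<le> (1/4)^n" by (rule w)
      finally show ?thesis using N[OF p] by (simp add: field_simps)
    qed
    have "(\<lambda>n. N p * (1/4)^n) \<longlonglongrightarrow> 0"
      by (rule tendsto_mult_right_zero[OF pw])
    then have "(\<lambda>n. (cmod (L2_inner M (\<lambda>x. w x - u n x) (e p)))\<^sup>2) \<longlonglongrightarrow> 0"
      by (rule tendsto_sandwich[OF _ _ tendsto_const[of 0], rotated 2]) (use cs in \<open>auto simp del: power_one_over\<close>)
    then have l0: "(\<lambda>n. L2_inner M (\<lambda>x. w x - u n x) (e p)) \<longlonglongrightarrow> 0"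
      
      by (rule power_tendsto_0_iff[THEN iffD1, OF pos2, THEN tendsto_norm_zero_cancel])
    then have l1: "(\<lambda>n. L2_inner M w (e p) - L2_inner M (u n) (e p)) \<longlonglongrightarrow> 0"
      unfolding L2_inner_diff_left[OF w(1) u e[OF p]] .
    have "L2_inner M w (e p) = L2_inner M f (e p)"
    proof (cases "\<exists>n. p \<in> F n")
      case True
      then obtain n where "p \<in> F n" by blast
      then have "p \<in> F m" if "n \<le> m" for m using Fmono that by blast
      then have "\<forall>\<^sub>F m in sequentially. L2_inner M w (e p) - L2_inner M (u m) (e p) = L2_inner M w (e p) - L2_inner M f (e p)"
        using uip[OF p] by (auto simp: eventually_sequentially)
      from Lim_transform_eventually[OF l1 this] show ?thesis
        by (simp add: LIMSEQ_const_iff)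
    next
      \<comment> \<open>An index that is never chosen has coefficient 0: adding \<open>p\<close> to
        \<open>F n\<close> cannot push the sum above \<open>S\<close>, which \<open>F n\<close>
        alone already reaches up to (1/4)^n.\<close>
      case False
      then have "(\<lambda>n. L2_inner M w (e p)) \<longlonglongrightarrow> 0" using l1 uip[OF p] by simp
      then have wz: "L2_inner M w (e p) = 0" by (simp add: LIMSEQ_const_iff)
      have "q p \<le> (1/4)^n" for n
      proof -
        have "sum q (insert p (F n)) \<le> S" by (rule Sge) (use F p in auto)
        then show ?thesis using False F[of n] by simp
      qed
      then have "q p \<le> 0" using LIMSEQ_le_const[OF pw, of "q p"] by blast
      then have "q p = 0" using q0[OF p] by simp
      then have "L2_inner M f (e p) = 0" using N[OF p] by (simp add: q_def)
      then show ?thesis using wz by simp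
    qed
    then show ?thesis using L2_inner_diff_left[OF f w(1) e[OF p]] by simp
  qed
  then have ae: "AE x in M. f x - w x = 0" using f w by (intro total) auto
  have Bn: "B - sum q (F n) \<le> (1/4)^n" for n
  proof -
    have "B - sum q (F n) = (LINT x|M. (cmod (w x - u n x))\<^sup>2)"
      unfolding resid[symmetric] using f w(1) u[of n] ae
      by (intro integral_cong_AE) (auto dest!: L2_fun_measurable)
    then show ?thesis using w(2)[of n] by simp
  qed
  have Sn: "B \<le> S + (1/4)^n" for n using Bn[of n] Sge[OF F(1,2), of n] by linarith
  have "B \<le> S + 0" by (rule LIMSEQ_le_const[OF tendsto_add[OF tendsto_const pw]]) (use Sn in blast)
  moreover have "S \<le> B" unfolding S_def by (rule infsum_le_finite_sums[OF sq]) (rule bes)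
  ultimately have "S = B" by simp
  then show ?thesis using has_sum_infsum[OF sq] by (simp add: S_def B_def q_def[abs_def])
qed

subsection \<open>Gaussian integration by parts\<close>

text \<open>Completing the square: an exponential factor only shifts the mean and rescales, so
  exponentials are integrable.\<close>

lemma normal_density_mult_exp:
  assumes "\<sigma> > 0"
  shows "normal_density 0 \<sigma> x * exp (c * x) = exp (c\<^sup>2 * \<sigma>\<^sup>2 / 2) * normal_density (c * \<sigma>\<^sup>2) \<sigma> x"
proof -
  have "- x\<^sup>2 / (2 * \<sigma>\<^sup>2) + c * x = c\<^sup>2 * \<sigma>\<^sup>2 / 2 + - (x - c * \<sigma>\<^sup>2)\<^sup>2 / (2 * \<sigma>\<^sup>2)"
    using assms by (simp add: field_simps power2_eq_square)
  then have "exp (- x\<^sup>2 / (2 * \<sigma>\<^sup>2)) * exp (c * x)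
      = exp (c\<^sup>2 * \<sigma>\<^sup>2 / 2) * exp (- (x - c * \<sigma>\<^sup>2)\<^sup>2 / (2 * \<sigma>\<^sup>2))"
    by (simp only: exp_add[symmetric])
  then show ?thesis by (simp add: normal_density_def)
qed

lemma exp_abs_le: "exp (c * \<bar>x\<bar>) \<le> exp (c * x) + exp (- c * (x::real))"
  by (cases "x \<ge> 0") auto

lemma integrable_gauss1_exp:
  assumes "\<sigma> > 0" shows "integrable (gauss1 \<sigma>) (\<lambda>x. exp (c * \<bar>x\<bar>))"
proof -
  have 1: "integrable (gauss1 \<sigma>) (\<lambda>x. exp (c * x))" for c
    unfolding gauss1_def
    by (subst integrable_real_density) (auto simp: normal_density_mult_exp[OF assms] intro: integrable_normal_density assms)
  show ?thesis
  proof (rule Bochner_Integration.integrable_bound)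
    show "integrable (gauss1 \<sigma>) (\<lambda>x. exp (c * x) + exp (- c * x))"
      by (intro Bochner_Integration.integrable_add 1)
    show "(\<lambda>x. exp (c * \<bar>x\<bar>)) \<in> borel_measurable (gauss1 \<sigma>)" by measurable
    show "AE x in gauss1 \<sigma>. norm (exp (c * \<bar>x\<bar>)) \<le> norm (exp (c * x) + exp (- c * x))"
      using exp_abs_le[of c] by (intro AE_I2) (simp add: abs_of_pos add_pos_pos)
  qed
qed

lemma gauss1_integrable_exp_bounded:
  fixes G :: "real \<Rightarrow> complex"
  assumes "\<sigma> > 0" "G \<in> borel_measurable borel" "\<And>x. norm (G x) \<le> C * exp (c * \<bar>x\<bar>)"
  shows "integrable (gauss1 \<sigma>) G"
proof (rule Bochner_Integration.integrable_bound)
  show "integrable (gauss1 \<sigma>) (\<lambda>x. C * exp (c * \<bar>x\<bar>))"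
    by (intro integrable_mult_right integrable_gauss1_exp assms)
  show "G \<in> borel_measurable (gauss1 \<sigma>)" using assms(2) by (simp add: gauss1_def)
  show "AE x in gauss1 \<sigma>. norm (G x) \<le> norm (C * exp (c * \<bar>x\<bar>))"
    using assms(3) by (intro AE_I2) (simp, meson abs_ge_self order_trans)
qed

text \<open>The bound is the expansion of (|x| - (c + 1) \<sigma>^2)^2 \<ge> 0. Taking the rate c +
  1 instead of c leaves a factor exp (- |x|), which makes the boundary terms of the integration by
  parts vanish.\<close>

lemma normal_density_exp_decay:
  assumes "\<sigma> > 0"
  obtains K where "\<And>x. normal_density 0 \<sigma> x * exp (c * \<bar>x\<bar>) \<le> K * exp (- \<bar>x\<bar>)"
proof
  fix x :: real
  have "c * \<bar>x\<bar> + - x\<^sup>2 / (2 * \<sigma>\<^sup>2) \<le> (c + 1)\<^sup>2 * \<sigma>\<^sup>2 / 2 + - \<bar>x\<bar>"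
  proof -
    have "0 \<le> (\<bar>x\<bar> - (c + 1) * \<sigma>\<^sup>2)\<^sup>2 / (2 * \<sigma>\<^sup>2)" by simp
    also have "\<dots> = x\<^sup>2 / (2 * \<sigma>\<^sup>2) - (c + 1) * \<bar>x\<bar> + (c + 1)\<^sup>2 * \<sigma>\<^sup>2 / 2"
      using assms by (simp add: power2_diff field_simps) (simp add: power2_eq_square power4_eq_xxxx algebra_simps)
    finally show ?thesis by (simp add: algebra_simps)
  qed
  then have "exp (- x\<^sup>2 / (2 * \<sigma>\<^sup>2)) * exp (c * \<bar>x\<bar>) \<le> exp ((c + 1)\<^sup>2 * \<sigma>\<^sup>2 / 2) * exp (- \<bar>x\<bar>)"
    unfolding exp_add[symmetric] by (simp add: add.commute)
  then have "1 / sqrt (2 * pi * \<sigma>\<^sup>2) * (exp (- x\<^sup>2 / (2 * \<sigma>\<^sup>2)) * exp (c * \<bar>x\<bar>))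
      \<le> 1 / sqrt (2 * pi * \<sigma>\<^sup>2) * (exp ((c + 1)\<^sup>2 * \<sigma>\<^sup>2 / 2) * exp (- \<bar>x\<bar>))"
    by (intro mult_left_mono) auto
  then show "normal_density 0 \<sigma> x * exp (c * \<bar>x\<bar>)
      \<le> (1 / sqrt (2 * pi * \<sigma>\<^sup>2) * exp ((c + 1)\<^sup>2 * \<sigma>\<^sup>2 / 2)) * exp (- \<bar>x\<bar>)"
    by (simp add: normal_density_def)
qed

lemma tendsto_exp_neg_abs:
  "((\<lambda>x::real. exp (- \<bar>x\<bar>)) \<longlongrightarrow> 0) at_top" "((\<lambda>x::real. exp (- \<bar>x\<bar>)) \<longlongrightarrow> 0) at_bot"
proof -
  have 1: "((\<lambda>x::real. exp (- x)) \<longlongrightarrow> 0) at_top"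
    by (rule filterlim_compose[OF exp_at_bot filterlim_uminus_at_bot_at_top])
  show "((\<lambda>x::real. exp (- \<bar>x\<bar>)) \<longlongrightarrow> 0) at_top"
    by (rule Lim_transform_eventually[OF 1 eventually_mono[OF eventually_ge_at_top[of 0]]]) simp
  show "((\<lambda>x::real. exp (- \<bar>x\<bar>)) \<longlongrightarrow> 0) at_bot"
    by (rule Lim_transform_eventually[OF exp_at_bot eventually_mono[OF eventually_le_at_bot[of 0]]]) simp
qed

text \<open>The density w satisfies w' = - (x / \<sigma>^2) w, so w (G' - x G / \<sigma>^2) is the
  derivative of w G, and w G tends to 0 at both ends because the Gaussian beats exponential
  growth.\<close>

lemma gauss1_by_parts:
  fixes G G' :: "real \<Rightarrow> complex"
  assumes \<sigma>: "\<sigma> > 0"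
    and deriv: "\<And>x. (G has_vector_derivative G' x) (at x)"
    and cont: "continuous_on UNIV G'"
    and bG: "\<And>x. norm (G x) \<le> C * exp (c * \<bar>x\<bar>)"
    and bG': "\<And>x. norm (G' x) \<le> C * exp (c * \<bar>x\<bar>)"
  shows "(LINT x|gauss1 \<sigma>. G' x) = (LINT x|gauss1 \<sigma>. of_real (x / \<sigma>\<^sup>2) * G x)"
proof -
  let ?w = "normal_density 0 \<sigma>"
  have contG: "continuous_on UNIV G"
    using deriv by (auto simp: continuous_on_eq_continuous_at intro: has_vector_derivative_continuous)
  have [measurable]: "G \<in> borel_measurable borel" "G' \<in> borel_measurable borel"
    using contG cont by (auto intro: borel_measurable_continuous_onI)
  have C0: "C \<ge> 0"
    using order_trans[OF norm_ge_zero bG[of 0]] by simp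
  define H where "H x = of_real (x / \<sigma>\<^sup>2) * G x" for x
  \<comment> \<open>The factor x is absorbed by |x| \<le> exp |x|, at the price of raising the rate
    from c to c + 1.\<close>
  have bH: "norm (H x) \<le> (C / \<sigma>\<^sup>2) * exp ((c + 1) * \<bar>x\<bar>)" for x
  proof -
    have "\<bar>x\<bar> \<le> exp \<bar>x\<bar>" using exp_ge_add_one_self[of "\<bar>x\<bar>"] by linarith
    then have "\<bar>x\<bar> / \<sigma>\<^sup>2 * norm (G x) \<le> exp \<bar>x\<bar> / \<sigma>\<^sup>2 * (C * exp (c * \<bar>x\<bar>))"
      using bG[of x] by (intro mult_mono divide_right_mono) auto
    also have "\<dots> = (C / \<sigma>\<^sup>2) * exp ((c + 1) * \<bar>x\<bar>)" by (simp add: distrib_right exp_add)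
    finally show ?thesis by (simp add: H_def norm_mult norm_divide norm_power)
  qed
  have iG': "integrable (gauss1 \<sigma>) G'" and iH: "integrable (gauss1 \<sigma>) H"
    by (rule gauss1_integrable_exp_bounded[OF \<sigma> _ bG'], measurable,
        rule gauss1_integrable_exp_bounded[OF \<sigma> _ bH], unfold H_def, measurable)
  define f where "f x = ?w x *\<^sub>R (G' x - H x)" for x
  define F where "F x = ?w x *\<^sub>R G x" for x
  have int_f: "integrable lborel f" and eq_f: "(LINT x|lborel. f x) = (LINT x|gauss1 \<sigma>. G' x - H x)"
  proof -
    have "integrable (gauss1 \<sigma>) (\<lambda>x. G' x - H x)" using iG' iH by auto
    then show "integrable lborel f" unfolding gauss1_def f_def
      by (subst (asm) integrable_density) (auto simp: H_def)
    show "(LINT x|lborel. f x) = (LINT x|gauss1 \<sigma>. G' x - H x)" unfolding gauss1_def f_def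
      by (subst integral_density) (auto simp: H_def)
  qed
  have w': "(?w has_real_derivative (- x / \<sigma>\<^sup>2 * ?w x)) (at x)" for x
    unfolding normal_density_def
    by (rule derivative_eq_intros refl | (use \<sigma> in \<open>simp add: field_simps power2_eq_square\<close>))+
  have F': "(F has_vector_derivative f x) (at x)" for x
  proof -
    have "((\<lambda>x. ?w x *\<^sub>R G x) has_vector_derivative (?w x *\<^sub>R G' x + (- x / \<sigma>\<^sup>2 * ?w x) *\<^sub>R G x)) (at x)"
      by (rule has_vector_derivative_scaleR[OF w' deriv])
    then show ?thesis
      by (simp add: F_def[abs_def] f_def H_def scaleR_conv_of_real algebra_simps)
  qed
  obtain K where K: "\<And>x. ?w x * exp (c * \<bar>x\<bar>) \<le> K * exp (- \<bar>x\<bar>)"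
    using normal_density_exp_decay[OF \<sigma>] by blast
  have bF: "norm (F x) \<le> exp (- \<bar>x\<bar>) * (C * K)" for x
  proof -
    have "norm (F x) \<le> ?w x * (C * exp (c * \<bar>x\<bar>))"
      unfolding F_def using bG[of x] by (simp add: mult_left_mono)
    also have "\<dots> \<le> C * (K * exp (- \<bar>x\<bar>))"
      using mult_left_mono[OF K C0] by (simp add: mult_ac)
    finally show ?thesis by (simp add: mult_ac)
  qed
  have top: "(F \<longlongrightarrow> 0) at_top"
    by (rule Lim_null_comparison[OF always_eventually tendsto_mult_left_zero[OF tendsto_exp_neg_abs(1)]])
       (use bF in blast)
  have bot: "(F \<longlongrightarrow> 0) at_bot"
    by (rule Lim_null_comparison[OF always_eventually tendsto_mult_left_zero[OF tendsto_exp_neg_abs(2)]])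
       (use bF in blast)
  have "(LBINT x=-\<infinity>..\<infinity>. f x) = 0 - 0"
  proof (rule interval_integral_FTC_integrable[where F = F])
    show "(F has_vector_derivative f x) (at x)" for x by (rule F')
    have "continuous_on UNIV f"
      unfolding f_def H_def normal_density_def
      by (intro continuous_intros cont contG) (use \<sigma> in auto)
    then show "isCont f x" for x by (simp add: continuous_on_eq_continuous_at)
    show "set_integrable lborel (einterval (-\<infinity>) \<infinity>) f"
      using int_f by (simp add: set_integrable_def einterval_def)
    show "((F \<circ> real_of_ereal) \<longlongrightarrow> 0) (at_right (-\<infinity>))" "((F \<circ> real_of_ereal) \<longlongrightarrow> 0) (at_left \<infinity>)"
      using top bot by (simp_all add: ereal_tendsto_simps)
  qed simp
  then have "(LINT x|lborel. f x) = 0"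
    by (simp add: interval_lebesgue_integral_def set_lebesgue_integral_def einterval_def)
  then have "(LINT x|gauss1 \<sigma>. G' x) = (LINT x|gauss1 \<sigma>. H x)" using eq_f iG' iH by simp
  then show ?thesis unfolding H_def .
qed

lemma has_vector_derivative_shift:
  assumes "((\<lambda>h::real. g (x + h)) has_vector_derivative D) (at 0)"
  shows "(g has_vector_derivative D) (at x)"
proof -
  have "((\<lambda>h. g (x + h)) \<circ> (\<lambda>t. t - x) has_vector_derivative (1 *\<^sub>R D)) (at x)"
    by (rule vector_diff_chain_at) (use assms in \<open>auto intro!: derivative_eq_intros\<close>)
  then show ?thesis by (simp add: o_def)
qed

section \<open>Integration by parts for the Gaussian measure on the complex plane\<close>

lemma gauss_complex_fubini:
  fixes w :: "complex \<Rightarrow> complex"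
  assumes \<sigma>: "\<sigma> > 0" and int: "integrable (gauss_complex \<sigma>) w" and [measurable]: "w \<in> borel_measurable borel"
  shows "(LINT z|gauss_complex \<sigma>. w z) = (LINT y|gauss1 \<sigma>. LINT x|gauss1 \<sigma>. w (Complex x y))"
    and "(LINT z|gauss_complex \<sigma>. w z) = (LINT x|gauss1 \<sigma>. LINT y|gauss1 \<sigma>. w (Complex x y))"
proof -
  interpret g: prob_space "gauss1 \<sigma>" by (rule prob_space_gauss1[OF \<sigma>])
  interpret pair_sigma_finite "gauss1 \<sigma>" "gauss1 \<sigma>" ..
  have i: "integrable (gauss1 \<sigma> \<Otimes>\<^sub>M gauss1 \<sigma>) (\<lambda>(x, y). w (Complex x y))"
    using int unfolding gauss_complex_def
    by (subst (asm) integrable_distr_eq[OF measurable_Complex_gauss1]) (auto simp: split_beta')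
  have e: "(LINT z|gauss_complex \<sigma>. w z) = (LINT p|(gauss1 \<sigma> \<Otimes>\<^sub>M gauss1 \<sigma>). (case p of (x, y) \<Rightarrow> w (Complex x y)))"
    unfolding gauss_complex_def
    by (subst integral_distr[OF measurable_Complex_gauss1]) (auto simp: split_beta')
  show "(LINT z|gauss_complex \<sigma>. w z) = (LINT y|gauss1 \<sigma>. LINT x|gauss1 \<sigma>. w (Complex x y))"
    unfolding e by (rule integral_snd[OF i, symmetric])
  show "(LINT z|gauss_complex \<sigma>. w z) = (LINT x|gauss1 \<sigma>. LINT y|gauss1 \<sigma>. w (Complex x y))"
    unfolding e by (rule integral_fst[OF i, symmetric])
qed

lemma integrable_gauss_complex_exp:
  assumes \<sigma>: "\<sigma> > 0" and c: "c \<ge> 0"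
  shows "integrable (gauss_complex \<sigma>) (\<lambda>z. exp (c * cmod z))"
proof (rule integrableI_bounded)
  interpret g: prob_space "gauss1 \<sigma>" by (rule prob_space_gauss1[OF \<sigma>])
  show "(\<lambda>z. exp (c * cmod z)) \<in> borel_measurable (gauss_complex \<sigma>)" by measurable
  have fin: "(\<integral>\<^sup>+x. ennreal (exp (c * \<bar>x\<bar>)) \<partial>gauss1 \<sigma>) < \<infinity>"
    using integrable_gauss1_exp[OF \<sigma>, of c] by (subst nn_integral_eq_integral) auto
  have "(\<integral>\<^sup>+z. ennreal (norm (exp (c * cmod z))) \<partial>gauss_complex \<sigma>)
      = (\<integral>\<^sup>+p. ennreal (exp (c * cmod (Complex (fst p) (snd p)))) \<partial>(gauss1 \<sigma> \<Otimes>\<^sub>M gauss1 \<sigma>))"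
    unfolding gauss_complex_def
    by (subst nn_integral_distr[OF measurable_Complex_gauss1]) (auto simp: split_beta')
  also have "\<dots> \<le> (\<integral>\<^sup>+p. ennreal (exp (c * \<bar>fst p\<bar>)) * ennreal (exp (c * \<bar>snd p\<bar>)) \<partial>(gauss1 \<sigma> \<Otimes>\<^sub>M gauss1 \<sigma>))"
  proof (rule nn_integral_mono)
    fix p :: "real \<times> real"
    have "c * cmod (Complex (fst p) (snd p)) \<le> c * (\<bar>fst p\<bar> + \<bar>snd p\<bar>)"
      using cmod_le[of "Complex (fst p) (snd p)"] c by (intro mult_left_mono) auto
    then have "exp (c * cmod (Complex (fst p) (snd p))) \<le> exp (c * \<bar>fst p\<bar>) * exp (c * \<bar>snd p\<bar>)"
      by (simp add: exp_add[symmetric] distrib_left)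
    then show "ennreal (exp (c * cmod (Complex (fst p) (snd p)))) \<le> ennreal (exp (c * \<bar>fst p\<bar>)) * ennreal (exp (c * \<bar>snd p\<bar>))"
      by (simp add: ennreal_mult[symmetric] ennreal_leI)
  qed
  also have "\<dots> = (\<integral>\<^sup>+x. \<integral>\<^sup>+y. ennreal (exp (c * \<bar>x\<bar>)) * ennreal (exp (c * \<bar>y\<bar>)) \<partial>gauss1 \<sigma> \<partial>gauss1 \<sigma>)"
    by (subst g.nn_integral_fst[symmetric]) auto
  also have "\<dots> = (\<integral>\<^sup>+x. ennreal (exp (c * \<bar>x\<bar>)) \<partial>gauss1 \<sigma>) * (\<integral>\<^sup>+x. ennreal (exp (c * \<bar>x\<bar>)) \<partial>gauss1 \<sigma>)"
    by (simp add: nn_integral_cmult nn_integral_multc)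
  also have "\<dots> < \<infinity>" using fin by (simp add: ennreal_mult_less_top)
  finally show "(\<integral>\<^sup>+z. ennreal (norm (exp (c * cmod z))) \<partial>gauss_complex \<sigma>) < \<infinity>" .
qed

lemma gauss_complex_integrable_exp_bounded:
  fixes w :: "complex \<Rightarrow> complex"
  assumes "\<sigma> > 0" "c \<ge> 0" "w \<in> borel_measurable borel" "\<And>z. norm (w z) \<le> C * exp (c * cmod z)"
  shows "integrable (gauss_complex \<sigma>) w"
proof (rule Bochner_Integration.integrable_bound)
  show "integrable (gauss_complex \<sigma>) (\<lambda>x. C * exp (c * cmod x))"
    by (intro integrable_mult_right integrable_gauss_complex_exp assms)
  show "w \<in> borel_measurable (gauss_complex \<sigma>)" using assms(3) by simp
  show "AE x in gauss_complex \<sigma>. norm (w x) \<le> norm (C * exp (c * cmod x))"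
    using assms(4) by (intro AE_I2) (simp, meson abs_ge_self order_trans)
qed

text \<open>Fubini with the variable of differentiation innermost reduces this to the real line. The
  direction \<open>u\<close> is 1 or \<i>, and \<open>Re (cnj u * z)\<close> is then x or y, so the
  two real directions share one formula.\<close>

lemma gauss_complex_by_parts:
  fixes w w' :: "complex \<Rightarrow> complex"
  assumes \<sigma>: "\<sigma> > 0" and c: "c \<ge> 0" and u: "u = 1 \<or> u = \<i>"
    and deriv: "\<And>z. ((\<lambda>h::real. w (z + of_real h * u)) has_vector_derivative w' z) (at 0)"
    and contw: "continuous_on UNIV w" and cont: "continuous_on UNIV w'"
    and b: "\<And>z. norm (w z) \<le> C * exp (c * cmod z)" and b': "\<And>z. norm (w' z) \<le> C * exp (c * cmod z)"
  shows "(LINT z|gauss_complex \<sigma>. w' z) = (LINT z|gauss_complex \<sigma>. of_real (Re (cnj u * z) / \<sigma>\<^sup>2) * w z)"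
proof -
  have C0: "C \<ge> 0"
    using order_trans[OF norm_ge_zero b[of 0]] by simp
  have [measurable]: "w \<in> borel_measurable borel" "w' \<in> borel_measurable borel"
    using contw cont by (auto intro: borel_measurable_continuous_onI)
  have reu: "\<bar>Re (cnj u * z)\<bar> \<le> cmod z" for z
    using u abs_Re_le_cmod[of z] abs_Im_le_cmod[of z] by auto
  have mH: "(\<lambda>z. of_real (Re (cnj u * z) / \<sigma>\<^sup>2) * w z) \<in> borel_measurable borel"
    using contw by (intro borel_measurable_continuous_onI continuous_intros) (use \<sigma> in auto)
  have bH: "norm (of_real (Re (cnj u * z) / \<sigma>\<^sup>2) * w z) \<le> (C / \<sigma>\<^sup>2) * exp ((c + 1) * cmod z)" for z
  proof -
    have "\<bar>Re (cnj u * z)\<bar> \<le> exp (cmod z)"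
      using exp_ge_add_one_self[of "cmod z"] reu[of z] by linarith
    then have "\<bar>Re (cnj u * z)\<bar> / \<sigma>\<^sup>2 * norm (w z) \<le> exp (cmod z) / \<sigma>\<^sup>2 * (C * exp (c * cmod z))"
      using b[of z] by (intro mult_mono divide_right_mono) auto
    also have "\<dots> = (C / \<sigma>\<^sup>2) * exp ((c + 1) * cmod z)" by (simp add: distrib_right exp_add)
    finally show ?thesis by (simp only: norm_mult norm_of_real abs_divide abs_power2)
  qed
  have i1: "integrable (gauss_complex \<sigma>) w'"
    by (rule gauss_complex_integrable_exp_bounded[OF \<sigma> c _ b']) simp
  have c1: "c + 1 \<ge> 0" using c by simp
  have i2: "integrable (gauss_complex \<sigma>) (\<lambda>z. of_real (Re (cnj u * z) / \<sigma>\<^sup>2) * w z)"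
    by (rule gauss_complex_integrable_exp_bounded[OF \<sigma> c1 mH bH])
  \<comment> \<open>On a line with y fixed the growth bound keeps its rate; the constant takes up
    the factor exp (c |y|).\<close>
  have line: "C * exp (c * cmod (Complex x y)) \<le> (C * exp (c * \<bar>y\<bar>)) * exp (c * \<bar>x\<bar>)" for x y
  proof -
    have "c * cmod (Complex x y) \<le> c * (\<bar>x\<bar> + \<bar>y\<bar>)"
      using cmod_le[of "Complex x y"] c by (intro mult_left_mono) auto
    then have "exp (c * cmod (Complex x y)) \<le> exp (c * \<bar>y\<bar>) * exp (c * \<bar>x\<bar>)"
      by (simp add: exp_add[symmetric] distrib_left)
    then show ?thesis using C0 by (simp add: mult.assoc mult_left_mono)
  qed
  have cx: "continuous_on UNIV (\<lambda>x. Complex x y)" and cy: "continuous_on UNIV (\<lambda>y. Complex x y)" for x y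
    unfolding Complex_eq by (intro continuous_intros)+
  show ?thesis
  proof (cases "u = 1")
    case True
    have inner: "(LINT x|gauss1 \<sigma>. w' (Complex x y)) = (LINT x|gauss1 \<sigma>. of_real (x / \<sigma>\<^sup>2) * w (Complex x y))" for y
    proof (rule gauss1_by_parts[OF \<sigma>])
      show "((\<lambda>x. w (Complex x y)) has_vector_derivative w' (Complex x y)) (at x)" for x
      proof (rule has_vector_derivative_shift)
        have "Complex (x + h) y = Complex x y + of_real h * u" for h
          using True by (simp add: complex_eq_iff)
        then show "((\<lambda>h. w (Complex (x + h) y)) has_vector_derivative w' (Complex x y)) (at 0)"
          using deriv[of "Complex x y"] by simp
      qed
      show "continuous_on UNIV (\<lambda>x. w' (Complex x y))"
        by (rule continuous_on_compose2[OF cont cx]) simp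
      show "norm (w (Complex x y)) \<le> (C * exp (c * \<bar>y\<bar>)) * exp (c * \<bar>x\<bar>)" for x
        by (rule order_trans[OF b line])
      show "norm (w' (Complex x y)) \<le> (C * exp (c * \<bar>y\<bar>)) * exp (c * \<bar>x\<bar>)" for x
        by (rule order_trans[OF b' line])
    qed
    show ?thesis
      unfolding gauss_complex_fubini(1)[OF \<sigma> i1 \<open>w' \<in> borel_measurable borel\<close>] gauss_complex_fubini(1)[OF \<sigma> i2 mH] inner
      by (simp add: True)
  next
    case False
    then have ui: "u = \<i>" using u by simp
    have inner: "(LINT y|gauss1 \<sigma>. w' (Complex x y)) = (LINT y|gauss1 \<sigma>. of_real (y / \<sigma>\<^sup>2) * w (Complex x y))" for x
    proof (rule gauss1_by_parts[OF \<sigma>])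
      show "((\<lambda>y. w (Complex x y)) has_vector_derivative w' (Complex x y)) (at y)" for y
      proof (rule has_vector_derivative_shift)
        have "Complex x (y + h) = Complex x y + of_real h * u" for h
          using ui by (simp add: complex_eq_iff)
        then show "((\<lambda>h. w (Complex x (y + h))) has_vector_derivative w' (Complex x y)) (at 0)"
          using deriv[of "Complex x y"] by simp
      qed
      show "continuous_on UNIV (\<lambda>y. w' (Complex x y))"
        by (rule continuous_on_compose2[OF cont cy]) simp
      show "norm (w (Complex x y)) \<le> (C * exp (c * \<bar>x\<bar>)) * exp (c * \<bar>y\<bar>)" for y
        by (rule order_trans[OF b]) (use line[of x y] in \<open>simp add: mult_ac\<close>)
      show "norm (w' (Complex x y)) \<le> (C * exp (c * \<bar>x\<bar>)) * exp (c * \<bar>y\<bar>)" for y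
        by (rule order_trans[OF b']) (use line[of x y] in \<open>simp add: mult_ac\<close>)
    qed
    show ?thesis
      unfolding gauss_complex_fubini(2)[OF \<sigma> i1 \<open>w' \<in> borel_measurable borel\<close>] gauss_complex_fubini(2)[OF \<sigma> i2 mH] inner
      by (simp add: ui)
  qed
qed

subsection \<open>Functions of exponential growth in finitely many coordinates\<close>

text \<open>A class stable under sums, products and conjugation whose members are all square
  integrable for the Gaussian measure, so that integrability becomes a syntactic check. The growth
  allowed is exponential rather than polynomial because the moment argument for totality integrates
  exp (u |x_i|).\<close>

definition tame :: "((nat \<Rightarrow> complex) \<Rightarrow> complex) \<Rightarrow> bool" where
  "tame \<phi> \<longleftrightarrow> \<phi> \<in> borel_measurable borel \<and>
     (\<exists>C c n. 0 \<le> C \<and> 0 \<le> c \<and> (\<forall>z. cmod (\<phi> z) \<le> C * exp (c * (\<Sum>i<n. cmod (z i)))))"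

lemma tameI:
  assumes "\<phi> \<in> borel_measurable borel" "0 \<le> C" "0 \<le> c"
    "\<And>z. cmod (\<phi> z) \<le> C * exp (c * (\<Sum>i<n. cmod (z i)))"
  shows "tame \<phi>"
  unfolding tame_def using assms by blast

lemma tameE:
  assumes "tame \<phi>"
  obtains C c n where "0 \<le> C" "0 \<le> c" "\<And>z. cmod (\<phi> z) \<le> C * exp (c * (\<Sum>i<n. cmod (z i)))"
  using assms unfolding tame_def by blast

lemma tame_measurable: "tame \<phi> \<Longrightarrow> \<phi> \<in> borel_measurable borel"
  by (simp add: tame_def)

lemma tame_mono:
  assumes "tame \<psi>" "\<phi> \<in> borel_measurable borel" "\<And>z. cmod (\<phi> z) \<le> K * cmod (\<psi> z)"
  shows "tame \<phi>"
proof -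
  obtain C c n where b: "0 \<le> C" "0 \<le> c" "\<And>z. cmod (\<psi> z) \<le> C * exp (c * (\<Sum>i<n. cmod (z i)))"
    using tameE[OF assms(1)] by blast
  show ?thesis
  proof (rule tameI[OF assms(2)])
    fix z
    have "cmod (\<phi> z) \<le> \<bar>K\<bar> * cmod (\<psi> z)"
      using assms(3)[of z] mult_right_mono[OF abs_ge_self[of K], of "cmod (\<psi> z)"] by simp
    also have "\<dots> \<le> \<bar>K\<bar> * (C * exp (c * (\<Sum>i<n. cmod (z i))))" by (intro mult_left_mono b) simp
    finally show "cmod (\<phi> z) \<le> (\<bar>K\<bar> * C) * exp (c * (\<Sum>i<n. cmod (z i)))" by (simp add: mult.assoc)
  qed (use b in auto)
qed

lemma tame_bounded:
  assumes "\<phi> \<in> borel_measurable borel" "\<And>z. cmod (\<phi> z) \<le> C"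
  shows "tame \<phi>"
  by (rule tameI[of _ C 0 0]) (use assms order_trans[OF norm_ge_zero assms(2)] in auto)

lemma tame_const [simp, intro]: "tame (\<lambda>_. c)"
  by (rule tame_bounded[of _ "cmod c"]) auto

lemma tame_mult [intro]:
  assumes "tame \<phi>" "tame \<psi>" shows "tame (\<lambda>z. \<phi> z * \<psi> z)"
proof -
  obtain C c n where b: "0 \<le> C" "0 \<le> c" "\<And>z. cmod (\<phi> z) \<le> C * exp (c * (\<Sum>i<n. cmod (z i)))"
    using tameE[OF assms(1)] by blast
  obtain D d m where b': "0 \<le> D" "0 \<le> d" "\<And>z. cmod (\<psi> z) \<le> D * exp (d * (\<Sum>i<m. cmod (z i)))"
    using tameE[OF assms(2)] by blast
  show ?thesis
  proof (rule tameI)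
    show "(\<lambda>z. \<phi> z * \<psi> z) \<in> borel_measurable borel"
      using assms[THEN tame_measurable] by measurable
    fix z :: "nat \<Rightarrow> complex"
    have s: "(\<Sum>i<n. cmod (z i)) \<le> (\<Sum>i<max n m. cmod (z i))" "(\<Sum>i<m. cmod (z i)) \<le> (\<Sum>i<max n m. cmod (z i))"
      by (intro sum_mono2; auto)+
    have "cmod (\<phi> z * \<psi> z) \<le> (C * exp (c * (\<Sum>i<n. cmod (z i)))) * (D * exp (d * (\<Sum>i<m. cmod (z i))))"
      unfolding norm_mult using b b' by (intro mult_mono) auto
    also have "\<dots> \<le> (C * exp (c * (\<Sum>i<max n m. cmod (z i)))) * (D * exp (d * (\<Sum>i<max n m. cmod (z i))))"
      using b b' s by (intro mult_mono mult_left_mono) (auto intro: mult_left_mono)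
    also have "\<dots> = (C * D) * exp ((c + d) * (\<Sum>i<max n m. cmod (z i)))"
      by (simp add: distrib_right exp_add)
    finally show "cmod (\<phi> z * \<psi> z) \<le> (C * D) * exp ((c + d) * (\<Sum>i<max n m. cmod (z i)))" .
  qed (use b b' in auto)
qed

lemma tame_add [intro]:
  assumes "tame \<phi>" "tame \<psi>" shows "tame (\<lambda>z. \<phi> z + \<psi> z)"
proof -
  obtain C c n where b: "0 \<le> C" "0 \<le> c" "\<And>z. cmod (\<phi> z) \<le> C * exp (c * (\<Sum>i<n. cmod (z i)))"
    using tameE[OF assms(1)] by blast
  obtain D d m where b': "0 \<le> D" "0 \<le> d" "\<And>z. cmod (\<psi> z) \<le> D * exp (d * (\<Sum>i<m. cmod (z i)))"
    using tameE[OF assms(2)] by blast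
  show ?thesis
  proof (rule tameI)
    show "(\<lambda>z. \<phi> z + \<psi> z) \<in> borel_measurable borel"
      using assms[THEN tame_measurable] by measurable
    fix z :: "nat \<Rightarrow> complex"
    define S where "S = (\<Sum>i<max n m. cmod (z i))"
    have S0: "0 \<le> S" unfolding S_def by (simp add: sum_nonneg)
    have s: "(\<Sum>i<n. cmod (z i)) \<le> S" "(\<Sum>i<m. cmod (z i)) \<le> S"
      unfolding S_def by (intro sum_mono2; auto)+
    have "c * (\<Sum>i<n. cmod (z i)) \<le> (c + d) * S" "d * (\<Sum>i<m. cmod (z i)) \<le> (c + d) * S"
      using b b' s S0 by (auto intro!: mult_mono sum_nonneg)
    then have "C * exp (c * (\<Sum>i<n. cmod (z i))) \<le> C * exp ((c + d) * S)"
      "D * exp (d * (\<Sum>i<m. cmod (z i))) \<le> D * exp ((c + d) * S)"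
      using b b' by (auto intro!: mult_left_mono)
    then have "cmod (\<phi> z + \<psi> z) \<le> C * exp ((c + d) * S) + D * exp ((c + d) * S)"
      using b(3)[of z] b'(3)[of z] norm_triangle_ineq[of "\<phi> z" "\<psi> z"] by linarith
    then show "cmod (\<phi> z + \<psi> z) \<le> (C + D) * exp ((c + d) * (\<Sum>i<max n m. cmod (z i)))"
      by (simp add: S_def distrib_right)
  qed (use b b' in auto)
qed

lemma tame_diff [intro]: "tame \<phi> \<Longrightarrow> tame \<psi> \<Longrightarrow> tame (\<lambda>z. \<phi> z - \<psi> z)"
  using tame_add[of \<phi> "\<lambda>z. -1 * \<psi> z"] tame_mult[OF tame_const[of "-1"], of \<psi>] by simp

lemma tame_cmult: "tame \<phi> \<Longrightarrow> tame (\<lambda>z. c * \<phi> z)"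
  by (rule tame_mult[OF tame_const])

lemma tame_sum: "(\<And>i. i \<in> A \<Longrightarrow> tame (\<phi> i)) \<Longrightarrow> tame (\<lambda>z. \<Sum>i\<in>A. \<phi> i z)"
  by (induction A rule: infinite_finite_induct) auto

lemma tame_power: "tame \<phi> \<Longrightarrow> tame (\<lambda>z. \<phi> z ^ k)"
  by (induction k) auto

lemma measurable_coord [measurable]: "(\<lambda>z::nat \<Rightarrow> complex. z i) \<in> borel_measurable borel"
  by (intro borel_measurable_continuous_onI continuous_on_product_coordinates)

lemma measurable_cnj [measurable (raw)]:
  "f \<in> borel_measurable M \<Longrightarrow> (\<lambda>x. cnj (f x)) \<in> borel_measurable M"
  by (rule borel_measurable_continuous_on[OF continuous_on_cnj[OF continuous_on_id]])

lemma tame_exp_coord: 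
  assumes "0 \<le> c" shows "tame (\<lambda>z. of_real (exp (c * cmod (z i))))"
proof (rule tameI)
  show "(\<lambda>z. of_real (exp (c * cmod (z i))) :: complex) \<in> borel_measurable borel" by measurable
  fix z :: "nat \<Rightarrow> complex"
  have "cmod (z i) \<le> (\<Sum>j<Suc i. cmod (z j))" by (rule member_le_sum) auto
  then show "cmod (of_real (exp (c * cmod (z i)))) \<le> 1 * exp (c * (\<Sum>j<Suc i. cmod (z j)))"
    using assms by (simp add: mult_left_mono del: sum.lessThan_Suc)
qed (use assms in auto)

lemma tame_coord [intro]: "tame (\<lambda>z. z i)"
proof (rule tame_mono[OF tame_exp_coord[of 1 i]])
  show "cmod (z i) \<le> 1 * cmod (complex_of_real (exp (1 * cmod (z i))))" for z :: "nat \<Rightarrow> complex"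
    using exp_ge_add_one_self[of "cmod (z i)"] by (simp del: exp_ge_add_one_self)
qed auto

lemma tame_Re: "tame (\<lambda>z. of_real (Re (z i)))"
  by (rule tame_mono[OF tame_coord[of i], of _ 1]) (auto simp: abs_Re_le_cmod)

lemma tame_Im: "tame (\<lambda>z. of_real (Im (z i)))"
  by (rule tame_mono[OF tame_coord[of i], of _ 1]) (auto simp: abs_Im_le_cmod)

lemma tame_cnj [intro]: "tame \<phi> \<Longrightarrow> tame (\<lambda>z. cnj (\<phi> z))"
  by (rule tame_mono[of \<phi> _ 1]) (auto dest: tame_measurable)

section \<open>The product measure, its restriction to \<open>ell2\<close>, and integration by parts
  in one coordinate\<close>

locale gauss_weights =
  fixes r :: real and a :: "nat \<Rightarrow> real"
  assumes r_pos: "r > 0" and a_pos: "\<And>i. a i > 0" and a_summable: "summable a"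
begin

abbreviation "P \<equiv> gauss_ell2 r a"
abbreviation "Q \<equiv> gauss_prod r a"
abbreviation "gc i \<equiv> gauss_complex (r * a i)"

lemma ra_pos: "r * a i > 0" using r_pos a_pos by simp

lemma prob_gc: "prob_space (gc i)" by (rule prob_space_gauss_complex[OF ra_pos])

sublocale Pm: prob_space P by (rule prob_space_gauss_ell2[OF r_pos a_pos a_summable])
sublocale Qm: prob_space Q by (rule prob_space_gauss_prod[OF r_pos a_pos])
sublocale gcs: product_prob_space gc "UNIV :: nat set"
  using prob_gc by (simp add: product_prob_space_def product_prob_space_axioms_def product_sigma_finite_def prob_space_imp_sigma_finite)

lemma measurable_Q: "f \<in> borel_measurable borel \<Longrightarrow> f \<in> borel_measurable Q"
  by (subst measurable_cong_sets[OF sets_gauss_prod refl])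

lemma measurable_P: "f \<in> borel_measurable borel \<Longrightarrow> f \<in> borel_measurable P"
  unfolding gauss_ell2_def by (intro measurable_restrict_space1 measurable_Q)

lemma space_Q: "space Q = UNIV"
  using sets_eq_imp_space_eq[OF sets_gauss_prod[of r a]] by simp

text \<open>\<open>ell2\<close> has full measure for the product. Integrals are computed on
  \<open>Q\<close>, where the coordinates are independent and Fubini applies, and then moved to
  \<open>P\<close>.\<close>

lemma integrable_P_iff:
  fixes f :: "(nat \<Rightarrow> complex) \<Rightarrow> 'b::{banach, second_countable_topology}"
  assumes "f \<in> borel_measurable borel"
  shows "integrable P f \<longleftrightarrow> integrable Q f" and "(LINT z|P. f z) = (LINT z|Q. f z)"
proof -
  have s: "ell2 \<inter> space Q \<in> sets Q" using ell2_borel by (simp add: space_Q sets_gauss_prod)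
  have i: "indicator ell2 \<in> borel_measurable Q"
    using ell2_borel by (intro measurable_Q borel_measurable_indicator)
  have m: "(\<lambda>x. indicator ell2 x *\<^sub>R f x) \<in> borel_measurable Q"
    using measurable_Q[OF assms] i by measurable
  have ae: "AE x in Q. indicator ell2 x *\<^sub>R f x = f x"
    using AE_gauss_prod_ell2[OF r_pos a_pos a_summable] by eventually_elim simp
  show "integrable P f \<longleftrightarrow> integrable Q f"
    unfolding gauss_ell2_def integrable_restrict_space[OF s]
    by (rule integrable_cong_AE[OF m measurable_Q[OF assms] ae])
  show "(LINT z|P. f z) = (LINT z|Q. f z)"
    unfolding gauss_ell2_def integral_restrict_space[OF s]
    by (rule integral_cong_AE[OF m measurable_Q[OF assms] ae])
qed

text \<open>The image of \<open>Q\<close> under restriction to \<open>J\<close> is the finite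
  product of its factors, and there the integral of a product splits.\<close>

lemma integral_prod_coords:
  fixes f :: "nat \<Rightarrow> complex \<Rightarrow> 'b::{real_normed_field, banach, second_countable_topology}"
  assumes J: "finite J" and f: "\<And>j. j \<in> J \<Longrightarrow> integrable (gc j) (f j)"
  shows "integrable Q (\<lambda>z. \<Prod>j\<in>J. f j (z j))"
    and "(LINT z|Q. (\<Prod>j\<in>J. f j (z j))) = (\<Prod>j\<in>J. LINT x|gc j. f j x)"
proof -
  have d: "distr Q (Pi\<^sub>M J gc) (\<lambda>x. restrict x J) = Pi\<^sub>M J gc"
    unfolding gauss_prod_def by (rule gcs.distr_PiM_restrict_finite[OF J]) simp
  have m: "(\<lambda>x. restrict x J) \<in> measurable Q (Pi\<^sub>M J gc)"
    unfolding gauss_prod_def by (rule measurable_restrict_subset) simp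
  have fm: "f j \<in> borel_measurable (gc j)" if "j \<in> J" for j using f[OF that] by auto
  have m2: "(\<lambda>x. \<Prod>j\<in>J. f j (x j)) \<in> borel_measurable (Pi\<^sub>M J gc)"
  proof (rule borel_measurable_prod)
    fix j assume j: "j \<in> J"
    show "(\<lambda>x. f j (x j)) \<in> borel_measurable (Pi\<^sub>M J gc)"
      by (rule measurable_compose[where f = "\<lambda>x. x j", OF measurable_component_singleton[of j J gc, OF j] fm[OF j]])
  qed
  have eq: "(\<Prod>j\<in>J. f j (restrict z J j)) = (\<Prod>j\<in>J. f j (z j))" for z by (intro prod.cong) auto
  let ?D = "distr Q (Pi\<^sub>M J gc) (\<lambda>x. restrict x J)"
  have "integrable (distr Q (Pi\<^sub>M J gc) (\<lambda>x. restrict x J)) (\<lambda>x. \<Prod>j\<in>J. f j (x j))"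
    unfolding d by (rule gcs.product_integrable_prod[OF J f])
  then show "integrable Q (\<lambda>z. \<Prod>j\<in>J. f j (z j))"
    unfolding integrable_distr_eq[OF m m2] eq .
  have "(LINT z|Q. (\<Prod>j\<in>J. f j (z j))) = (LINT x|?D. (\<Prod>j\<in>J. f j (x j)))"
    unfolding integral_distr[OF m m2] eq ..
  then show "(LINT z|Q. (\<Prod>j\<in>J. f j (z j))) = (\<Prod>j\<in>J. LINT x|gc j. f j x)"
    using gcs.product_integral_prod[OF J f] unfolding d by simp
qed

text \<open>The exponential of a sum over coordinates is a product of one-coordinate exponentials,
  each of which is integrable.\<close>

lemma tame_integrable_Q:
  assumes "tame \<phi>" shows "integrable Q \<phi>"
proof -
  obtain C c n where b: "0 \<le> C" "0 \<le> c" "\<And>z. cmod (\<phi> z) \<le> C * exp (c * (\<Sum>i<n. cmod (z i)))"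
    using tameE[OF assms] by blast
  show ?thesis
  proof (rule Bochner_Integration.integrable_bound)
    have "integrable Q (\<lambda>z. \<Prod>i<n. exp (c * cmod (z i)))"
      by (rule integral_prod_coords(1)) (auto intro: integrable_gauss_complex_exp[OF ra_pos b(2)])
    then show "integrable Q (\<lambda>z. C * (\<Prod>i<n. exp (c * cmod (z i))))" by (rule integrable_mult_right)
    show "\<phi> \<in> borel_measurable Q" by (intro measurable_Q tame_measurable assms)
    have "cmod (\<phi> z) \<le> norm (C * (\<Prod>i<n. exp (c * cmod (z i))))" for z
      using b(1) b(3)[of z] by (simp add: exp_sum sum_distrib_left abs_mult prod_nonneg)
    then show "AE z in Q. norm (\<phi> z) \<le> norm (C * (\<Prod>i<n. exp (c * cmod (z i))))" by simp
  qed
qed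

lemma tame_integrable: "tame \<phi> \<Longrightarrow> integrable P \<phi>"
  using integrable_P_iff(1)[OF tame_measurable] tame_integrable_Q by blast

lemma tame_L2: assumes "tame \<phi>" shows "\<phi> \<in> L2_fun P"
proof -
  have "integrable P (\<lambda>z. \<phi> z * cnj (\<phi> z))" using assms by (intro tame_integrable) auto
  then have "integrable P (\<lambda>z. norm (\<phi> z * cnj (\<phi> z)))" by (rule integrable_norm)
  then show ?thesis
    using measurable_P[OF tame_measurable[OF assms]] by (simp add: L2_fun_def norm_mult power2_eq_square)
qed

lemma integral_coord:
  fixes w :: "complex \<Rightarrow> complex"
  assumes "integrable (gc i) w"
  shows "(LINT z|Q. w (z i)) = (LINT x|gc i. w x)"
  using integral_prod_coords(2)[of "{i}" "\<lambda>_. w"] assms by simp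

definition Qrest where "Qrest i = Pi\<^sub>M (UNIV - {i}) gc"

text \<open>\<open>Q\<close> is the image of its ith factor times the remaining ones under the map
  inserting the ith coordinate. This isolates one variable for integration by parts.\<close>

lemma Q_fiber:
  fixes F :: "(nat \<Rightarrow> complex) \<Rightarrow> complex"
  assumes "integrable Q F" and [measurable]: "F \<in> borel_measurable borel"
  shows "(LINT z|Q. F z) = (LINT X|Qrest i. LINT x|gc i. F (X(i := x)))"
proof -
  interpret R: prob_space "Qrest i" unfolding Qrest_def by (intro prob_space_PiM prob_gc)
  interpret g: prob_space "gc i" by (rule prob_gc)
  interpret pair_sigma_finite "gc i" "Qrest i" ..
  have ins: "insert i (UNIV - {i}) = (UNIV :: nat set)" by auto
  have d: "distr (gc i \<Otimes>\<^sub>M Qrest i) Q (\<lambda>(x, X). X(i := x)) = Q"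
    using distr_pair_PiM_eq_PiM[of "UNIV - {i}" gc i] prob_gc
    unfolding gauss_prod_def Qrest_def ins by simp
  have m: "(\<lambda>(x, X). X(i := x)) \<in> measurable (gc i \<Otimes>\<^sub>M Qrest i) Q"
    unfolding gauss_prod_def Qrest_def split_beta'
    by (subst ins[symmetric]) (rule measurable_fun_upd[where J = "UNIV - {i}"], auto)
  have FQ: "F \<in> borel_measurable Q" by (rule measurable_Q) fact
  have i: "integrable (gc i \<Otimes>\<^sub>M Qrest i) (\<lambda>(x, X). F (X(i := x)))"
    using integrable_distr_eq[OF m FQ] assms(1) unfolding d by (simp add: split_beta')
  have "(LINT z|Q. F z) = (LINT p|(gc i \<Otimes>\<^sub>M Qrest i). F ((\<lambda>(x, X). X(i := x)) p))"
    using integral_distr[OF m FQ] unfolding d .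
  also have "\<dots> = (LINT p|(gc i \<Otimes>\<^sub>M Qrest i). (\<lambda>(x, X). F (X(i := x))) p)"
    by (simp add: split_beta')
  also have "\<dots> = (LINT X|Qrest i. LINT x|gc i. F (X(i := x)))"
    by (rule integral_snd[OF i, symmetric])
  finally show ?thesis .
qed

end

text \<open>A relation, so that existence of the derivative is part of it; the function
  \<open>pderiv_dir\<close> also returns a value where there is no derivative.\<close>

definition has_pd :: "nat \<Rightarrow> complex \<Rightarrow> ((nat \<Rightarrow> complex) \<Rightarrow> complex) \<Rightarrow> ((nat \<Rightarrow> complex) \<Rightarrow> complex) \<Rightarrow> bool" where
  "has_pd i c \<phi> \<phi>' \<longleftrightarrow>
     (\<forall>z. ((\<lambda>h::real. \<phi> (z(i := z i + of_real h * c))) has_vector_derivative \<phi>' z) (at 0))"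

lemma continuous_fun_upd:
  "continuous_on UNIV (\<lambda>x::complex. (X :: nat \<Rightarrow> complex)(i := x))"
proof (rule continuous_on_coordinatewise_then_product)
  show "continuous_on UNIV (\<lambda>x. (X(i := x)) j)" for j by (cases "j = i") auto
qed

context gauss_weights begin

text \<open>Integrate by parts on each fiber: with the other coordinates frozen, a tame bound is an
  exponential bound in the single variable z_i.\<close>

lemma Q_by_parts:
  assumes pd: "has_pd i u F F'" and u: "u = 1 \<or> u = \<i>"
    and cF: "continuous_on UNIV F" and cF': "continuous_on UNIV F'" and tF: "tame F" and tF': "tame F'"
  shows "(LINT z|Q. F' z) = (LINT z|Q. of_real (Re (cnj u * z i) / (r * a i)\<^sup>2) * F z)"
proof -
  let ?H = "\<lambda>z. of_real (Re (cnj u * z i) / (r * a i)\<^sup>2) * F z"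
  have tH: "tame ?H"
  proof (rule tame_mult[OF _ tF])
    show "tame (\<lambda>z. complex_of_real (Re (cnj u * z i) / (r * a i)\<^sup>2))"
    proof (rule tame_mono[OF tame_coord[of i]])
      show "(\<lambda>z. complex_of_real (Re (cnj u * z i) / (r * a i)\<^sup>2)) \<in> borel_measurable borel" by measurable
      fix z :: "nat \<Rightarrow> complex"
      have "\<bar>Re (cnj u * z i)\<bar> \<le> cmod (z i)"
        using u abs_Re_le_cmod[of "z i"] abs_Im_le_cmod[of "z i"] by auto
      then show "cmod (complex_of_real (Re (cnj u * z i) / (r * a i)\<^sup>2)) \<le> (1 / (r * a i)\<^sup>2) * cmod (z i)"
        unfolding norm_of_real abs_divide abs_power2 by (simp add: divide_right_mono)
    qed
  qed
  obtain C c n where b: "0 \<le> C" "0 \<le> c" "\<And>z. cmod (F z) \<le> C * exp (c * (\<Sum>i<n. cmod (z i)))"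
    using tameE[OF tF] by blast
  obtain D d m where b': "0 \<le> D" "0 \<le> d" "\<And>z. cmod (F' z) \<le> D * exp (d * (\<Sum>i<m. cmod (z i)))"
    using tameE[OF tF'] by blast
  have bnd: "C * exp (c * (\<Sum>j<n. cmod ((X(i := x)) j))) \<le> (C * exp (c * (\<Sum>j<n. cmod (X j)))) * exp (c * cmod x)"
    if "0 \<le> C" "0 \<le> c" for C c n and X :: "nat \<Rightarrow> complex" and x
  proof -
    have "(\<Sum>j<n. cmod ((X(i := x)) j)) \<le> (\<Sum>j<n. cmod (X j) + (if j = i then cmod x else 0))"
      by (intro sum_mono) auto
    also have "\<dots> \<le> (\<Sum>j<n. cmod (X j)) + cmod x" by (simp add: sum.distrib)
    finally have "c * (\<Sum>j<n. cmod ((X(i := x)) j)) \<le> c * (\<Sum>j<n. cmod (X j)) + c * cmod x"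
      using that(2) by (metis distrib_left mult_left_mono)
    then have "exp (c * (\<Sum>j<n. cmod ((X(i := x)) j))) \<le> exp (c * (\<Sum>j<n. cmod (X j))) * exp (c * cmod x)"
      by (simp only: exp_add[symmetric] exp_le_cancel_iff)
    then show ?thesis using that(1) by (simp only: mult.assoc mult_left_mono)
  qed
  have inner: "(LINT x|gc i. F' (X(i := x))) = (LINT x|gc i. ?H (X(i := x)))" for X
  proof -
    \<comment> \<open>\<open>gauss_complex_by_parts\<close> takes one constant and one rate for a
      function and its derivative; the maximum of the two constants and the sum c + d of the rates
      dominate both.\<close>
    define K where "K = max (C * exp (c * (\<Sum>j<n. cmod (X j)))) (D * exp (d * (\<Sum>j<m. cmod (X j))))"
    have K0: "0 \<le> K" using b(1) by (simp add: K_def le_max_iff_disj)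
    have mono: "A * exp (q * cmod x) \<le> K * exp ((c + d) * cmod x)" if "A \<le> K" "q \<le> c + d" for A q and x :: complex
      using that K0 by (intro mult_mono) (auto intro: mult_right_mono)
    have "(LINT x|gc i. F' (X(i := x))) = (LINT x|gc i. of_real (Re (cnj u * x) / (r * a i)\<^sup>2) * F (X(i := x)))"
    proof (rule gauss_complex_by_parts[OF ra_pos _ u])
      show "0 \<le> c + d" using b b' by simp
      show "((\<lambda>h::real. F (X(i := z + of_real h * u))) has_vector_derivative F' (X(i := z))) (at 0)" for z
        using pd[unfolded has_pd_def, rule_format, of "X(i := z)"] by simp
      show "continuous_on UNIV (\<lambda>x. F (X(i := x)))" "continuous_on UNIV (\<lambda>x. F' (X(i := x)))"
        by (rule continuous_on_compose2[OF cF continuous_fun_upd], simp,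
            rule continuous_on_compose2[OF cF' continuous_fun_upd], simp)
      show "norm (F (X(i := z))) \<le> K * exp ((c + d) * cmod z)" for z
        by (rule order_trans[OF b(3)], rule order_trans[OF bnd[OF b(1,2)]], rule mono)
           (use b' in \<open>auto simp: K_def\<close>)
      show "norm (F' (X(i := z))) \<le> K * exp ((c + d) * cmod z)" for z
        by (rule order_trans[OF b'(3)], rule order_trans[OF bnd[OF b'(1,2)]], rule mono)
           (use b in \<open>auto simp: K_def\<close>)
    qed
    then show ?thesis by simp
  qed
  show ?thesis
    unfolding Q_fiber[OF tame_integrable_Q[OF tF'] tame_measurable[OF tF'], of i]
      Q_fiber[OF tame_integrable_Q[OF tH] tame_measurable[OF tH], of i] inner ..
qed

end

subsection \<open>Wirtinger derivatives\<close>

lemma has_pd_const [intro]: "has_pd i c (\<lambda>_. k) (\<lambda>_. 0)"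
  by (simp add: has_pd_def)

lemma has_pd_coord: "has_pd i c (\<lambda>z. z j) (\<lambda>_. if j = i then c else 0)"
proof -
  have "((\<lambda>h::real. w + of_real h * c) has_vector_derivative c) (at 0)" for w
    by (rule derivative_eq_intros has_vector_derivative_of_real refl | simp)+
  then show ?thesis by (simp add: has_pd_def)
qed

lemma has_pd_cnj: "has_pd i c \<phi> \<phi>' \<Longrightarrow> has_pd i c (\<lambda>z. cnj (\<phi> z)) (\<lambda>z. cnj (\<phi>' z))"
  unfolding has_pd_def by (auto intro: bounded_linear.has_vector_derivative[OF bounded_linear_cnj])

lemma has_pd_add: "has_pd i c \<phi> \<phi>' \<Longrightarrow> has_pd i c \<psi> \<psi>' \<Longrightarrow> has_pd i c (\<lambda>z. \<phi> z + \<psi> z) (\<lambda>z. \<phi>' z + \<psi>' z)"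
  unfolding has_pd_def by (auto intro: has_vector_derivative_add)

lemma has_pd_mult:
  assumes "has_pd i c \<phi> \<phi>'" "has_pd i c \<psi> \<psi>'"
  shows "has_pd i c (\<lambda>z. \<phi> z * \<psi> z) (\<lambda>z. \<phi> z * \<psi>' z + \<phi>' z * \<psi> z)"
  unfolding has_pd_def
proof
  fix z
  show "((\<lambda>h::real. \<phi> (z(i := z i + of_real h * c)) * \<psi> (z(i := z i + of_real h * c)))
     has_vector_derivative (\<phi> z * \<psi>' z + \<phi>' z * \<psi> z)) (at 0)"
    using has_vector_derivative_mult[OF assms(1)[unfolded has_pd_def, rule_format, of z]
        assms(2)[unfolded has_pd_def, rule_format, of z]] by simp
qed

lemma has_pd_pderiv_dir: "has_pd i c \<phi> \<phi>' \<Longrightarrow> pderiv_dir i c \<phi> = \<phi>'"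
  unfolding has_pd_def by (intro ext) (simp add: pderiv_dir_def vector_derivative_at)

text \<open>
  \<open>wirt i \<phi> d b\<close>: the Wirtinger derivatives of \<open>\<phi>\<close> in \<open>z\<^sub>i\<close> and in its conjugate are \<open>d\<close> and \<open>b\<close>,
  so that the derivatives in \<open>x\<^sub>i\<close> and \<open>y\<^sub>i\<close> are \<open>d + b\<close> and \<open>\<i> (d - b)\<close>.
\<close>

definition wirt :: "nat \<Rightarrow> ((nat \<Rightarrow> complex) \<Rightarrow> complex) \<Rightarrow> ((nat \<Rightarrow> complex) \<Rightarrow> complex) \<Rightarrow>
    ((nat \<Rightarrow> complex) \<Rightarrow> complex) \<Rightarrow> bool" where
  "wirt i \<phi> d b \<longleftrightarrow> has_pd i 1 \<phi> (\<lambda>z. d z + b z) \<and> has_pd i \<i> \<phi> (\<lambda>z. \<i> * (d z - b z)) \<and>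
     tame \<phi> \<and> tame d \<and> tame b \<and>
     continuous_on UNIV \<phi> \<and> continuous_on UNIV d \<and> continuous_on UNIV b"

lemma wirt_const: "wirt i (\<lambda>_. k) (\<lambda>_. 0) (\<lambda>_. 0)"
  by (auto simp: wirt_def)

lemma wirt_coord: "wirt i (\<lambda>z. z j) (\<lambda>_. if j = i then 1 else 0) (\<lambda>_. 0)"
  using has_pd_coord[of i 1 j] has_pd_coord[of i \<i> j]
  by (auto simp: wirt_def continuous_on_product_coordinates)

lemma wirt_cnj: "wirt i \<phi> d b \<Longrightarrow> wirt i (\<lambda>z. cnj (\<phi> z)) (\<lambda>z. cnj (b z)) (\<lambda>z. cnj (d z))"
  unfolding wirt_def
  using has_pd_cnj[of i 1 \<phi> "\<lambda>z. d z + b z"] has_pd_cnj[of i \<i> \<phi> "\<lambda>z. \<i> * (d z - b z)"]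
  by (auto intro!: continuous_intros simp: algebra_simps)

lemma wirt_add: "wirt i \<phi> d b \<Longrightarrow> wirt i \<psi> d' b' \<Longrightarrow>
    wirt i (\<lambda>z. \<phi> z + \<psi> z) (\<lambda>z. d z + d' z) (\<lambda>z. b z + b' z)"
  unfolding wirt_def
  using has_pd_add[of i 1 \<phi> "\<lambda>z. d z + b z" \<psi> "\<lambda>z. d' z + b' z"]
    has_pd_add[of i \<i> \<phi> "\<lambda>z. \<i> * (d z - b z)" \<psi> "\<lambda>z. \<i> * (d' z - b' z)"]
  by (auto intro!: continuous_intros simp: algebra_simps)

lemma wirt_mult: "wirt i \<phi> d b \<Longrightarrow> wirt i \<psi> d' b' \<Longrightarrow>
    wirt i (\<lambda>z. \<phi> z * \<psi> z) (\<lambda>z. \<phi> z * d' z + d z * \<psi> z) (\<lambda>z. \<phi> z * b' z + b z * \<psi> z)"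
  unfolding wirt_def
  using has_pd_mult[of i 1 \<phi> "\<lambda>z. d z + b z" \<psi> "\<lambda>z. d' z + b' z"]
    has_pd_mult[of i \<i> \<phi> "\<lambda>z. \<i> * (d z - b z)" \<psi> "\<lambda>z. \<i> * (d' z - b' z)"]
  by (auto intro!: continuous_intros simp: algebra_simps)

lemma wirt_cmult: "wirt i \<phi> d b \<Longrightarrow> wirt i (\<lambda>z. k * \<phi> z) (\<lambda>z. k * d z) (\<lambda>z. k * b z)"
  using wirt_mult[OF wirt_const[of i k], of \<phi> d b] by simp

lemma wirt_diff: "wirt i \<phi> d b \<Longrightarrow> wirt i \<psi> d' b' \<Longrightarrow>
    wirt i (\<lambda>z. \<phi> z - \<psi> z) (\<lambda>z. d z - d' z) (\<lambda>z. b z - b' z)"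
  using wirt_add[of i \<phi> d b "\<lambda>z. -1 * \<psi> z"] wirt_cmult[of i \<psi> d' b' "-1"] by fastforce

lemma wirt_power0: "wirt i \<phi> (\<lambda>_. 0) (\<lambda>_. 0) \<Longrightarrow> wirt i (\<lambda>z. \<phi> z ^ k) (\<lambda>_. 0) (\<lambda>_. 0)"
proof (induction k)
  case 0 then show ?case using wirt_const[of i 1] by simp
next
  case (Suc k) then show ?case using wirt_mult[of i \<phi> "\<lambda>_. 0" "\<lambda>_. 0" "\<lambda>z. \<phi> z ^ k" "\<lambda>_. 0" "\<lambda>_. 0"] by simp
qed

lemma wirt_prod0:
  "(\<And>j. j \<in> S \<Longrightarrow> wirt i (\<phi> j) (\<lambda>_. 0) (\<lambda>_. 0)) \<Longrightarrow> wirt i (\<lambda>z. \<Prod>j\<in>S. \<phi> j z) (\<lambda>_. 0) (\<lambda>_. 0)"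
proof (induction S rule: infinite_finite_induct)
  case (insert j S)
  then show ?case
    using wirt_mult[of i "\<phi> j" "\<lambda>_. 0" "\<lambda>_. 0" "\<lambda>z. \<Prod>j\<in>S. \<phi> j z" "\<lambda>_. 0" "\<lambda>_. 0"] by simp
qed (use wirt_const[of i 1] in auto)

lemma wirt_tame: "wirt i \<phi> d b \<Longrightarrow> tame \<phi>" "wirt i \<phi> d b \<Longrightarrow> tame d" "wirt i \<phi> d b \<Longrightarrow> tame b"
  by (auto simp: wirt_def)

lemma wirt_dz: "wirt i \<phi> d b \<Longrightarrow> dz i \<phi> = d"
  unfolding wirt_def
  by (intro ext) (auto dest!: has_pd_pderiv_dir simp: dz_def)

context gauss_weights begin

text \<open>The second moment of |z_i| under \<open>P\<close>. Its ratio to a_i^2 is 2 r^2 for every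
  i, which is the origin of the constant in the theorem.\<close>

definition vv :: "nat \<Rightarrow> real" where "vv i = 2 * r\<^sup>2 * (a i)\<^sup>2"

lemma vv_pos: "vv i > 0" using r_pos a_pos[of i] by (simp add: vv_def)

text \<open>The derivatives in x_i and y_i combine to D_x F + \<i> D_y F = 2 b, and the two real
  integrations by parts turn this into (x_i + \<i> y_i) / (r a_i)^2 = z_i / (r a_i)^2. Halving
  replaces (r a_i)^2 by \<open>vv i\<close>.\<close>

lemma wirt_by_parts:
  assumes w: "wirt i F d b"
  shows "(LINT z|P. b z) = (LINT z|P. z i / of_real (vv i) * F z)"
proof -
  have t: "tame F" "tame d" "tame b" and c: "continuous_on UNIV F" "continuous_on UNIV d" "continuous_on UNIV b"
    using w by (auto simp: wirt_def)
  let ?k = "complex_of_real ((r * a i)\<^sup>2)"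
  have tr: "tame (\<lambda>z. of_real (Re (z i) / (r * a i)\<^sup>2) * F z)"
    using tame_mult[OF tame_cmult[OF tame_Re[of i], of "1 / ?k"] t(1)] by simp
  have ti: "tame (\<lambda>z. of_real (Im (z i) / (r * a i)\<^sup>2) * F z)"
    using tame_mult[OF tame_cmult[OF tame_Im[of i], of "1 / ?k"] t(1)] by simp
  have 1: "(LINT z|Q. d z + b z) = (LINT z|Q. of_real (Re (cnj 1 * z i) / (r * a i)\<^sup>2) * F z)"
    by (rule Q_by_parts) (use w t c in \<open>auto simp: wirt_def intro!: continuous_intros\<close>)
  have 2: "(LINT z|Q. \<i> * (d z - b z)) = (LINT z|Q. of_real (Re (cnj \<i> * z i) / (r * a i)\<^sup>2) * F z)"
    by (rule Q_by_parts) (use w t c in \<open>auto simp: wirt_def intro!: continuous_intros tame_cmult\<close>)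
  have id: "integrable Q d" "integrable Q b" using t tame_integrable_Q by auto
  have "2 * (LINT z|Q. b z) = (LINT z|Q. d z + b z) + \<i> * (LINT z|Q. \<i> * (d z - b z))"
    using id by (simp add: algebra_simps)
  also have "\<dots> = (LINT z|Q. of_real (Re (z i) / (r * a i)\<^sup>2) * F z) + (LINT z|Q. \<i> * (of_real (Im (z i) / (r * a i)\<^sup>2) * F z))"
    unfolding 1 2 by simp
  also have "\<dots> = (LINT z|Q. of_real (Re (z i) / (r * a i)\<^sup>2) * F z + \<i> * (of_real (Im (z i) / (r * a i)\<^sup>2) * F z))"
    using tr ti by (intro Bochner_Integration.integral_add[symmetric] tame_integrable_Q tame_cmult)
  also have "\<dots> = (LINT z|Q. 2 * (z i / of_real (vv i) * F z))" (is "_ = (LINT z|Q. 2 * ?g z)")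
  proof (rule Bochner_Integration.integral_cong[OF refl])
    fix z :: "nat \<Rightarrow> complex"
    have zi: "z i = of_real (Re (z i)) + \<i> * of_real (Im (z i))" by (rule complex_eq)
    have "of_real (Re (z i) / (r * a i)\<^sup>2) * F z + \<i> * (of_real (Im (z i) / (r * a i)\<^sup>2) * F z)
        = (of_real (Re (z i)) + \<i> * of_real (Im (z i))) / ?k * F z"
      by (simp add: add_divide_distrib distrib_right)
    also have "\<dots> = z i / ?k * F z" unfolding zi[symmetric] ..
    also have "\<dots> = 2 * (z i / of_real (vv i) * F z)" by (simp add: vv_def power_mult_distrib)
    finally show "of_real (Re (z i) / (r * a i)\<^sup>2) * F z + \<i> * (of_real (Im (z i) / (r * a i)\<^sup>2) * F z)
       = 2 * (z i / of_real (vv i) * F z)" .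
  qed
  also have "\<dots> = 2 * (LINT z|Q. ?g z)" by (rule integral_mult_right_zero)
  finally have "(LINT z|Q. b z) = (LINT z|Q. z i / of_real (vv i) * F z)"
    by (simp only: mult_cancel_left) simp
  moreover have tz: "tame (\<lambda>z. z i / of_real (vv i) * F z)"
    using tame_mult[OF tame_cmult[OF tame_coord[of i], of "1 / of_real (vv i)"] t(1)] by simp
  ultimately show ?thesis
    using integrable_P_iff(2)[OF tame_measurable[OF t(3)]] integrable_P_iff(2)[OF tame_measurable[OF tz]]
    by metis
qed

text \<open>Integrate the derivative of \<open>p * cnj q\<close> in the conjugate variable: it falls
  on \<open>p\<close> as \<open>bp\<close> and on \<open>cnj q\<close> as the conjugate of
  \<open>dq\<close>. The operator applied to \<open>q\<close> on the right is
  \<open>- delta_op\<close>, so the weak definition of the operator extends the classical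
  derivative.\<close>

lemma wirt_adjoint:
  assumes p: "wirt i p dp bp" and q: "wirt i q dq bq"
  shows "L2_inner P bp q = L2_inner P p (\<lambda>z. cnj (z i) / of_real (vv i) * q z - dq z)"
proof -
  have w: "wirt i (\<lambda>z. p z * cnj (q z)) (\<lambda>z. p z * cnj (bq z) + dp z * cnj (q z)) (\<lambda>z. p z * cnj (dq z) + bp z * cnj (q z))"
    by (rule wirt_mult[OF p wirt_cnj[OF q]])
  note t = wirt_tame[OF p] wirt_tame[OF q]
  have "tame (\<lambda>z. p z * cnj (q z))" using t by (intro tame_mult tame_cnj)
  from tame_mult[OF tame_cmult[OF tame_coord[of i], of "1 / of_real (vv i)"] this]
  have tz: "tame (\<lambda>z. z i / of_real (vv i) * (p z * cnj (q z)))" by simp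
  have i1: "integrable P (\<lambda>z. p z * cnj (dq z))" "integrable P (\<lambda>z. bp z * cnj (q z))"
    using t by (auto intro!: tame_integrable)
  have "L2_inner P bp q = (LINT z|P. p z * cnj (dq z) + bp z * cnj (q z)) - (LINT z|P. p z * cnj (dq z))"
    unfolding L2_inner_def using i1 by simp
  also have "\<dots> = (LINT z|P. z i / of_real (vv i) * (p z * cnj (q z))) - (LINT z|P. p z * cnj (dq z))"
    unfolding wirt_by_parts[OF w] ..
  also have "\<dots> = (LINT z|P. z i / of_real (vv i) * (p z * cnj (q z)) - p z * cnj (dq z))"
    by (rule Bochner_Integration.integral_diff[OF tame_integrable[OF tz] i1(1), symmetric])
  also have "\<dots> = L2_inner P p (\<lambda>z. cnj (z i) / of_real (vv i) * q z - dq z)"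
    unfolding L2_inner_def by (intro Bochner_Integration.integral_cong refl) (simp add: algebra_simps)
  finally show ?thesis .
qed

end

subsection \<open>Complex Hermite polynomials\<close>

text \<open>The derivative that the raising step requires is already replaced by its value
  \<open>of_nat m * herm v (m - 1) n\<close>; \<open>wirt_herm\<close> justifies this. At m = 0 the
  truncated index is harmless because its factor is 0.\<close>

fun herm :: "real \<Rightarrow> nat \<Rightarrow> nat \<Rightarrow> complex \<Rightarrow> complex" where
  "herm v m 0 z = z ^ m"
| "herm v m (Suc n) z = cnj z / of_real v * herm v m n z - of_nat m * herm v (m - 1) n z"

lemma wirt_coord_power:
  "wirt i (\<lambda>z. z i ^ m) (\<lambda>z. of_nat m * z i ^ (m - 1)) (\<lambda>_. 0)"
proof (induction m)
  case 0 then show ?case using wirt_const[of i 1] by simp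
next
  case (Suc m)
  have e: "(\<lambda>z::nat \<Rightarrow> complex. z i * (of_nat m * z i ^ (m - 1)) + 1 * z i ^ m) = (\<lambda>z. of_nat (Suc m) * z i ^ m)"
    by (cases m) (auto simp: algebra_simps)
  show ?case using wirt_mult[OF wirt_coord[of i i] Suc] e by simp
qed

text \<open>The derivative in z commutes with the raising step, while the derivative in the
  conjugate of z has commutator 1 / v with it, so n steps add up to n / v. The induction is over all
  m because a raising step also involves degree m - 1.\<close>

lemma wirt_herm:
  "wirt i (\<lambda>z. herm v m n (z i)) (\<lambda>z. of_nat m * herm v (m - 1) n (z i)) (\<lambda>z. of_nat n / of_real v * herm v m (n - 1) (z i))"
proof (induction n arbitrary: m)
  case 0 then show ?case using wirt_coord_power[of i m] by simp
next
  case (Suc n)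
  have c: "wirt i (\<lambda>z. cnj (z i) / of_real v) (\<lambda>_. 0) (\<lambda>_. 1 / of_real v)"
    using wirt_cmult[OF wirt_cnj[OF wirt_coord[of i i]], of "1 / of_real v"] by simp
  have e: "wirt i (\<lambda>z. herm v m (Suc n) (z i))
     (\<lambda>z. (cnj (z i) / of_real v * (of_nat m * herm v (m - 1) n (z i)) + 0 * herm v m n (z i)) - of_nat m * (of_nat (m - 1) * herm v (m - 1 - 1) n (z i)))
     (\<lambda>z. (cnj (z i) / of_real v * (of_nat n / of_real v * herm v m (n - 1) (z i)) + 1 / of_real v * herm v m n (z i)) - of_nat m * (of_nat n / of_real v * herm v (m - 1) (n - 1) (z i)))"
    using wirt_diff[OF wirt_mult[OF c Suc[of m]] wirt_cmult[OF Suc[of "m - 1"], of "of_nat m"]] by simp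
  have 1: "(cnj w / of_real v * (of_nat m * herm v (m - 1) n w) + 0 * herm v m n w) - of_nat m * (of_nat (m - 1) * herm v (m - 1 - 1) n w)
      = of_nat m * herm v (m - 1) (Suc n) w" for w
    by (simp add: algebra_simps)
  have 2: "(cnj w / of_real v * (of_nat n / of_real v * herm v m (n - 1) w) + 1 / of_real v * herm v m n w) - of_nat m * (of_nat n / of_real v * herm v (m - 1) (n - 1) w)
      = of_nat (Suc n) / of_real v * herm v m (Suc n - 1) w" for w
  proof (cases n)
    case (Suc k)
    then show ?thesis by (simp add: algebra_simps add_divide_distrib diff_divide_distrib)
  qed simp
  show ?case using e unfolding 1 2 .
qed

lemma wirt_herm_other:
  assumes "j \<noteq> i" shows "wirt i (\<lambda>z. herm v m n (z j)) (\<lambda>_. 0) (\<lambda>_. 0)"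
proof (induction n arbitrary: m)
  case 0
  have "wirt i (\<lambda>z. z j) (\<lambda>_. 0) (\<lambda>_. 0)" using wirt_coord[of i j] assms by simp
  then show ?case using wirt_power0 by simp
next
  case (Suc n)
  have "wirt i (\<lambda>z. cnj (z j)) (\<lambda>_. 0) (\<lambda>_. 0)" using wirt_cnj[OF wirt_coord[of i j]] assms by simp
  from wirt_cmult[OF this, of "1 / of_real v"] have c: "wirt i (\<lambda>z. cnj (z j) / of_real v) (\<lambda>_. 0) (\<lambda>_. 0)" by simp
  show ?case using wirt_diff[OF wirt_mult[OF c Suc[of m]] wirt_cmult[OF Suc[of "m - 1"], of "of_nat m"]] by simp
qed

text \<open>The commutator of multiplication by z with the raising step is the identity, so moving z
  through n steps leaves n equal terms. This keeps the span of the Hermite polynomials closed under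
  multiplication by coordinates, as totality requires.\<close>

lemma mult_coord_herm:
  "z * herm v m n z = herm v (Suc m) n z + of_nat n * herm v m (n - 1) z"
proof (induction n arbitrary: m)
  case (Suc n)
  have "z * herm v m (Suc n) z = cnj z / of_real v * (z * herm v m n z) - of_nat m * (z * herm v (m - 1) n z)"
    by (simp add: algebra_simps)
  also have "\<dots> = cnj z / of_real v * (herm v (Suc m) n z + of_nat n * herm v m (n - 1) z)
      - of_nat m * (herm v (Suc (m - 1)) n z + of_nat n * herm v (m - 1) (n - 1) z)"
    by (simp only: Suc)
  also have "\<dots> = herm v (Suc m) (Suc n) z + of_nat (Suc n) * herm v m (Suc n - 1) z"
    by (cases m; cases n) (simp_all add: algebra_simps add_divide_distrib)
  finally show ?case .
next
  case 0 show ?case by simp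
qed

definition Idx :: "((nat \<Rightarrow> nat) \<times> (nat \<Rightarrow> nat)) set" where
  "Idx = {(\<alpha>, \<beta>). finite {i. \<alpha> i \<noteq> 0} \<and> finite {i. \<beta> i \<noteq> 0}}"

context gauss_weights begin

definition hermite :: "(nat \<Rightarrow> nat) \<Rightarrow> (nat \<Rightarrow> nat) \<Rightarrow> (nat \<Rightarrow> complex) \<Rightarrow> complex" where
  "hermite \<alpha> \<beta> z = (\<Prod>i | \<alpha> i \<noteq> 0 \<or> \<beta> i \<noteq> 0. herm (vv i) (\<alpha> i) (\<beta> i) (z i))"

lemma hermite_eq_prod:
  assumes "finite S" "{i. \<alpha> i \<noteq> 0 \<or> \<beta> i \<noteq> 0} \<subseteq> S"
  shows "hermite \<alpha> \<beta> z = (\<Prod>i\<in>S. herm (vv i) (\<alpha> i) (\<beta> i) (z i))"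
  unfolding hermite_def by (rule prod.mono_neutral_left) (use assms in auto)

lemma Idx_support:
  assumes "(\<alpha>, \<beta>) \<in> Idx"
  obtains S where "finite S" "i \<in> S" "{i. \<alpha> i \<noteq> 0 \<or> \<beta> i \<noteq> 0} \<subseteq> S"
proof -
  have "finite (insert i ({i. \<alpha> i \<noteq> 0} \<union> {i. \<beta> i \<noteq> 0}))" using assms by (simp add: Idx_def)
  then show thesis by (rule that) blast+
qed

text \<open>The degrees at i are free while \<open>S\<close>, \<alpha> and \<beta> are fixed, so all
  terms of a one-variable identity at i share the same cofactor and the identity lifts to
  \<open>hermite\<close>.\<close>

lemma hermite_remove:
  assumes "finite S" "i \<in> S" "{i. \<alpha> i \<noteq> 0 \<or> \<beta> i \<noteq> 0} \<subseteq> S"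
  shows "hermite (\<alpha>(i := m)) (\<beta>(i := n)) z
    = herm (vv i) m n (z i) * (\<Prod>j\<in>S - {i}. herm (vv j) (\<alpha> j) (\<beta> j) (z j))"
proof -
  have "hermite (\<alpha>(i := m)) (\<beta>(i := n)) z = (\<Prod>j\<in>S. herm (vv j) ((\<alpha>(i := m)) j) ((\<beta>(i := n)) j) (z j))"
    by (rule hermite_eq_prod) (use assms in auto)
  then show ?thesis using assms(1,2) by (simp add: prod.remove)
qed

lemma wirt_hermite:
  assumes "(\<alpha>, \<beta>) \<in> Idx"
  shows "wirt i (hermite \<alpha> \<beta>) (\<lambda>z. of_nat (\<alpha> i) * hermite (\<alpha>(i := \<alpha> i - 1)) \<beta> z)
     (\<lambda>z. of_nat (\<beta> i) / of_real (vv i) * hermite \<alpha> (\<beta>(i := \<beta> i - 1)) z)"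
proof -
  obtain S where S: "finite S" "i \<in> S" "{i. \<alpha> i \<noteq> 0 \<or> \<beta> i \<noteq> 0} \<subseteq> S"
    using Idx_support[OF assms] by blast
  define R where "R z = (\<Prod>j\<in>S - {i}. herm (vv j) (\<alpha> j) (\<beta> j) (z j))" for z
  have R: "wirt i R (\<lambda>_. 0) (\<lambda>_. 0)" unfolding R_def
    by (rule wirt_prod0) (auto intro: wirt_herm_other)
  note rm = hermite_remove[OF S, folded R_def]
  have e0: "hermite \<alpha> \<beta> = (\<lambda>z. herm (vv i) (\<alpha> i) (\<beta> i) (z i) * R z)"
    using rm[of "\<alpha> i" "\<beta> i"] by auto
  have e1: "hermite (\<alpha>(i := \<alpha> i - 1)) \<beta> = (\<lambda>z. herm (vv i) (\<alpha> i - 1) (\<beta> i) (z i) * R z)"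
    using rm[of "\<alpha> i - 1" "\<beta> i"] by auto
  have e2: "hermite \<alpha> (\<beta>(i := \<beta> i - 1)) = (\<lambda>z. herm (vv i) (\<alpha> i) (\<beta> i - 1) (z i) * R z)"
    using rm[of "\<alpha> i" "\<beta> i - 1"] by auto
  show ?thesis using wirt_mult[OF wirt_herm[of i "vv i" "\<alpha> i" "\<beta> i"] R]
    unfolding e0 e1 e2 by (simp add: mult.assoc)
qed

lemma hermite_raise:
  assumes "(\<alpha>, \<beta>) \<in> Idx"
  shows "cnj (z i) / of_real (vv i) * hermite \<alpha> \<beta> z - of_nat (\<alpha> i) * hermite (\<alpha>(i := \<alpha> i - 1)) \<beta> z
     = hermite \<alpha> (\<beta>(i := \<beta> i + 1)) z"
proof -
  obtain S where S: "finite S" "i \<in> S" "{i. \<alpha> i \<noteq> 0 \<or> \<beta> i \<noteq> 0} \<subseteq> S"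
    using Idx_support[OF assms] by blast
  note rm = hermite_remove[OF S]
  show ?thesis
    using rm[of "\<alpha> i" "\<beta> i" z] rm[of "\<alpha> i - 1" "\<beta> i" z] rm[of "\<alpha> i" "\<beta> i + 1" z]
    by (simp add: left_diff_distrib mult.assoc)
qed

lemma hermite_mult_coord:
  assumes "(\<alpha>, \<beta>) \<in> Idx"
  shows "z i * hermite \<alpha> \<beta> z = hermite (\<alpha>(i := \<alpha> i + 1)) \<beta> z + of_nat (\<beta> i) * hermite \<alpha> (\<beta>(i := \<beta> i - 1)) z"
proof -
  obtain S where S: "finite S" "i \<in> S" "{i. \<alpha> i \<noteq> 0 \<or> \<beta> i \<noteq> 0} \<subseteq> S"
    using Idx_support[OF assms] by blast
  note rm = hermite_remove[OF S]
  show ?thesis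
    using rm[of "\<alpha> i" "\<beta> i" z] rm[of "\<alpha> i + 1" "\<beta> i" z] rm[of "\<alpha> i" "\<beta> i - 1" z]
      mult_coord_herm[of "z i" "vv i" "\<alpha> i" "\<beta> i"]
    by (simp add: distrib_right mult.assoc[symmetric])
qed

lemma Idx_upd: "(\<alpha>, \<beta>) \<in> Idx \<Longrightarrow> (\<alpha>(i := m), \<beta>(j := n)) \<in> Idx"
proof -
  assume "(\<alpha>, \<beta>) \<in> Idx"
  then have f: "finite {k. \<alpha> k \<noteq> 0}" "finite {k. \<beta> k \<noteq> 0}" by (auto simp: Idx_def)
  have "finite {k. (\<alpha>(i := m)) k \<noteq> 0}"
    by (rule finite_subset[of _ "insert i {k. \<alpha> k \<noteq> 0}"]) (use f in auto)
  moreover have "finite {k. (\<beta>(j := n)) k \<noteq> 0}"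
    by (rule finite_subset[of _ "insert j {k. \<beta> k \<noteq> 0}"]) (use f in auto)
  ultimately show ?thesis by (simp add: Idx_def)
qed

lemma tame_hermite: "(\<alpha>, \<beta>) \<in> Idx \<Longrightarrow> tame (hermite \<alpha> \<beta>)"
  using wirt_tame(1)[OF wirt_hermite[of \<alpha> \<beta> 0]] .

lemma tame_herm_coord: "tame (\<lambda>z. herm v m n (z i))"
  by (rule wirt_tame(1)[OF wirt_herm])

text \<open>Each raising step in the second argument moves to the first as a lowering one and
  contributes n / v, until only powers of the coordinate remain. Those are orthogonal by the same
  integration by parts.\<close>

lemma herm_inner:
  "L2_inner P (\<lambda>z. herm (vv i) m n (z i)) (\<lambda>z. herm (vv i) m' n' (z i))
    = (if m = m' \<and> n = n' then of_real (fact m * vv i ^ m * fact n / vv i ^ n) else 0)"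
proof -
  let ?v = "vv i"
  define ip where "ip m n m' n' = L2_inner P (\<lambda>z. herm ?v m n (z i)) (\<lambda>z. herm ?v m' n' (z i))" for m n m' n'
  have v0: "?v \<noteq> 0" using vv_pos[of i] by simp
  have cnj_ip: "ip m n m' n' = cnj (ip m' n' m n)" for m n m' n'
    by (simp add: ip_def L2_inner_cnj)
  have step: "ip m n m' (Suc n') = of_nat n / of_real ?v * ip m (n - 1) m' n'" for m n m' n'
  proof -
    have "L2_inner P (\<lambda>z. of_nat n / of_real ?v * herm ?v m (n - 1) (z i)) (\<lambda>z. herm ?v m' n' (z i))
        = L2_inner P (\<lambda>z. herm ?v m n (z i)) (\<lambda>z. herm ?v m' (Suc n') (z i))"
      using wirt_adjoint[OF wirt_herm[of i ?v m n] wirt_herm[of i ?v m' n']] by simp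
    then show ?thesis unfolding ip_def L2_inner_cmult_left by simp
  qed
  have base: "ip m 0 m' 0 = (if m = m' then of_real (fact m * ?v ^ m) else 0)" for m m'
  proof (induction m arbitrary: m')
    case 0
    show ?case
    proof (cases m')
      case 0 then show ?thesis by (simp add: ip_def L2_inner_def Pm.prob_space)
    next
      case (Suc k)
      have w: "wirt i (\<lambda>z. z i ^ k) (\<lambda>z. of_nat k * z i ^ (k - 1)) (\<lambda>_. 0)" by (rule wirt_coord_power)
      have "0 = (LINT z|P. z i / of_real ?v * z i ^ k)" using wirt_by_parts[OF w] by simp
      also have "\<dots> = (LINT z|P. z i ^ Suc k) / of_real ?v" by simp
      finally have "(LINT z|P. z i ^ Suc k) = 0" using v0 by (metis divide_eq_0_iff of_real_eq_0_iff)
      then have "cnj (LINT z|P. z i ^ Suc k) = 0" by (simp only: complex_cnj_zero)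
      then have "(LINT z|P. cnj (z i ^ Suc k)) = 0" by (simp only: Bochner_Integration.integral_cnj)
      then show ?thesis using Suc by (simp add: ip_def L2_inner_def)
    qed
  next
    case (Suc m)
    \<comment> \<open>By parts, the mean of z^(m + 1) times the conjugate of z^m' is v m' times the
      mean of z^m times the conjugate of z^(m' - 1): both powers drop by one.\<close>
    have w: "wirt i (\<lambda>z. z i ^ m * cnj (z i ^ m')) (\<lambda>z. z i ^ m * cnj 0 + of_nat m * z i ^ (m - 1) * cnj (z i ^ m'))
       (\<lambda>z. z i ^ m * cnj (of_nat m' * z i ^ (m' - 1)) + 0 * cnj (z i ^ m'))"
      by (rule wirt_mult[OF wirt_coord_power wirt_cnj[OF wirt_coord_power]])
    have "(LINT z|P. z i ^ m * cnj (of_nat m' * z i ^ (m' - 1)) + 0 * cnj (z i ^ m')) = (LINT z|P. of_nat m' * (z i ^ m * cnj (z i ^ (m' - 1))))"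
      by (intro Bochner_Integration.integral_cong refl) simp
    also have "\<dots> = of_nat m' * ip m 0 (m' - 1) 0"
      by (simp add: ip_def L2_inner_def)
    finally have l: "(LINT z|P. z i ^ m * cnj (of_nat m' * z i ^ (m' - 1)) + 0 * cnj (z i ^ m')) = of_nat m' * ip m 0 (m' - 1) 0" .
    have "(LINT z|P. z i / of_real ?v * (z i ^ m * cnj (z i ^ m'))) = (LINT z|P. 1 / of_real ?v * (z i ^ Suc m * cnj (z i ^ m')))"
      by (intro Bochner_Integration.integral_cong refl) simp
    also have "\<dots> = 1 / of_real ?v * ip (Suc m) 0 m' 0"
      unfolding Bochner_Integration.integral_mult_right_zero by (simp add: ip_def L2_inner_def)
    finally have "of_nat m' * ip m 0 (m' - 1) 0 = 1 / of_real ?v * ip (Suc m) 0 m' 0"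
      using wirt_by_parts[OF w] l by metis
    then have "ip (Suc m) 0 m' 0 = of_real ?v * of_nat m' * ip m 0 (m' - 1) 0"
      using v0 by (simp add: field_simps)
    then show ?case unfolding Suc by (cases m') auto
  qed
  have "ip m n m' n' = (if m = m' \<and> n = n' then of_real (fact m * ?v ^ m * fact n / ?v ^ n) else 0)" for m n m' n'
  proof (induction n' arbitrary: n)
    case 0
    show ?case
    proof (cases n)
      case 0 then show ?thesis using base by simp
    next
      case (Suc k)
      \<comment> \<open>Symmetry puts the raising steps in the second argument, where they meet
        conjugate degree 0 and give 0.\<close>
      have "ip m (Suc k) m' 0 = cnj (ip m' 0 m (Suc k))" by (rule cnj_ip)
      also have "\<dots> = 0" unfolding step by simp
      finally show ?thesis using Suc by simp
    qed
  next
    case (Suc n')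
    show ?case unfolding step Suc using v0 by (cases n) (auto simp: field_simps)
  qed
  then show ?thesis by (simp add: ip_def)
qed

definition hermite_norm_sq :: "(nat \<Rightarrow> nat) \<Rightarrow> (nat \<Rightarrow> nat) \<Rightarrow> real" where
  "hermite_norm_sq \<alpha> \<beta> = (\<Prod>i | \<alpha> i \<noteq> 0 \<or> \<beta> i \<noteq> 0. fact (\<alpha> i) * vv i ^ \<alpha> i * fact (\<beta> i) / vv i ^ \<beta> i)"

lemma hermite_norm_sq_eq_prod:
  assumes "finite S" "{i. \<alpha> i \<noteq> 0 \<or> \<beta> i \<noteq> 0} \<subseteq> S"
  shows "hermite_norm_sq \<alpha> \<beta> = (\<Prod>i\<in>S. fact (\<alpha> i) * vv i ^ \<alpha> i * fact (\<beta> i) / vv i ^ \<beta> i)"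
  unfolding hermite_norm_sq_def by (rule prod.mono_neutral_left) (use assms in auto)

lemma hermite_norm_sq_pos: "hermite_norm_sq \<alpha> \<beta> > 0"
  unfolding hermite_norm_sq_def using vv_pos by (intro prod_pos) auto

text \<open>The coordinates are independent under \<open>Q\<close>, so the pairing is a product of
  one-variable pairings, and degrees that differ anywhere make one factor 0.\<close>

lemma hermite_inner:
  assumes p: "(\<alpha>, \<beta>) \<in> Idx" and q: "(\<alpha>', \<beta>') \<in> Idx"
  shows "L2_inner P (hermite \<alpha> \<beta>) (hermite \<alpha>' \<beta>') = (if \<alpha> = \<alpha>' \<and> \<beta> = \<beta>' then of_real (hermite_norm_sq \<alpha> \<beta>) else 0)"
proof -
  obtain S1 where S1: "finite S1" "{i. \<alpha> i \<noteq> 0 \<or> \<beta> i \<noteq> 0} \<subseteq> S1" using Idx_support[OF p] by metis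
  obtain S2 where S2: "finite S2" "{i. \<alpha>' i \<noteq> 0 \<or> \<beta>' i \<noteq> 0} \<subseteq> S2" using Idx_support[OF q] by metis
  define S where "S = S1 \<union> S2"
  have S: "finite S" "{i. \<alpha> i \<noteq> 0 \<or> \<beta> i \<noteq> 0} \<subseteq> S" "{i. \<alpha>' i \<noteq> 0 \<or> \<beta>' i \<noteq> 0} \<subseteq> S"
    using S1 S2 by (auto simp: S_def)
  let ?f = "\<lambda>j x. herm (vv j) (\<alpha> j) (\<beta> j) x * cnj (herm (vv j) (\<alpha>' j) (\<beta>' j) x)"
  have tf: "tame (\<lambda>z. ?f j (z j))" for j by (intro tame_mult tame_cnj tame_herm_coord)
  have mf: "?f j \<in> borel_measurable borel" for j
  proof -
    have "continuous_on UNIV (\<lambda>x. herm v m n x)" for v m n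
      by (induction n arbitrary: m) (auto intro!: continuous_intros simp: divide_inverse)
    then show ?thesis by (intro borel_measurable_continuous_onI continuous_intros)
  qed
  \<comment> \<open>Integrability on one factor is read back from \<open>Q\<close>, where tameness
    provides it.\<close>
  have fi: "integrable (gc j) (?f j)" for j
  proof -
    have d: "distr Q (gc j) (\<lambda>z. z j) = gc j"
      unfolding gauss_prod_def by (rule distr_PiM_component) (use prob_gc in auto)
    have m: "(\<lambda>z. z j) \<in> measurable Q (gc j)" unfolding gauss_prod_def by measurable
    have m2: "?f j \<in> borel_measurable (gc j)"
      by (subst measurable_cong_sets[OF sets_gauss_complex refl]) (rule mf)
    show ?thesis
      using integrable_distr_eq[OF m m2] tame_integrable_Q[OF tf[of j]] unfolding d by simp
  qed
  have "L2_inner P (hermite \<alpha> \<beta>) (hermite \<alpha>' \<beta>') = (LINT z|Q. hermite \<alpha> \<beta> z * cnj (hermite \<alpha>' \<beta>' z))"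
    unfolding L2_inner_def
    by (rule integrable_P_iff(2)[OF tame_measurable]) (intro tame_mult tame_cnj tame_hermite p q)
  also have "\<dots> = (LINT z|Q. (\<Prod>j\<in>S. ?f j (z j)))"
    by (simp add: hermite_eq_prod[OF S(1,2)] hermite_eq_prod[OF S(1,3)] prod.distrib)
  also have "\<dots> = (\<Prod>j\<in>S. LINT x|gc j. ?f j x)" by (rule integral_prod_coords(2)[OF S(1) fi])
  also have "\<dots> = (\<Prod>j\<in>S. if \<alpha> j = \<alpha>' j \<and> \<beta> j = \<beta>' j then of_real (fact (\<alpha> j) * vv j ^ \<alpha> j * fact (\<beta> j) / vv j ^ \<beta> j) else 0)"
  proof (rule prod.cong[OF refl])
    fix j
    have "(LINT x|gc j. ?f j x) = (LINT z|Q. ?f j (z j))" by (rule integral_coord[OF fi, symmetric])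
    also have "\<dots> = L2_inner P (\<lambda>z. herm (vv j) (\<alpha> j) (\<beta> j) (z j)) (\<lambda>z. herm (vv j) (\<alpha>' j) (\<beta>' j) (z j))"
      unfolding L2_inner_def by (rule integrable_P_iff(2)[OF tame_measurable[OF tf], symmetric])
    finally show "(LINT x|gc j. ?f j x) = (if \<alpha> j = \<alpha>' j \<and> \<beta> j = \<beta>' j then of_real (fact (\<alpha> j) * vv j ^ \<alpha> j * fact (\<beta> j) / vv j ^ \<beta> j) else 0)"
      unfolding herm_inner .
  qed
  also have "\<dots> = (if \<alpha> = \<alpha>' \<and> \<beta> = \<beta>' then of_real (hermite_norm_sq \<alpha> \<beta>) else 0)"
  proof (cases "\<alpha> = \<alpha>' \<and> \<beta> = \<beta>'")
    case True then show ?thesis by (simp add: hermite_norm_sq_eq_prod[OF S(1,3)])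
  next
    case False
    then obtain j where j: "\<not> (\<alpha> j = \<alpha>' j \<and> \<beta> j = \<beta>' j)" by auto
    have "\<alpha> j \<noteq> 0 \<or> \<beta> j \<noteq> 0 \<or> \<alpha>' j \<noteq> 0 \<or> \<beta>' j \<noteq> 0" using j by auto
    then have "j \<in> S" using S(2,3) by blast
    then show ?thesis using False j S(1) by (auto intro!: prod_zero)
  qed
  finally show ?thesis .
qed

end

subsection \<open>Test functions and cutoffs\<close>

text \<open>The order is explicit because the derivative of a product contains the undifferentiated
  factors: \<open>Ck_mult\<close> is an induction on k that uses the passage from order k + 1 to k.
  Smoothness is \<open>Ck k\<close> for all k.\<close>

primrec Ck :: "nat \<Rightarrow> ((nat \<Rightarrow> complex) \<Rightarrow> complex) \<Rightarrow> bool" where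
  "Ck 0 \<phi> \<longleftrightarrow> continuous_on UNIV \<phi>"
| "Ck (Suc k) \<phi> \<longleftrightarrow> continuous_on UNIV \<phi> \<and> (\<forall>i c. \<exists>\<phi>'. has_pd i c \<phi> \<phi>' \<and> Ck k \<phi>')"

lemma Ck_cont: "Ck k \<phi> \<Longrightarrow> continuous_on UNIV \<phi>"
  by (cases k) auto

lemma Ck_SucD: "Ck (Suc k) \<phi> \<Longrightarrow> Ck k \<phi>"
proof (induction k arbitrary: \<phi>)
  case (Suc k)
  show ?case unfolding Ck.simps(2)[of k]
  proof (intro conjI allI)
    show "continuous_on UNIV \<phi>" using Ck_cont[OF Suc.prems] .
    fix i c
    obtain \<phi>' where "has_pd i c \<phi> \<phi>'" "Ck (Suc k) \<phi>'" using Suc.prems unfolding Ck.simps(2)[of "Suc k"] by blast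
    then show "\<exists>\<phi>'. has_pd i c \<phi> \<phi>' \<and> Ck k \<phi>'" using Suc.IH by blast
  qed
qed simp

lemma Ck_const: "Ck k (\<lambda>_. c)"
proof (induction k arbitrary: c)
  case (Suc k)
  then show ?case using has_pd_const by (auto intro!: exI[of _ "\<lambda>_. 0"])
qed simp

lemma Ck_add: "Ck k \<phi> \<Longrightarrow> Ck k \<psi> \<Longrightarrow> Ck k (\<lambda>z. \<phi> z + \<psi> z)"
proof (induction k arbitrary: \<phi> \<psi>)
  case (Suc k)
  show ?case unfolding Ck.simps(2)
  proof (intro conjI allI)
    show "continuous_on UNIV (\<lambda>z. \<phi> z + \<psi> z)" using Suc.prems[THEN Ck_cont] by (rule continuous_on_add)
    fix i c
    obtain \<phi>' \<psi>' where "has_pd i c \<phi> \<phi>'" "Ck k \<phi>'" "has_pd i c \<psi> \<psi>'" "Ck k \<psi>'"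
      using Suc.prems unfolding Ck.simps(2) by meson
    then show "\<exists>\<xi>. has_pd i c (\<lambda>z. \<phi> z + \<psi> z) \<xi> \<and> Ck k \<xi>"
      using has_pd_add Suc.IH by blast
  qed
qed (simp add: continuous_on_add)

lemma Ck_mult: "Ck k \<phi> \<Longrightarrow> Ck k \<psi> \<Longrightarrow> Ck k (\<lambda>z. \<phi> z * \<psi> z)"
proof (induction k arbitrary: \<phi> \<psi>)
  case (Suc k)
  show ?case unfolding Ck.simps(2)
  proof (intro conjI allI)
    show "continuous_on UNIV (\<lambda>z. \<phi> z * \<psi> z)" using Suc.prems[THEN Ck_cont] by (rule continuous_on_mult)
    fix i c
    obtain \<phi>' \<psi>' where d: "has_pd i c \<phi> \<phi>'" "Ck k \<phi>'" "has_pd i c \<psi> \<psi>'" "Ck k \<psi>'"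
      using Suc.prems unfolding Ck.simps(2) by meson
    have "Ck k (\<lambda>z. \<phi> z * \<psi>' z + \<phi>' z * \<psi> z)"
      using Suc.prems[THEN Ck_SucD] d by (intro Ck_add Suc.IH)
    then show "\<exists>\<xi>. has_pd i c (\<lambda>z. \<phi> z * \<psi> z) \<xi> \<and> Ck k \<xi>"
      using has_pd_mult[OF d(1,3)] by blast
  qed
qed (simp add: continuous_on_mult)

lemma Ck_prod: "(\<And>j. j \<in> S \<Longrightarrow> Ck k (\<phi> j)) \<Longrightarrow> Ck k (\<lambda>z. \<Prod>j\<in>S. \<phi> j z)"
proof (induction S rule: infinite_finite_induct)
  case (insert j S)
  have "Ck k (\<lambda>z. \<phi> j z * (\<Prod>j\<in>S. \<phi> j z))" using insert by (intro Ck_mult) auto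
  then show ?case using insert.hyps by simp
qed (simp_all add: Ck_const)

lemma Ck_coord: "Ck k (\<lambda>z. z j)"
proof (cases k)
  case (Suc l)
  show ?thesis unfolding Suc Ck.simps(2)
  proof (intro conjI allI)
    show "continuous_on UNIV (\<lambda>z::nat \<Rightarrow> complex. z j)" by (rule continuous_on_product_coordinates)
    fix i c
    show "\<exists>\<xi>. has_pd i c (\<lambda>z. z j) \<xi> \<and> Ck l \<xi>"
      by (rule exI, rule conjI, rule has_pd_coord, rule Ck_const)
  qed
qed (simp add: continuous_on_product_coordinates)

lemma Ck_cnj: "Ck k \<phi> \<Longrightarrow> Ck k (\<lambda>z. cnj (\<phi> z))"
proof (induction k arbitrary: \<phi>)
  case (Suc k)
  show ?case unfolding Ck.simps(2)
  proof (intro conjI allI)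
    show "continuous_on UNIV (\<lambda>z. cnj (\<phi> z))" using Ck_cont[OF Suc.prems] by (rule continuous_on_cnj)
    fix i c
    obtain \<phi>' where "has_pd i c \<phi> \<phi>'" "Ck k \<phi>'" using Suc.prems unfolding Ck.simps(2) by blast
    then show "\<exists>\<xi>. has_pd i c (\<lambda>z. cnj (\<phi> z)) \<xi> \<and> Ck k \<xi>"
      using has_pd_cnj Suc.IH by blast
  qed
qed (simp add: continuous_on_cnj)

lemma Ck_herm: "Ck k (\<lambda>z. herm v m n (z j))"
proof (induction n arbitrary: m)
  case 0
  have "Ck k (\<lambda>z. \<Prod>_\<in>{..<m}. z j)" by (rule Ck_prod) (rule Ck_coord)
  then show ?case by simp
next
  case (Suc n)
  have "Ck k (\<lambda>z. (1 / of_real v) * cnj (z j) * herm v m n (z j) + (- of_nat m) * herm v (m - 1) n (z j))"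
    by (rule Ck_add; rule Ck_mult; (rule Ck_mult)?) (rule Ck_const Ck_cnj Ck_coord Suc)+
  then show ?case by simp
qed

lemma has_pd_scale:
  assumes "has_pd i c \<phi> \<phi>'"
  shows "has_pd i c (\<lambda>z. \<phi> (\<lambda>j. of_real s * z j)) (\<lambda>z. of_real s * \<phi>' (\<lambda>j. of_real s * z j))"
  unfolding has_pd_def
proof
  fix z :: "nat \<Rightarrow> complex"
  let ?z = "\<lambda>j. of_real s * z j"
  have "((\<lambda>h::real. \<phi> (?z(i := ?z i + of_real h * c))) has_vector_derivative \<phi>' ?z) (at (s * 0))"
    using assms[unfolded has_pd_def, rule_format, of ?z] by simp
  then have "((\<lambda>h::real. \<phi> (?z(i := ?z i + of_real h * c))) \<circ> (\<lambda>h. s * h) has_vector_derivative s *\<^sub>R \<phi>' ?z) (at 0)"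
    by (intro vector_diff_chain_at) (auto intro!: derivative_eq_intros)
  moreover have "(\<lambda>h::real. \<phi> (?z(i := ?z i + of_real h * c))) \<circ> (\<lambda>h. s * h)
      = (\<lambda>h. \<phi> (\<lambda>j. of_real s * (z(i := z i + of_real h * c)) j))"
    by (intro ext) (simp add: o_def, rule arg_cong[of _ _ \<phi>], simp add: fun_eq_iff algebra_simps)
  ultimately show "((\<lambda>h::real. \<phi> (\<lambda>j. of_real s * (z(i := z i + of_real h * c)) j))
      has_vector_derivative of_real s * \<phi>' ?z) (at 0)"
    by (simp only: scaleR_conv_of_real)
qed

lemma continuous_on_scale_seq: "continuous_on UNIV (\<lambda>z::nat \<Rightarrow> complex. \<lambda>j. k * z j)"
  by (rule continuous_on_coordinatewise_then_product)
     (intro continuous_on_mult continuous_on_const continuous_on_product_coordinates)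

lemma Ck_scale: "Ck k \<phi> \<Longrightarrow> Ck k (\<lambda>z. \<phi> (\<lambda>j. of_real s * z j))"
proof (induction k arbitrary: \<phi>)
  case 0
  then show ?case
    using continuous_on_compose2[OF _ continuous_on_scale_seq[of "of_real s"], of UNIV \<phi>] by simp
next
  case (Suc k)
  show ?case unfolding Ck.simps(2)
  proof (intro conjI allI)
    show "continuous_on UNIV (\<lambda>z. \<phi> (\<lambda>j. of_real s * z j))"
      using continuous_on_compose2[OF Ck_cont[OF Suc.prems] continuous_on_scale_seq[of "of_real s"]] by simp
    fix i c
    obtain \<phi>' where d: "has_pd i c \<phi> \<phi>'" "Ck k \<phi>'" using Suc.prems unfolding Ck.simps(2) by blast
    have "Ck k (\<lambda>z. of_real s * \<phi>' (\<lambda>j. of_real s * z j))"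
      by (rule Ck_mult[OF Ck_const Suc.IH[OF d(2)]])
    then show "\<exists>\<xi>. has_pd i c (\<lambda>z. \<phi> (\<lambda>j. of_real s * z j)) \<xi> \<and> Ck k \<xi>"
      using has_pd_scale[OF d(1), of s] by blast
  qed
qed

text \<open>
  All derivatives of \<open>exp (- 1 / x)\<close>, extended by \<open>0\<close> to the left of \<open>0\<close>, have this form for
  some polynomial \<open>p\<close>.
\<close>

definition gbump :: "real poly \<Rightarrow> real \<Rightarrow> real" where
  "gbump p x = (if x > 0 then poly p (1 / x) * exp (- (1 / x)) else 0)"

lemma poly_exp_tendsto: "((\<lambda>y. poly p y * exp (- y)) \<longlongrightarrow> (0::real)) at_top"
proof -
  have "((\<lambda>y. \<Sum>i\<le>degree p. coeff p i * (y ^ i / exp y)) \<longlongrightarrow> (\<Sum>i\<le>degree p. coeff p i * 0)) at_top"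
    by (intro tendsto_sum tendsto_mult tendsto_const tendsto_power_div_exp_0)
  then show ?thesis by (simp add: poly_altdef exp_minus divide_inverse sum_distrib_right mult.assoc)
qed

text \<open>In the variable y = 1/x the chain rule produces the factor y^2, which is
  \<open>[:0, 0, 1:]\<close>, and p - p' collects the derivatives of the exponential and of the
  polynomial. At 0 only the difference quotient from the right is in question, and the exponential
  beats its powers of y.\<close>

lemma gbump_deriv:
  "(gbump p has_real_derivative gbump ([:0, 0, 1:] * (p - pderiv p)) x) (at x)"
proof -
  consider "x > 0" | "x < 0" | "x = 0" by linarith
  then show ?thesis
  proof cases
    case 1
    have "((\<lambda>x. poly p (1 / x) * exp (- (1 / x))) has_real_derivative
        (poly p (1/x) * (exp (- (1/x)) * (1 / x\<^sup>2)) + (poly (pderiv p) (1/x) * (- 1 / x\<^sup>2)) * exp (- (1/x)))) (at x)"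
      by (rule derivative_eq_intros DERIV_chain2[OF poly_DERIV] refl
          | (use 1 in \<open>simp add: power2_eq_square\<close>))+
    moreover have "(poly p (1/x) * (exp (- (1/x)) * (1 / x\<^sup>2)) + (poly (pderiv p) (1/x) * (- 1 / x\<^sup>2)) * exp (- (1/x)))
        = gbump ([:0, 0, 1:] * (p - pderiv p)) x"
      using 1 by (simp add: gbump_def power2_eq_square field_simps)
    ultimately have "((\<lambda>x. poly p (1 / x) * exp (- (1 / x))) has_real_derivative gbump ([:0, 0, 1:] * (p - pderiv p)) x) (at x)"
      by simp
    then show ?thesis
      by (rule has_field_derivative_transform_within_open[of _ _ _ "{0<..}"]) (use 1 in \<open>auto simp: gbump_def\<close>)
  next
    case 2
    have "((\<lambda>x. 0) has_real_derivative gbump ([:0, 0, 1:] * (p - pderiv p)) x) (at x)"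
      using 2 by (simp add: gbump_def)
    then show ?thesis
      by (rule has_field_derivative_transform_within_open[of _ _ _ "{..<0}"]) (use 2 in \<open>auto simp: gbump_def\<close>)
  next
    case 3
    have "((\<lambda>h. gbump p h / h) \<longlongrightarrow> 0) (at_right 0)"
    proof -
      \<comment> \<open>\<open>pCons 0 p\<close> is the polynomial y p(y); the additional y is the
        1/h of the difference quotient.\<close>
      have "((\<lambda>h. poly (pCons 0 p) (inverse h) * exp (- inverse h)) \<longlongrightarrow> (0::real)) (at_right 0)"
        by (rule filterlim_compose[OF poly_exp_tendsto filterlim_inverse_at_top_right])
      then show ?thesis
        by (rule Lim_transform_eventually)
           (auto simp: eventually_at_right_field gbump_def field_simps intro!: exI[of _ 1])
    qed
    moreover have "((\<lambda>h. gbump p h / h) \<longlongrightarrow> 0) (at_left 0)"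
      by (rule Lim_transform_eventually[OF tendsto_const])
         (auto simp: eventually_at_left_field gbump_def intro!: exI[of _ "-1"])
    ultimately have "((\<lambda>h. gbump p h / h) \<longlongrightarrow> 0) (at 0)" by (simp add: filterlim_split_at)
    then show ?thesis unfolding 3 by (simp add: DERIV_def gbump_def)
  qed
qed

lemma continuous_gbump: "continuous_on UNIV (gbump p)"
  by (intro continuous_at_imp_continuous_on ballI DERIV_isCont[OF gbump_deriv])

text \<open>In every direction the argument is affine, so a derivative is a constant times another
  member of the family; the induction therefore runs over all \<open>p\<close>.\<close>

lemma Ck_gbump: "Ck k (\<lambda>z. of_real (gbump p (1 + Re (u * z j))))"
proof (induction k arbitrary: p)
  case 0
  have "continuous_on UNIV (\<lambda>z::nat \<Rightarrow> complex. 1 + Re (u * z j))"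
    by (intro continuous_intros continuous_on_product_coordinates)
  from continuous_on_compose2[OF continuous_gbump this] show ?case
    by (simp add: continuous_on_of_real)
next
  case (Suc k)
  let ?q = "[:0, 0, 1:] * (p - pderiv p)"
  show ?case unfolding Ck.simps(2)
  proof (intro conjI allI)
    have "continuous_on UNIV (\<lambda>z::nat \<Rightarrow> complex. 1 + Re (u * z j))"
      by (intro continuous_intros continuous_on_product_coordinates)
    from continuous_on_compose2[OF continuous_gbump this]
    show "continuous_on UNIV (\<lambda>z. complex_of_real (gbump p (1 + Re (u * z j))))"
      by (simp add: continuous_on_of_real)
    fix i c
    define k' where "k' = (if j = i then Re (u * c) else 0)"
    have "has_pd i c (\<lambda>z. complex_of_real (gbump p (1 + Re (u * z j)))) (\<lambda>z. of_real k' * of_real (gbump ?q (1 + Re (u * z j))))"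
      unfolding has_pd_def
    proof
      fix z :: "nat \<Rightarrow> complex"
      have arg: "1 + Re (u * (z(i := z i + of_real h * c)) j) = 1 + Re (u * z j) + h * k'" for h :: real
      proof -
        have "u * (z i + of_real h * c) = u * z i + of_real h * (u * c)" by (simp add: algebra_simps)
        then show ?thesis by (simp add: k'_def algebra_simps)
      qed
      have "((\<lambda>h. gbump p (1 + Re (u * z j) + h * k')) has_real_derivative gbump ?q (1 + Re (u * z j) + 0 * k') * k') (at 0)"
        by (rule DERIV_chain2[OF gbump_deriv]) (auto intro!: derivative_eq_intros)
      then have "((\<lambda>h. complex_of_real (gbump p (1 + Re (u * z j) + h * k'))) has_vector_derivative of_real (gbump ?q (1 + Re (u * z j)) * k')) (at 0)"
        by (intro bounded_linear.has_vector_derivative[OF bounded_linear_of_real])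
           (simp add: has_real_derivative_iff_has_vector_derivative)
      then show "((\<lambda>h. complex_of_real (gbump p (1 + Re (u * (z(i := z i + of_real h * c)) j))))
          has_vector_derivative of_real k' * of_real (gbump ?q (1 + Re (u * z j)))) (at 0)"
        unfolding arg by (simp add: mult.commute)
    qed
    moreover have "Ck k (\<lambda>z. of_real k' * of_real (gbump ?q (1 + Re (u * z j))))"
      by (rule Ck_mult[OF Ck_const Suc])
    ultimately show "\<exists>\<xi>. has_pd i c (\<lambda>z. complex_of_real (gbump p (1 + Re (u * z j)))) \<xi> \<and> Ck k \<xi>"
      by blast
  qed
qed

section \<open>Cutoffs and the recognition of test functions\<close>

definition cyl :: "nat \<Rightarrow> ((nat \<Rightarrow> complex) \<Rightarrow> complex) \<Rightarrow> bool" where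
  "cyl n \<phi> \<longleftrightarrow> (\<forall>z w. (\<forall>i<n. z i = w i) \<longrightarrow> \<phi> z = \<phi> w)"

text \<open>For each i < n the four factors with \<open>u\<close> in {1, -1, \<i>, -\<i>} are all
  nonzero only if |Re z_i| < 1 and |Im z_i| < 1. The factor \<open>exp 1\<close> normalises the
  value at 0, which is the pointwise limit of the dilations used later; no plateau is built
  in.\<close>

lemma exists_cutoff:
  obtains \<theta> where "\<And>k. Ck k \<theta>" "cyl n \<theta>" "\<And>z i. \<theta> z \<noteq> 0 \<Longrightarrow> i < n \<Longrightarrow> cmod (z i) \<le> 2" "\<theta> (\<lambda>_. 0) = 1"
proof
  define B :: "nat \<Rightarrow> complex \<Rightarrow> (nat \<Rightarrow> complex) \<Rightarrow> complex"
    where "B i u z = of_real (exp 1) * of_real (gbump 1 (1 + Re (u * z i)))" for i u z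
  define \<theta> where "\<theta> z = (\<Prod>i<n. \<Prod>u\<in>{1, -1, \<i>, -\<i>}. B i u z)" for z
  show "Ck k \<theta>" for k
    unfolding \<theta>_def B_def by (intro Ck_prod Ck_mult Ck_const Ck_gbump)
  show "cyl n \<theta>"
    unfolding cyl_def \<theta>_def B_def by (auto intro!: prod.cong)
  have "B i u (\<lambda>_. 0) = 1" for i u
    by (simp add: B_def gbump_def flip: of_real_mult exp_add)
  then show "\<theta> (\<lambda>_. 0) = 1" unfolding \<theta>_def by (simp only: prod.neutral_const)
  fix z i assume nz: "\<theta> z \<noteq> 0" and i: "i < n"
  have pos: "1 + Re (u * z i) > 0" if "u \<in> {1, -1, \<i>, -\<i>}" for u
  proof (rule ccontr)
    assume "\<not> ?thesis"
    then have "B i u z = 0" by (simp add: B_def gbump_def)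
    then have "(\<Prod>u\<in>{1, -1, \<i>, -\<i>}. B i u z) = 0" using that by (intro prod_zero) auto
    then have "\<theta> z = 0" unfolding \<theta>_def using i by (intro prod_zero) auto
    then show False using nz by simp
  qed
  have "\<bar>Re (z i)\<bar> \<le> 1" "\<bar>Im (z i)\<bar> \<le> 1" using pos[of 1] pos[of "-1"] pos[of \<i>] pos[of "-\<i>"] by auto
  then show "cmod (z i) \<le> 2" using cmod_le[of "z i"] by simp
qed

lemma Ck_pderivs:
  assumes "\<And>k. Ck k \<phi>" shows "Ck k (pderivs ds \<phi>)"
proof (induction ds arbitrary: k)
  case Nil then show ?case using assms by (simp add: pderivs_def)
next
  case (Cons d ds)
  obtain i c where d: "d = (i, c)" by (cases d)
  obtain \<phi>' where p: "has_pd i c (pderivs ds \<phi>) \<phi>'" "Ck k \<phi>'"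
    using Cons.IH[of "Suc k"] unfolding Ck.simps(2) by blast
  have "pderivs (d # ds) \<phi> = pderiv_dir i c (pderivs ds \<phi>)" by (simp add: pderivs_def d)
  then show ?case using has_pd_pderiv_dir[OF p(1)] p(2) by simp
qed

lemma Ck_smooth_cyl:
  assumes "\<And>k. Ck k \<phi>" "cyl n \<phi>" shows "smooth_cyl n \<phi>"
  unfolding smooth_cyl_def
proof (intro conjI allI impI ballI)
  show "\<phi> z = \<phi> w" if "\<forall>i<n. z i = w i" for z w using assms(2) that by (auto simp: cyl_def)
  fix ds
  show "continuous_on UNIV (pderivs ds \<phi>)" using Ck_cont[OF Ck_pderivs[OF assms(1)]] .
  fix z :: "nat \<Rightarrow> complex" and i :: nat and c :: complex
  obtain \<phi>' where "has_pd i c (pderivs ds \<phi>) \<phi>'"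
    using Ck_pderivs[OF assms(1), of "Suc 0" ds] unfolding Ck.simps(2) by blast
  then show "(\<lambda>h::real. pderivs ds \<phi> (z(i := z i + of_real h * c))) differentiable (at 0)"
    unfolding has_pd_def by (blast intro: differentiableI_vector)
qed

text \<open>The support lies in a product of n discs and of single points {0} in the later
  coordinates, which is compact by Tychonoff's theorem.\<close>

lemma compact_supp_cylI:
  assumes "\<forall>z i. \<phi> z \<noteq> 0 \<longrightarrow> i < n \<longrightarrow> cmod (z i) \<le> R"
  shows "compact_supp_cyl n \<phi>"
proof -
  define T :: "(nat \<Rightarrow> complex) set" where "T = Pi\<^sub>E UNIV (\<lambda>i. if i < n then cball 0 R else {0})"
  have "compactin (product_topology (\<lambda>i. euclidean) UNIV) T"
    unfolding T_def compactin_PiE by auto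
  then have T: "compact T" by (simp add: euclidean_product_topology)
  have mem: "z \<in> T" if "\<forall>i\<ge>n. z i = 0" "\<phi> z \<noteq> 0" for z
  proof -
    have "z i \<in> (if i < n then cball 0 R else {0})" for i using that assms by (cases "i < n") auto
    then show ?thesis unfolding T_def PiE_iff by simp
  qed
  have "{z. (\<forall>i\<ge>n. z i = 0) \<and> \<phi> z \<noteq> 0} \<subseteq> T"
  proof (rule subsetI)
    fix z assume z: "z \<in> {z. (\<forall>i\<ge>n. z i = 0) \<and> \<phi> z \<noteq> 0}"
    show "z \<in> T" by (rule mem) (use z in blast)+
  qed
  then have "closure {z. (\<forall>i\<ge>n. z i = 0) \<and> \<phi> z \<noteq> 0} \<subseteq> T"
    by (rule closure_minimal[OF _ compact_imp_closed[OF T]])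
  then have "closure {z. (\<forall>i\<ge>n. z i = 0) \<and> \<phi> z \<noteq> 0} = T \<inter> closure {z. (\<forall>i\<ge>n. z i = 0) \<and> \<phi> z \<noteq> 0}"
    by (rule Int_absorb1[symmetric])
  then show ?thesis unfolding compact_supp_cyl_def
    by (rule ssubst) (rule compact_Int_closed[OF T closed_closure])
qed

definition dzb :: "nat \<Rightarrow> ((nat \<Rightarrow> complex) \<Rightarrow> complex) \<Rightarrow> (nat \<Rightarrow> complex) \<Rightarrow> complex" where
  "dzb i \<phi> z = (pderiv_dir i 1 \<phi> z + \<i> * pderiv_dir i \<i> \<phi> z) / 2"

text \<open>Compactness of the support is given on the copy of \<complex>^n inside the sequences.
  The truncation \<open>tr\<close> sends every sequence there without changing the values of the
  function or of its derivatives, so a bound on the compact set \<open>K\<close> is global.\<close>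

lemma test_funs_bounded_derivs:
  assumes "\<phi> \<in> test_funs"
  obtains C where "continuous_on UNIV \<phi>" "\<And>z. cmod (\<phi> z) \<le> C"
    "\<And>i c. c = 1 \<or> c = \<i> \<Longrightarrow> has_pd i c \<phi> (pderiv_dir i c \<phi>) \<and> continuous_on UNIV (pderiv_dir i c \<phi>)
       \<and> (\<exists>D. \<forall>z. cmod (pderiv_dir i c \<phi> z) \<le> D)"
proof -
  obtain n where n: "smooth_cyl n \<phi>" "compact_supp_cyl n \<phi>"
    using assms by (auto simp: test_funs_def)
  have cylz: "\<phi> z = \<phi> w" if "\<And>i. i < n \<Longrightarrow> z i = w i" for z w
    using n(1) that by (auto simp: smooth_cyl_def)
  have sm: "continuous_on UNIV (pderivs ds \<phi>)"
    "\<And>z i c. i < n \<Longrightarrow> c \<in> {1, \<i>} \<Longrightarrow> (\<lambda>h::real. pderivs ds \<phi> (z(i := z i + of_real h * c))) differentiable (at 0)"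
    if "set ds \<subseteq> {..<n} \<times> {1, \<i>}" for ds
    using n(1) that unfolding smooth_cyl_def by auto
  define K where "K = closure {z. (\<forall>i\<ge>n. z i = 0) \<and> \<phi> z \<noteq> 0}"
  have K: "compact K" using n(2) by (simp add: compact_supp_cyl_def K_def)
  define tr :: "(nat \<Rightarrow> complex) \<Rightarrow> nat \<Rightarrow> complex" where "tr z = (\<lambda>i. if i < n then z i else 0)" for z
  have bounded: "\<exists>C. \<forall>z. cmod (\<psi> z) \<le> C"
    if c: "continuous_on UNIV \<psi>" and t: "\<And>z. \<psi> z = \<psi> (tr z)" and v: "\<And>z. tr z \<notin> K \<Longrightarrow> \<psi> (tr z) = 0" for \<psi>
  proof -
    have "bounded (\<psi> ` K)"
      by (rule compact_imp_bounded[OF compact_continuous_image[OF continuous_on_subset[OF c] K]]) simp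
    then obtain C where C: "\<And>z. z \<in> K \<Longrightarrow> cmod (\<psi> z) \<le> C" unfolding bounded_iff by blast
    have "cmod (\<psi> z) \<le> max C 0" for z
      using C[of "tr z"] v[of z] t[of z] by (cases "tr z \<in> K") auto
    then show ?thesis by blast
  qed
  have zero: "\<phi> w = 0" if "w \<notin> K" "\<forall>i\<ge>n. w i = 0" for w
    using that closure_subset[of "{z. (\<forall>i\<ge>n. z i = 0) \<and> \<phi> z \<noteq> 0}"] unfolding K_def by blast
  have trn: "\<forall>i\<ge>n. tr z i = 0" for z by (simp add: tr_def)
  have cont: "continuous_on UNIV \<phi>" using sm(1)[of "[]"] by (simp add: pderivs_def)
  have "\<exists>C. \<forall>z. cmod (\<phi> z) \<le> C"
    by (rule bounded[OF cont]) (use zero[OF _ trn] in \<open>auto intro: cylz simp: tr_def\<close>)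
  then obtain C where C: "\<And>z. cmod (\<phi> z) \<le> C" by blast
  have deriv: "has_pd i c \<phi> (pderiv_dir i c \<phi>) \<and> continuous_on UNIV (pderiv_dir i c \<phi>)
       \<and> (\<exists>D. \<forall>z. cmod (pderiv_dir i c \<phi> z) \<le> D)" if c: "c = 1 \<or> c = \<i>" for i c
  proof (cases "i < n")
    case False
    have "\<phi> (z(i := z i + of_real h * c)) = \<phi> z" for z and h :: real by (rule cylz) (use False in auto)
    then have "has_pd i c \<phi> (\<lambda>_. 0)" by (simp add: has_pd_def)
    then show ?thesis using has_pd_pderiv_dir[of i c \<phi> "\<lambda>_. 0"] by (auto intro: exI[of _ 0])
  next
    case True
    have h: "has_pd i c \<phi> (pderiv_dir i c \<phi>)"
      unfolding has_pd_def pderiv_dir_def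
      using sm(2)[of "[]" i c] True c by (auto simp: pderivs_def vector_derivative_works[symmetric])
    have ct: "continuous_on UNIV (pderiv_dir i c \<phi>)"
      using sm(1)[of "[(i, c)]"] True c by (auto simp: pderivs_def)
    have "\<exists>D. \<forall>z. cmod (pderiv_dir i c \<phi> z) \<le> D"
    proof (rule bounded[OF ct])
      fix z
      have "\<phi> (z(i := z i + of_real h * c)) = \<phi> ((tr z)(i := tr z i + of_real h * c))" for h :: real
        by (rule cylz) (use True in \<open>auto simp: tr_def\<close>)
      then show "pderiv_dir i c \<phi> z = pderiv_dir i c \<phi> (tr z)" by (simp add: pderiv_dir_def)
      assume nK: "tr z \<notin> K"
      define L where "L h = (tr z)(i := tr z i + of_real h * c)" for h :: real
      have L: "continuous_on UNIV L" unfolding L_def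
        by (rule continuous_on_compose2[OF continuous_fun_upd[of "tr z" i]]) (auto intro!: continuous_intros)
      \<comment> \<open>\<open>K\<close> is closed: near a point outside it the function vanishes
        for all small h, and so does the derivative at h = 0.\<close>
      have op: "open (L -` (- K))"
        using open_vimage[OF _ L] compact_imp_closed[OF K] by (simp add: open_Compl)
      have "((\<lambda>h. \<phi> (L h)) has_vector_derivative 0) (at 0)"
      proof (rule has_vector_derivative_transform_within_open[OF has_vector_derivative_const op])
        show "0 \<in> L -` (- K)" using nK by (simp add: L_def)
        fix h assume "h \<in> L -` (- K)"
        then show "0 = \<phi> (L h)" using zero[of "L h"] True trn[of z] by (auto simp: L_def)
      qed
      then show "pderiv_dir i c \<phi> (tr z) = 0"
        unfolding pderiv_dir_def L_def by (rule vector_derivative_at)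
    qed
    then show ?thesis using h ct by blast
  qed
  show thesis by (rule that[OF cont C deriv])
qed

lemma test_funs_wirt:
  assumes "\<phi> \<in> test_funs" shows "wirt i \<phi> (dz i \<phi>) (dzb i \<phi>)"
proof -
  obtain C where C: "continuous_on UNIV \<phi>" "\<And>z. cmod (\<phi> z) \<le> C"
    "\<And>i c. c = 1 \<or> c = \<i> \<Longrightarrow> has_pd i c \<phi> (pderiv_dir i c \<phi>) \<and> continuous_on UNIV (pderiv_dir i c \<phi>)
       \<and> (\<exists>D. \<forall>z. cmod (pderiv_dir i c \<phi> z) \<le> D)"
    using test_funs_bounded_derivs[OF assms] by blast
  let ?x = "pderiv_dir i 1 \<phi>" and ?y = "pderiv_dir i \<i> \<phi>"
  have t: "tame \<phi>" by (rule tame_bounded[OF borel_measurable_continuous_onI[OF C(1)] C(2)])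
  have tp: "tame (pderiv_dir i c \<phi>)" if c: "c = 1 \<or> c = \<i>" for c
  proof -
    obtain D where "\<And>z. cmod (pderiv_dir i c \<phi> z) \<le> D" using C(3)[OF c, of i] by blast
    then show ?thesis using C(3)[OF c, of i] by (intro tame_bounded borel_measurable_continuous_onI) auto
  qed
  have cp: "continuous_on UNIV ?x" "continuous_on UNIV ?y" using C(3) by auto
  have d: "dz i \<phi> = (\<lambda>z. (1/2) * (?x z - \<i> * ?y z))" "dzb i \<phi> = (\<lambda>z. (1/2) * (?x z + \<i> * ?y z))"
    by (auto simp: dz_def dzb_def fun_eq_iff)
  have "(\<lambda>z. dz i \<phi> z + dzb i \<phi> z) = ?x" "(\<lambda>z. \<i> * (dz i \<phi> z - dzb i \<phi> z)) = ?y"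
    by (auto simp: d fun_eq_iff algebra_simps)
  moreover have "tame (dz i \<phi>)" "tame (dzb i \<phi>)"
    unfolding d by (intro tame_cmult tame_diff tame_add tp; simp)+
  moreover have "continuous_on UNIV (dz i \<phi>)" "continuous_on UNIV (dzb i \<phi>)"
    unfolding d using cp by (auto intro!: continuous_intros)
  ultimately show ?thesis
    using C(1,3) t by (auto simp: wirt_def)
qed

lemma dz_bounded:
  assumes "\<phi> \<in> test_funs" obtains D where "\<And>z. cmod (dz i \<phi> z) \<le> D"
proof -
  obtain D1 where D1: "\<And>z. cmod (pderiv_dir i 1 \<phi> z) \<le> D1"
    using test_funs_bounded_derivs[OF assms] by metis
  obtain D2 where D2: "\<And>z. cmod (pderiv_dir i \<i> \<phi> z) \<le> D2"
    using test_funs_bounded_derivs[OF assms] by metis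
  have "cmod (dz i \<phi> z) \<le> D1 + D2" for z
  proof -
    have "cmod (dz i \<phi> z) \<le> (cmod (pderiv_dir i 1 \<phi> z) + cmod (\<i> * pderiv_dir i \<i> \<phi> z)) / 2"
      unfolding dz_def norm_divide using norm_triangle_ineq4[of "pderiv_dir i 1 \<phi> z" "\<i> * pderiv_dir i \<i> \<phi> z"] by simp
    also have "\<dots> \<le> D1 + D2" using D1[of z] D2[of z] order_trans[OF norm_ge_zero D1[of z]] order_trans[OF norm_ge_zero D2[of z]]
      by (simp add: norm_mult)
    finally show ?thesis .
  qed
  then show thesis by (rule that)
qed

lemma Ck_test_fun:
  assumes "\<And>k. Ck k \<phi>" "cyl n \<phi>" "n \<ge> 1" "\<forall>z i. \<phi> z \<noteq> 0 \<longrightarrow> i < n \<longrightarrow> cmod (z i) \<le> R"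
  shows "\<phi> \<in> test_funs"
  using Ck_smooth_cyl[OF assms(1,2)] compact_supp_cylI[OF assms(4)] assms(3) unfolding test_funs_def by blast

lemma tame_cmod: "tame \<phi> \<Longrightarrow> tame (\<lambda>z. of_real (cmod (\<phi> z)))"
  by (rule tame_mono[of \<phi> _ 1]) (auto dest: tame_measurable)

section \<open>Extending the weak identity from test functions to Hermite polynomials\<close>

context gauss_weights begin

lemma delta_op_wirt:
  assumes "wirt i \<phi> d b"
  shows "delta_op r a i \<phi> z = d z - cnj (z i) / of_real (vv i) * \<phi> z"
  using wirt_dz[OF assms] by (simp add: delta_op_def vv_def)

lemma tame_delta: "wirt i \<phi> d b \<Longrightarrow> tame (\<lambda>z. d z - cnj (z i) / of_real (vv i) * \<phi> z)"
proof -
  assume w: "wirt i \<phi> d b"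
  have "tame (\<lambda>z. d z - (1 / of_real (vv i) * cnj (z i)) * \<phi> z)"
    by (intro tame_diff tame_mult tame_cmult tame_cnj tame_coord wirt_tame[OF w])
  then show ?thesis by simp
qed

lemma dominated_inner:
  assumes u: "u \<in> L2_fun P" and t: "\<And>m. tame (\<psi> m)" and W: "tame W"
    and b: "\<And>m z. cmod (\<psi> m z) \<le> cmod (W z)" and l: "\<And>z. (\<lambda>m. \<psi> m z) \<longlonglongrightarrow> \<psi>' z" and t': "tame \<psi>'"
  shows "(\<lambda>m::nat. L2_inner P u (\<psi> m)) \<longlonglongrightarrow> L2_inner P u \<psi>'"
  unfolding L2_inner_def
proof (rule integral_dominated_convergence[where w = "\<lambda>z. cmod (u z * cnj (W z))"])
  show "(\<lambda>z. u z * cnj (\<psi>' z)) \<in> borel_measurable P" "(\<lambda>z. u z * cnj (\<psi> m z)) \<in> borel_measurable P" for m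
    using u tame_L2[OF t] tame_L2[OF t'] by (auto intro!: borel_measurable_integrable L2_inner_integrable)
  show "integrable P (\<lambda>z. cmod (u z * cnj (W z)))"
    by (rule integrable_norm[OF L2_inner_integrable[OF u tame_L2[OF W]]])
  show "AE z in P. (\<lambda>m. u z * cnj (\<psi> m z)) \<longlonglongrightarrow> u z * cnj (\<psi>' z)"
    by (intro AE_I2 tendsto_mult tendsto_const tendsto_cnj l)
  show "AE z in P. norm (u z * cnj (\<psi> m z)) \<le> cmod (u z * cnj (W z))" for m
    by (intro AE_I2) (simp add: norm_mult mult_left_mono b)
qed

text \<open>\<open>H\<close> times the dilated cutoff \<theta>(s z) is a test function. The product
  rule gives \<theta>(s z) times \<open>delta_op\<close> of \<open>H\<close>, plus an error s
  (\<partial>_i \<theta>)(s z) H. As s tends to 0 the cutoff tends to 1 and the error to 0, all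
  dominated by a fixed tame function.\<close>

lemma weak_extend:
  assumes g: "g \<in> L2_fun P" and S: "finite S" and u: "\<And>i. i \<in> S \<Longrightarrow> u i \<in> L2_fun P"
    and weak: "\<And>\<phi>. \<phi> \<in> test_funs \<Longrightarrow> L2_inner P g \<phi> = - (\<Sum>i\<in>S. L2_inner P (u i) (delta_op r a i \<phi>))"
    and H: "\<And>k. Ck k H" "cyl n H" "n \<ge> 1" and w: "\<And>i. wirt i H (dH i) (bH i)"
  shows "L2_inner P g H = - (\<Sum>i\<in>S. L2_inner P (u i) (delta_op r a i H))"
proof -
  obtain \<theta> where \<theta>: "\<And>k. Ck k \<theta>" "cyl n \<theta>" "\<And>z i. \<theta> z \<noteq> 0 \<Longrightarrow> i < n \<Longrightarrow> cmod (z i) \<le> 2" "\<theta> (\<lambda>_. 0) = 1"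
    using exists_cutoff[of n] by blast
  have \<theta>t: "\<theta> \<in> test_funs" by (rule Ck_test_fun[OF \<theta>(1,2) H(3), where R = 2]) (use \<theta>(3) in blast)
  obtain C where C: "\<And>z. cmod (\<theta> z) \<le> C" using test_funs_bounded_derivs[OF \<theta>t] by metis
  have "\<exists>D. \<forall>z. cmod (dz i \<theta> z) \<le> D" for i using dz_bounded[OF \<theta>t] by metis
  then obtain D where D: "\<And>i z. cmod (dz i \<theta> z) \<le> D i" by metis
  define s where "s m = inverse (real (Suc m))" for m
  have s: "0 < s m" "s m \<le> 1" for m by (auto simp: s_def field_simps)
  have s0: "s \<longlonglongrightarrow> 0" unfolding s_def by (rule LIMSEQ_inverse_real_of_nat)
  define \<theta>s where "\<theta>s m = (\<lambda>z. \<theta> (\<lambda>j. of_real (s m) * z j))" for m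
  have \<theta>s1: "Ck k (\<theta>s m)" for k m unfolding \<theta>s_def by (rule Ck_scale[OF \<theta>(1)])
  have cylmono: "\<theta>s m z = \<theta>s m w" "H z = H w" if "\<forall>i<n. z i = w i" for z w m
    using that \<theta>(2) H(2) unfolding cyl_def \<theta>s_def by auto
  have \<theta>s3: "cmod (z i) \<le> 2 / s m" if "\<theta>s m z \<noteq> 0" "i < n" for z i m
    using \<theta>(3)[OF that[unfolded \<theta>s_def]] s(1)[of m] by (simp add: norm_mult field_simps)
  have \<theta>st: "\<theta>s m \<in> test_funs" for m
  proof (rule Ck_test_fun[OF _ _ H(3), where R = "2 / s m"])
    show "Ck k (\<theta>s m)" for k by (rule \<theta>s1)
    show "cyl n (\<theta>s m)" unfolding cyl_def using cylmono by metis
    show "\<forall>z i. \<theta>s m z \<noteq> 0 \<longrightarrow> i < n \<longrightarrow> cmod (z i) \<le> 2 / s m" using \<theta>s3 by blast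
  qed
  have \<theta>sd: "dz i (\<theta>s m) z = of_real (s m) * dz i \<theta> (\<lambda>j. of_real (s m) * z j)" for i m z
  proof -
    have "pderiv_dir i c (\<theta>s m) = (\<lambda>z. of_real (s m) * pderiv_dir i c \<theta> (\<lambda>j. of_real (s m) * z j))" for c
    proof -
      obtain \<theta>' where p: "has_pd i c \<theta> \<theta>'" using \<theta>(1)[of "Suc 0"] unfolding Ck.simps(2) by blast
      show ?thesis using has_pd_pderiv_dir[OF has_pd_scale[OF p, of "s m"]] has_pd_pderiv_dir[OF p] by (simp add: \<theta>s_def)
    qed
    then show ?thesis by (simp add: dz_def algebra_simps)
  qed
  have ws: "wirt i (\<theta>s m) (dz i (\<theta>s m)) (dzb i (\<theta>s m))" for i m by (rule test_funs_wirt[OF \<theta>st])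
  define \<phi> where "\<phi> m = (\<lambda>z. \<theta>s m z * H z)" for m
  have \<phi>t: "\<phi> m \<in> test_funs" for m
  proof (rule Ck_test_fun[OF _ _ H(3), where R = "2 / s m"])
    show "Ck k (\<phi> m)" for k unfolding \<phi>_def by (rule Ck_mult[OF \<theta>s1 H(1)])
    show "cyl n (\<phi> m)" unfolding cyl_def \<phi>_def using cylmono by metis
    show "\<forall>z i. \<phi> m z \<noteq> 0 \<longrightarrow> i < n \<longrightarrow> cmod (z i) \<le> 2 / s m"
      unfolding \<phi>_def using \<theta>s3 by (metis mult_zero_left)
  qed
  have w\<phi>: "wirt i (\<phi> m) (\<lambda>z. \<theta>s m z * dH i z + dz i (\<theta>s m) z * H z) (\<lambda>z. \<theta>s m z * bH i z + dzb i (\<theta>s m) z * H z)" for i m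
    unfolding \<phi>_def by (rule wirt_mult[OF ws w])
  define dl where "dl i z = dH i z - cnj (z i) / of_real (vv i) * H z" for i z
  have dl: "delta_op r a i H = dl i" for i by (intro ext) (simp add: delta_op_wirt[OF w] dl_def)
  have d\<phi>: "delta_op r a i (\<phi> m) = (\<lambda>z. \<theta>s m z * dl i z + of_real (s m) * dz i \<theta> (\<lambda>j. of_real (s m) * z j) * H z)" for i m
    by (intro ext, simp only: delta_op_wirt[OF w\<phi>]) (simp add: dl_def \<phi>_def \<theta>sd algebra_simps)
  have scale_lim: "(\<lambda>m. \<psi> (\<lambda>j. of_real (s m) * z j)) \<longlonglongrightarrow> \<psi> (\<lambda>_. 0)" if c: "continuous_on UNIV \<psi>" for \<psi> :: "(nat \<Rightarrow> complex) \<Rightarrow> complex" and z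
  proof -
    have "continuous_on UNIV (\<lambda>t::real. \<lambda>j. complex_of_real t * z j)"
      by (rule continuous_on_coordinatewise_then_product) (intro continuous_intros)
    from continuous_on_compose2[OF c this] have "isCont (\<lambda>t::real. \<psi> (\<lambda>j. complex_of_real t * z j)) 0"
      by (simp add: continuous_on_eq_continuous_at)
    from isCont_tendsto_compose[OF this s0] show ?thesis by simp
  qed
  have \<theta>lim: "(\<lambda>m. \<theta>s m z) \<longlonglongrightarrow> 1" for z
    unfolding \<theta>s_def using scale_lim[OF Ck_cont[OF \<theta>(1)], of z] \<theta>(4) by simp
  have tH: "tame H" and tdl: "tame (dl i)" for i
    using wirt_tame[OF w] tame_delta[OF w] by (auto simp: dl_def[abs_def])
  have C0: "0 \<le> C" using order_trans[OF norm_ge_zero C] by blast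
  have D0: "0 \<le> D i" for i using order_trans[OF norm_ge_zero D] by blast
  have lim1: "(\<lambda>m. L2_inner P g (\<phi> m)) \<longlonglongrightarrow> L2_inner P g H"
  proof (rule dominated_inner[OF g _ tame_cmult[OF tH, of "of_real C"] _ _ tH])
    show "tame (\<phi> m)" for m by (rule wirt_tame(1)[OF w\<phi>])
    show "cmod (\<phi> m z) \<le> cmod (of_real C * H z)" for m z
      unfolding \<phi>_def \<theta>s_def norm_mult using C C0 by (simp add: mult_right_mono)
    show "(\<lambda>m. \<phi> m z) \<longlonglongrightarrow> H z" for z
      unfolding \<phi>_def using tendsto_mult[OF \<theta>lim tendsto_const] by simp
  qed
  have lim2: "(\<lambda>m. L2_inner P (u i) (delta_op r a i (\<phi> m))) \<longlonglongrightarrow> L2_inner P (u i) (dl i)" if "i \<in> S" for i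
  proof (rule dominated_inner[OF u[OF that]])
    show "tame (delta_op r a i (\<phi> m))" for m
      using tame_delta[OF w\<phi>[of i m]] delta_op_wirt[OF w\<phi>[of i m]] by presburger
    show "tame (\<lambda>z. of_real C * of_real (cmod (dl i z)) + of_real (D i) * of_real (cmod (H z)))"
      by (intro tame_add tame_cmult tame_cmod tH tdl)
    show "tame (dl i)" by (rule tdl)
    show "(\<lambda>m. delta_op r a i (\<phi> m) z) \<longlonglongrightarrow> dl i z" for z
    proof -
      have "continuous_on UNIV (dz i \<theta>)" using test_funs_wirt[OF \<theta>t, of i] by (simp add: wirt_def)
      note l = scale_lim[OF this, of z]
      have "(\<lambda>m. \<theta>s m z * dl i z + of_real (s m) * dz i \<theta> (\<lambda>j. of_real (s m) * z j) * H z)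
         \<longlonglongrightarrow> 1 * dl i z + of_real 0 * dz i \<theta> (\<lambda>_. 0) * H z"
        by (intro tendsto_add tendsto_mult tendsto_const \<theta>lim l tendsto_of_real s0)
      then show ?thesis unfolding d\<phi> by simp
    qed
    show "cmod (delta_op r a i (\<phi> m) z) \<le> cmod (of_real C * of_real (cmod (dl i z)) + of_real (D i) * of_real (cmod (H z)))" for m z
    proof -
      have "cmod (delta_op r a i (\<phi> m) z) \<le> cmod (\<theta>s m z) * cmod (dl i z) + s m * cmod (dz i \<theta> (\<lambda>j. of_real (s m) * z j)) * cmod (H z)"
        unfolding d\<phi> using s(1)[of m] norm_triangle_ineq[of "\<theta>s m z * dl i z" "of_real (s m) * dz i \<theta> (\<lambda>j. of_real (s m) * z j) * H z"]
        by (simp add: norm_mult)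
      also have "\<dots> \<le> C * cmod (dl i z) + (1 * D i) * cmod (H z)"
        using C D s[of m] by (intro add_mono mult_right_mono mult_mono) (auto simp: \<theta>s_def less_imp_le)
      also have "\<dots> = cmod (of_real (C * cmod (dl i z) + D i * cmod (H z)))"
        using C0 D0[of i] by (simp only: norm_of_real) simp
      finally show ?thesis by simp
    qed
  qed
  have "(\<lambda>m. - (\<Sum>i\<in>S. L2_inner P (u i) (delta_op r a i (\<phi> m)))) \<longlonglongrightarrow> - (\<Sum>i\<in>S. L2_inner P (u i) (dl i))"
    by (intro tendsto_minus tendsto_sum lim2)
  then have "(\<lambda>m. L2_inner P g (\<phi> m)) \<longlonglongrightarrow> - (\<Sum>i\<in>S. L2_inner P (u i) (dl i))"
    using weak[OF \<phi>t] by simp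
  then show ?thesis using LIMSEQ_unique[OF lim1] unfolding dl by blast
qed

lemma Ck_hermite: "Ck k (hermite \<alpha> \<beta>)"
  unfolding hermite_def[abs_def] by (intro Ck_prod Ck_herm)

text \<open>On Hermite polynomials \<open>- delta_op\<close> is the raising operator, which absorbs
  the minus sign of the weak identity: the coefficient of \<open>g\<close> at \<beta> is a sum of
  coefficients of the \<open>u i\<close> at \<beta> + e_i.\<close>

lemma weak_extend_hermite:
  assumes "g \<in> L2_fun P" "finite S" "\<And>i. i \<in> S \<Longrightarrow> u i \<in> L2_fun P"
    and "\<And>\<phi>. \<phi> \<in> test_funs \<Longrightarrow> L2_inner P g \<phi> = - (\<Sum>i\<in>S. L2_inner P (u i) (delta_op r a i \<phi>))"
    and I: "(\<alpha>, \<beta>) \<in> Idx"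
  shows "L2_inner P g (hermite \<alpha> \<beta>) = (\<Sum>i\<in>S. L2_inner P (u i) (hermite \<alpha> (\<beta>(i := \<beta> i + 1))))"
proof -
  have "finite {i. \<alpha> i \<noteq> 0 \<or> \<beta> i \<noteq> 0}" using I by (simp add: Idx_def Collect_disj_eq)
  then obtain n where n: "{i. \<alpha> i \<noteq> 0 \<or> \<beta> i \<noteq> 0} \<subseteq> {..<n}" using finite_nat_iff_bounded by blast
  \<comment> \<open>\<open>Suc n\<close> rather than \<open>n\<close>, since a test function lives
    on at least one coordinate and the support of the degrees may be empty.\<close>
  have c: "cyl (Suc n) (hermite \<alpha> \<beta>)"
    unfolding cyl_def
  proof (intro allI impI)
    fix z w :: "nat \<Rightarrow> complex" assume zw: "\<forall>i<Suc n. z i = w i"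
    have "z i = w i" if "i \<in> {i. \<alpha> i \<noteq> 0 \<or> \<beta> i \<noteq> 0}" for i 
    proof -
      have "i < n" using that n by blast
      then show ?thesis using zw by simp
    qed
    then show "hermite \<alpha> \<beta> z = hermite \<alpha> \<beta> w" unfolding hermite_def by (intro prod.cong refl) simp
  qed
  have d: "delta_op r a i (hermite \<alpha> \<beta>) = (\<lambda>z. -1 * hermite \<alpha> (\<beta>(i := \<beta> i + 1)) z)" for i
    
  proof
    fix z
    show "delta_op r a i (hermite \<alpha> \<beta>) z = -1 * hermite \<alpha> (\<beta>(i := \<beta> i + 1)) z"
      unfolding delta_op_wirt[OF wirt_hermite[OF I]] hermite_raise[OF I, of z i, symmetric] by simp
  qed
  have "L2_inner P g (hermite \<alpha> \<beta>) = - (\<Sum>i\<in>S. L2_inner P (u i) (delta_op r a i (hermite \<alpha> \<beta>)))"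
    by (rule weak_extend[OF assms(1-4) Ck_hermite c _ wirt_hermite[OF I]]) simp_all
  then show ?thesis unfolding d L2_inner_cmult_right by (simp add: sum_negf)
qed

end

subsection \<open>Totality of the Hermite polynomials\<close>

text \<open>Expand the exponential: every partial sum integrates to 0 because the moments vanish,
  and all of them are dominated by exp (|u| |X|) |q|. Moments alone need not determine a measure;
  the exponential integrability makes them do so.\<close>

lemma moments_iexp_zero:
  fixes q X :: "'a \<Rightarrow> real"
  assumes [measurable]: "q \<in> borel_measurable M" "X \<in> borel_measurable M"
    and ik: "\<And>k. integrable M (\<lambda>x. X x ^ k * q x)"
    and ie: "\<And>u. integrable M (\<lambda>x. exp (u * \<bar>X x\<bar>) * \<bar>q x\<bar>)"
    and zero: "\<And>k. (LINT x|M. X x ^ k * q x) = 0"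
  shows "(LINT x|M. of_real (q x) * iexp (u * X x)) = 0"
proof -
  let ?w = "\<lambda>x. \<i> * of_real (u * X x)"
  define s where "s n x = of_real (q x) * (\<Sum>k<n. ?w x ^ k /\<^sub>R fact k)" for n x
  have s_eq: "s n x = (\<Sum>k<n. ((\<i> * of_real u) ^ k / fact k) * of_real (X x ^ k * q x))" for n x
    unfolding s_def sum_distrib_left
    by (intro sum.cong refl) (simp add: power_mult_distrib scaleR_conv_of_real field_simps)
  have s0: "(LINT x|M. s n x) = 0" for n
  proof -
    have ic: "integrable M (\<lambda>x. ((\<i> * of_real u) ^ k / fact k) * complex_of_real (X x ^ k * q x))" for k
      by (intro integrable_mult_right integrable_of_real ik)
    have "(LINT x|M. s n x) = (\<Sum>k<n. LINT x|M. ((\<i> * of_real u) ^ k / fact k) * of_real (X x ^ k * q x))"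
      unfolding s_eq by (rule Bochner_Integration.integral_sum) (rule ic)
    also have "\<dots> = 0"
      using zero by (intro sum.neutral ballI) (simp only: integral_mult_right_zero integral_complex_of_real of_real_0 mult_zero_right)
    finally show ?thesis .
  qed
  have "(\<lambda>n. LINT x|M. s n x) \<longlonglongrightarrow> (LINT x|M. of_real (q x) * iexp (u * X x))"
  proof (rule integral_dominated_convergence[where w = "\<lambda>x. exp (\<bar>u\<bar> * \<bar>X x\<bar>) * \<bar>q x\<bar>"])
    show "(\<lambda>x. of_real (q x) * iexp (u * X x)) \<in> borel_measurable M" by measurable
    show "s n \<in> borel_measurable M" for n unfolding s_def by measurable
    show "integrable M (\<lambda>x. exp (\<bar>u\<bar> * \<bar>X x\<bar>) * \<bar>q x\<bar>)" by (rule ie)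
    show "AE x in M. (\<lambda>n. s n x) \<longlonglongrightarrow> of_real (q x) * iexp (u * X x)"
    proof (rule AE_I2)
      fix x
      have "(\<lambda>n. \<Sum>k<n. ?w x ^ k /\<^sub>R fact k) \<longlonglongrightarrow> exp (?w x)"
        using exp_converges[of "?w x"] by (simp add: sums_def)
      then show "(\<lambda>n. s n x) \<longlonglongrightarrow> of_real (q x) * iexp (u * X x)"
        unfolding s_def by (intro tendsto_mult tendsto_const) simp
    qed
    show "AE x in M. norm (s n x) \<le> exp (\<bar>u\<bar> * \<bar>X x\<bar>) * \<bar>q x\<bar>" for n
    proof (rule AE_I2)
      fix x
      have "norm (\<Sum>k<n. ?w x ^ k /\<^sub>R fact k) \<le> (\<Sum>k<n. norm (?w x ^ k /\<^sub>R fact k))" by (rule norm_sum)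
      also have "\<dots> = (\<Sum>k<n. (\<bar>u\<bar> * \<bar>X x\<bar>) ^ k /\<^sub>R fact k)"
        by (intro sum.cong refl) (simp add: norm_mult norm_power abs_mult power_mult_distrib)
      also have "\<dots> \<le> (\<Sum>k. (\<bar>u\<bar> * \<bar>X x\<bar>) ^ k /\<^sub>R fact k)"
        by (rule sum_le_suminf[OF summable_exp_generic]) auto
      also have "\<dots> = exp (\<bar>u\<bar> * \<bar>X x\<bar>)" by (simp add: exp_def)
      finally have "\<bar>q x\<bar> * norm (\<Sum>k<n. ?w x ^ k /\<^sub>R fact k) \<le> \<bar>q x\<bar> * exp (\<bar>u\<bar> * \<bar>X x\<bar>)"
        by (intro mult_left_mono) auto
      then show "norm (s n x) \<le> exp (\<bar>u\<bar> * \<bar>X x\<bar>) * \<bar>q x\<bar>"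
        unfolding s_def norm_mult by (simp only: norm_of_real mult.commute)
    qed
  qed
  then show ?thesis unfolding s0 by (simp add: LIMSEQ_const_iff)
qed

text \<open>By the case u = 0 the positive and negative parts of q have the same mass c. Divided by
  c and pushed forward by \<open>X\<close> they are probability measures on the line with equal
  characteristic functions, hence equal by Levy's uniqueness theorem.\<close>

lemma iexp_zero_imp_indicator_zero:
  fixes q X :: "'a \<Rightarrow> real"
  assumes q: "integrable M q" and X[measurable]: "X \<in> borel_measurable M"
    and zero: "\<And>u. (LINT x|M. of_real (q x) * iexp (u * X x)) = 0"
    and A[measurable]: "A \<in> sets borel"
  shows "(LINT x|M. indicator A (X x) * q x) = 0"
proof -
  have [measurable]: "q \<in> borel_measurable M" using q by auto
  define p m where "p x = max (q x) 0" and "m x = max (- q x) 0" for x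
  have q_eq: "q x = p x - m x" for x by (auto simp: p_def m_def)
  have ip: "integrable M p" and im: "integrable M m" unfolding p_def m_def using q by auto
  have p0: "p x \<ge> 0" "m x \<ge> 0" for x by (auto simp: p_def m_def)
  have [measurable]: "p \<in> borel_measurable M" "m \<in> borel_measurable M" using ip im by auto
  define c where "c = (LINT x|M. p x)"
  have "(LINT x|M. complex_of_real (q x)) = 0" using zero[of 0] by simp
  then have "(LINT x|M. q x) = 0" by (simp only: integral_complex_of_real of_real_eq_0_iff)
  then have cm: "(LINT x|M. m x) = c" using ip im unfolding q_eq c_def by simp
  have c0: "c \<ge> 0" unfolding c_def using p0 by simp
  show ?thesis
  proof (cases "c = 0")
    \<comment> \<open>Without mass there is nothing to normalise, but then q is 0 almost
      everywhere.\<close>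
    case True
    have "AE x in M. p x = 0" "AE x in M. m x = 0"
      using integral_nonneg_eq_0_iff_AE[OF ip] integral_nonneg_eq_0_iff_AE[OF im] p0 True cm
      by (auto simp: c_def)
    then have "AE x in M. indicator A (X x) * q x = 0" by eventually_elim (simp add: q_eq)
    then show ?thesis by (rule integral_eq_zero_AE)
  next
    case False
    then have cpos: "c > 0" using c0 by simp
    define D where "D f = distr (density M (\<lambda>x. ennreal (f x / c))) borel X" for f
    have dist: "real_distribution (D f)" and Dint: "\<And>g::real \<Rightarrow> complex. g \<in> borel_measurable borel \<Longrightarrow> (LINT y|D f. g y) = (LINT x|M. (f x / c) *\<^sub>R g (X x))"
      if f: "integrable M f" "\<And>x. f x \<ge> 0" "(LINT x|M. f x) = c" for f
    proof -
      have [measurable]: "f \<in> borel_measurable M" using f(1) by auto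
      have "emeasure (density M (\<lambda>x. ennreal (f x / c))) (space M) = (\<integral>\<^sup>+x. ennreal (f x / c) \<partial>M)"
        by (subst emeasure_density) (auto intro!: nn_integral_cong)
      also have "\<dots> = ennreal (LINT x|M. f x / c)"
        by (rule nn_integral_eq_integral) (use f cpos in auto)
      also have "\<dots> = 1" using f cpos by simp
      finally have "prob_space (density M (\<lambda>x. ennreal (f x / c)))" by (intro prob_spaceI) simp
      then interpret N: prob_space "density M (\<lambda>x. ennreal (f x / c))" .
      show "real_distribution (D f)" unfolding D_def by (rule N.real_distribution_distr) simp
      show "(LINT y|D f. g y) = (LINT x|M. (f x / c) *\<^sub>R g (X x))" if [measurable]: "g \<in> borel_measurable borel"
        for g :: "real \<Rightarrow> complex"
        unfolding D_def using f(2) cpos by (subst integral_distr, simp, simp, subst integral_density) auto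
    qed
    note Dp = dist[OF ip p0(1) c_def[symmetric]] and Dm = dist[OF im p0(2) cm]
    have key: "(LINT y|D p. g y) - (LINT y|D m. g y) = (LINT x|M. of_real (q x) * g (X x)) / of_real c"
      if g[measurable]: "g \<in> borel_measurable borel" and b: "\<And>y. norm (g y) \<le> 1" for g :: "real \<Rightarrow> complex"
    proof -
      have i: "integrable M (\<lambda>x. (f x / c) *\<^sub>R g (X x))" if f: "integrable M f" for f
      proof (rule Bochner_Integration.integrable_bound)
        show "integrable M (\<lambda>x. f x / c)" using f by auto
        show "(\<lambda>x. (f x / c) *\<^sub>R g (X x)) \<in> borel_measurable M" using f by measurable
        show "AE x in M. norm ((f x / c) *\<^sub>R g (X x)) \<le> norm (f x / c)"
        proof (rule AE_I2)
          fix x show "norm ((f x / c) *\<^sub>R g (X x)) \<le> norm (f x / c)"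
            using mult_left_mono[OF b[of "X x"], of "norm (f x / c)"] by simp
        qed
      qed
      have "(LINT y|D p. g y) - (LINT y|D m. g y) = (LINT x|M. (p x / c) *\<^sub>R g (X x) - (m x / c) *\<^sub>R g (X x))"
        unfolding Dint[OF ip p0(1) c_def[symmetric] g] Dint[OF im p0(2) cm g]
        by (rule Bochner_Integration.integral_diff[OF i[OF ip] i[OF im], symmetric])
      also have "\<dots> = (LINT x|M. of_real (q x) * g (X x) / of_real c)"
        by (intro Bochner_Integration.integral_cong refl)
           (simp add: q_eq scaleR_conv_of_real left_diff_distrib diff_divide_distrib)
      also have "\<dots> = (LINT x|M. of_real (q x) * g (X x)) / of_real c" by (rule integral_divide_zero)
      finally show ?thesis .
    qed
    have "char (D p) = char (D m)"
    proof
      fix u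
      have "char (D p) u - char (D m) u = (LINT x|M. of_real (q x) * iexp (u * X x)) / of_real c"
        unfolding char_def by (rule key) (simp_all)
      then show "char (D p) u = char (D m) u" using zero by simp
    qed
    then have eq: "D p = D m" by (rule Levy_uniqueness[OF Dp Dm])
    have "(LINT x|M. of_real (q x) * complex_of_real (indicator A (X x))) / of_real c = 0"
      by (subst key[symmetric]) (simp_all add: eq indicator_def)
    then have "(LINT x|M. of_real (q x) * complex_of_real (indicator A (X x))) = 0" using cpos by simp
    moreover have "(\<lambda>x. of_real (q x) * complex_of_real (indicator A (X x))) = (\<lambda>x. complex_of_real (indicator A (X x) * q x))"
      by (auto simp: mult.commute)
    ultimately show ?thesis by (simp only: integral_complex_of_real of_real_eq_0_iff)
  qed
qed

text \<open>Since \<open>X\<close> is real, the real and imaginary parts of q have vanishing moments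
  separately, and each is a real density as above; \<open>f\<close> in the proof stands for either
  part.\<close>

lemma moments_zero_imp_indicator_zero:
  fixes q :: "'a \<Rightarrow> complex" and X :: "'a \<Rightarrow> real"
  assumes X[measurable]: "X \<in> borel_measurable M"
    and ik: "\<And>k. integrable M (\<lambda>x. of_real (X x) ^ k * q x)"
    and ie: "\<And>u. integrable M (\<lambda>x. of_real (exp (u * \<bar>X x\<bar>)) * q x)"
    and zero: "\<And>k. (LINT x|M. of_real (X x) ^ k * q x) = 0"
    and A: "A \<in> sets borel"
  shows "(LINT x|M. indicator A (X x) * q x) = 0"
proof -
  have iq: "integrable M q" using ik[of 0] by simp
  then have [measurable]: "q \<in> borel_measurable M" by auto
  have part: "(LINT x|M. indicator A (X x) * f (q x)) = 0"
    if f: "bounded_linear f" "\<And>s w. f (of_real s * w) = s * f w" "\<And>w. \<bar>f w\<bar> \<le> cmod w" for f :: "complex \<Rightarrow> real"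
  proof -
    have fi: "integrable M (\<lambda>x. f (q x))" by (rule integrable_bounded_linear[OF f(1) iq])
    then have [measurable]: "(\<lambda>x. f (q x)) \<in> borel_measurable M" by auto
    have fk: "X x ^ k * f (q x) = f (of_real (X x) ^ k * q x)" for x k
      using f(2)[of "X x ^ k" "q x"] by simp
    show ?thesis
    proof (rule iexp_zero_imp_indicator_zero[OF fi X _ A], rule moments_iexp_zero)
      show "integrable M (\<lambda>x. X x ^ k * f (q x))" for k
        unfolding fk by (rule integrable_bounded_linear[OF f(1) ik])
      show "(LINT x|M. X x ^ k * f (q x)) = 0" for k
        unfolding fk integral_bounded_linear[OF f(1) ik] zero
        by (rule linear_simps(3)[OF f(1)])
      show "integrable M (\<lambda>x. exp (u * \<bar>X x\<bar>) * \<bar>f (q x)\<bar>)" for u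
      proof (rule Bochner_Integration.integrable_bound[OF integrable_norm[OF ie[of u]]])
        show "AE x in M. norm (exp (u * \<bar>X x\<bar>) * \<bar>f (q x)\<bar>) \<le> norm (norm (of_real (exp (u * \<bar>X x\<bar>)) * q x))"
          using f(3) by (intro AE_I2) (simp add: norm_mult)
      qed measurable
    qed measurable
  qed
  have i: "integrable M (\<lambda>x. indicator A (X x) * q x)"
  proof (rule Bochner_Integration.integrable_bound[OF iq])
    show "(\<lambda>x. indicator A (X x) * q x) \<in> borel_measurable M" using A by measurable
    show "AE x in M. norm (indicator A (X x) * q x) \<le> norm (q x)"
      by (intro AE_I2) (simp add: indicator_def)
  qed
  have "Re (LINT x|M. indicator A (X x) * q x) = (LINT x|M. indicator A (X x) * Re (q x))"
    unfolding integral_Re[OF i, symmetric]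
    by (intro Bochner_Integration.integral_cong refl) (simp add: indicator_def)
  also have "\<dots> = 0" by (rule part) (auto simp: bounded_linear_Re abs_Re_le_cmod)
  finally have re: "Re (LINT x|M. indicator A (X x) * q x) = 0" .
  have "Im (LINT x|M. indicator A (X x) * q x) = (LINT x|M. indicator A (X x) * Im (q x))"
    unfolding integral_Im[OF i, symmetric]
    by (intro Bochner_Integration.integral_cong refl) (simp add: indicator_def)
  also have "\<dots> = 0" by (rule part) (auto simp: bounded_linear_Im abs_Im_le_cmod)
  finally show ?thesis using re by (simp add: complex_eq_iff)
qed

section \<open>Boxes in the real coordinates\<close>

definition crd :: "bool \<Rightarrow> nat \<Rightarrow> (nat \<Rightarrow> complex) \<Rightarrow> real" where
  "crd b i z = (if b then Re (z i) else Im (z i))"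

lemma crd_measurable [measurable]: "crd b i \<in> borel_measurable borel"
  unfolding crd_def[abs_def] by measurable

lemma abs_crd_le: "\<bar>crd b i z\<bar> \<le> cmod (z i)"
  by (simp add: crd_def abs_Re_le_cmod abs_Im_le_cmod)

text \<open>Boxes are given by lists so that constraints can be added one real coordinate at a time
  and an intersection is a concatenation. A coordinate may occur repeatedly.\<close>

definition crd_rect :: "(bool \<times> nat \<times> real set) list \<Rightarrow> (nat \<Rightarrow> complex) set" where
  "crd_rect L = {z. \<forall>(b, i, A)\<in>set L. crd b i z \<in> A}"

lemma crd_rect_simps:
  "crd_rect [] = UNIV" "crd_rect ((b, i, A) # L) = {z. crd b i z \<in> A} \<inter> crd_rect L"
  "crd_rect (L @ L') = crd_rect L \<inter> crd_rect L'"
  unfolding crd_rect_def set_append ball_Un by auto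

definition borel_list :: "(bool \<times> nat \<times> real set) list \<Rightarrow> bool" where
  "borel_list L \<longleftrightarrow> (\<forall>(b, i, A)\<in>set L. A \<in> sets borel)"

lemma crd_rect_borel: "borel_list L \<Longrightarrow> crd_rect L \<in> sets borel"
proof (induction L)
  case (Cons t L)
  obtain b i A where t: "t = (b, i, A)" by (cases t)
  have "crd b i -` A \<inter> space borel \<in> sets borel"
    using Cons.prems by (intro measurable_sets[OF crd_measurable]) (auto simp: t borel_list_def)
  then show ?case using Cons by (simp add: t crd_rect_simps borel_list_def vimage_def sets.Int)
qed (simp add: crd_rect_simps)

text \<open>The real coordinates are measurable for the generated \<sigma>-algebra, hence so is the
  identity into the product; the coordinates being countably many, the product carries the Borel
  \<sigma>-algebra.\<close>

lemma sets_borel_crd_rect: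
  "sets (borel :: (nat \<Rightarrow> complex) measure) \<subseteq> sigma_sets UNIV {crd_rect L | L. borel_list L}"
proof -
  define N where "N = sigma UNIV {crd_rect L | L. borel_list L}"
  have sN: "sets N = sigma_sets UNIV {crd_rect L | L. borel_list L}" and spN: "space N = UNIV"
    by (auto simp: N_def)
  have c: "crd b i \<in> borel_measurable N" for b i
  proof (rule measurableI)
    fix A :: "real set" assume "A \<in> sets borel"
    then have "crd_rect [(b, i, A)] \<in> {crd_rect L | L. borel_list L}" by (auto simp: borel_list_def)
    moreover have "crd b i -` A \<inter> space N = crd_rect [(b, i, A)]" by (auto simp: spN crd_rect_simps)
    ultimately show "crd b i -` A \<inter> space N \<in> sets N" unfolding sN by (auto intro: sigma_sets.Basic)
  qed simp
  note c [measurable]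
  have "(\<lambda>z. z i) \<in> borel_measurable N" for i
  proof -
    have "(\<lambda>z. of_real (crd True i z) + \<i> * of_real (crd False i z)) \<in> borel_measurable N" by measurable
    moreover have "(\<lambda>z. of_real (crd True i z) + \<i> * of_real (crd False i z)) = (\<lambda>z. z i)"
      by (auto simp: crd_def complex_eq_iff)
    ultimately show ?thesis by simp
  qed
  then have "(\<lambda>z. z) \<in> N \<rightarrow>\<^sub>M Pi\<^sub>M UNIV (\<lambda>i::nat. borel :: complex measure)"
    by (intro measurable_PiM_single') auto
  then have id: "(\<lambda>z. z) \<in> N \<rightarrow>\<^sub>M borel"
    by (subst measurable_cong_sets[OF refl sets_PiM_equal_borel[symmetric]])
  show ?thesis
  proof
    fix B :: "(nat \<Rightarrow> complex) set" assume "B \<in> sets borel"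
    from measurable_sets[OF id this] show "B \<in> sigma_sets UNIV {crd_rect L | L. borel_list L}"
      by (simp add: sN spN)
  qed
qed

context gauss_weights begin

text \<open>The linear span as an inductive predicate: closure under multiplication by coordinates
  then follows from the generators by rule induction.\<close>

inductive hspan :: "((nat \<Rightarrow> complex) \<Rightarrow> complex) \<Rightarrow> bool" where
  hspan_hermite: "(\<alpha>, \<beta>) \<in> Idx \<Longrightarrow> hspan (hermite \<alpha> \<beta>)"
| hspan_add: "hspan p \<Longrightarrow> hspan q \<Longrightarrow> hspan (\<lambda>z. p z + q z)"
| hspan_cmult: "hspan p \<Longrightarrow> hspan (\<lambda>z. c * p z)"

lemma hspan_coord: "hspan q \<Longrightarrow> hspan (\<lambda>z. z i * q z)"
proof (induction rule: hspan.induct)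
  case (hspan_hermite \<alpha> \<beta>)
  have I: "(\<alpha>(i := \<alpha> i + 1), \<beta>) \<in> Idx" "(\<alpha>, \<beta>(i := \<beta> i - 1)) \<in> Idx"
    using Idx_upd[OF hspan_hermite, of i "\<alpha> i + 1" i "\<beta> i"] Idx_upd[OF hspan_hermite, of i "\<alpha> i" i "\<beta> i - 1"] by simp_all
  have "hspan (\<lambda>z. hermite (\<alpha>(i := \<alpha> i + 1)) \<beta> z + of_nat (\<beta> i) * hermite \<alpha> (\<beta>(i := \<beta> i - 1)) z)"
    by (intro hspan.hspan_add hspan.hspan_cmult hspan.hspan_hermite I)
  then show ?case unfolding hermite_mult_coord[OF hspan_hermite] .
next
  case (hspan_add p q)
  then show ?case using hspan.hspan_add[of "\<lambda>z. z i * p z" "\<lambda>z. z i * q z"] by (simp add: distrib_left)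
next
  case (hspan_cmult p c)
  then show ?case using hspan.hspan_cmult[of "\<lambda>z. z i * p z" c] by (simp add: mult.left_commute)
qed

text \<open>On generators, \<open>hermite_raise\<close> is solved for the term containing
  \<open>cnj (z i)\<close>, which leaves a combination of two Hermite polynomials.\<close>

lemma hspan_cnj_coord: "hspan q \<Longrightarrow> hspan (\<lambda>z. cnj (z i) * q z)"
proof (induction rule: hspan.induct)
  case (hspan_hermite \<alpha> \<beta>)
  have I: "(\<alpha>(i := \<alpha> i - 1), \<beta>) \<in> Idx" "(\<alpha>, \<beta>(i := \<beta> i + 1)) \<in> Idx"
    using Idx_upd[OF hspan_hermite, of i "\<alpha> i - 1" i "\<beta> i"] Idx_upd[OF hspan_hermite, of i "\<alpha> i" i "\<beta> i + 1"] by simp_all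
  have h: "hspan (\<lambda>z. of_real (vv i) * (hermite \<alpha> (\<beta>(i := \<beta> i + 1)) z + of_nat (\<alpha> i) * hermite (\<alpha>(i := \<alpha> i - 1)) \<beta> z))"
    by (intro hspan.hspan_add hspan.hspan_cmult hspan.hspan_hermite I)
  have "of_real (vv i) * (hermite \<alpha> (\<beta>(i := \<beta> i + 1)) z + of_nat (\<alpha> i) * hermite (\<alpha>(i := \<alpha> i - 1)) \<beta> z) = cnj (z i) * hermite \<alpha> \<beta> z" for z
    unfolding hermite_raise[OF hspan_hermite, symmetric] using vv_pos[of i] by (simp add: field_simps)
  then show ?case using h by simp
next
  case (hspan_add p q)
  then show ?case using hspan.hspan_add[of "\<lambda>z. cnj (z i) * p z" "\<lambda>z. cnj (z i) * q z"] by (simp add: distrib_left)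
next
  case (hspan_cmult p c)
  then show ?case using hspan.hspan_cmult[of "\<lambda>z. cnj (z i) * p z" c] by (simp add: mult.left_commute)
qed

lemma hspan_crd: assumes "hspan q" shows "hspan (\<lambda>z. of_real (crd b i z) * q z)"
proof (cases b)
  case True
  have "hspan (\<lambda>z. (1/2) * (z i * q z + cnj (z i) * q z))"
    by (intro hspan_add hspan_cmult hspan_coord hspan_cnj_coord assms)
  moreover have "(1/2) * (z i * q z + cnj (z i) * q z) = of_real (crd b i z) * q z" for z
    using complex_add_cnj[of "z i"] True by (simp add: crd_def distrib_right[symmetric])
  ultimately show ?thesis by simp
next
  case False
  have "hspan (\<lambda>z. (- \<i> / 2) * (z i * q z + (-1) * (cnj (z i) * q z)))"
    by (intro hspan_add hspan_cmult hspan_coord hspan_cnj_coord assms)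
  moreover have "(- \<i> / 2) * (z i * q z + (-1) * (cnj (z i) * q z)) = of_real (crd b i z) * q z" for z
    using False by (simp add: crd_def complex_eq_iff field_simps)
  ultimately show ?thesis by simp
qed

lemma hspan_crd_power: "hspan q \<Longrightarrow> hspan (\<lambda>z. of_real (crd b i z) ^ k * q z)"
proof (induction k)
  case (Suc k)
  then show ?case using hspan_crd[of "\<lambda>z. of_real (crd b i z) ^ k * q z" b i] by (simp add: mult.assoc)
qed simp

lemma hspan_tame: "hspan q \<Longrightarrow> tame q"
  by (induction rule: hspan.induct) (auto intro: tame_hermite tame_cmult)

lemma hspan_one: "hspan (\<lambda>_. 1)"
proof -
  have "((\<lambda>_. 0), (\<lambda>_. 0)) \<in> Idx" by (simp add: Idx_def)
  from hspan_hermite[OF this] show ?thesis by (simp add: hermite_def[abs_def])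
qed

lemma tame_crd: "tame (\<lambda>z. of_real (crd b i z))"
  by (rule tame_mono[OF tame_coord[of i], of _ 1]) (simp_all add: abs_crd_le)

lemma tame_exp_crd: "tame (\<lambda>z. of_real (exp (u * \<bar>crd b i z\<bar>)))"
proof (rule tame_mono[OF tame_exp_coord[of "\<bar>u\<bar>" i], of _ 1])
  fix z
  have "u * \<bar>crd b i z\<bar> \<le> \<bar>u\<bar> * cmod (z i)"
    using abs_crd_le[of b i z] by (intro mult_mono) auto
  then show "cmod (of_real (exp (u * \<bar>crd b i z\<bar>))) \<le> 1 * cmod (complex_of_real (exp (\<bar>u\<bar> * cmod (z i))))" by simp
qed simp_all

text \<open>
  Indicators are inserted one real coordinate at a time; each step only needs the uniqueness
  theorem for characteristic functions on the real line.
\<close>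

lemma orth_imp_rect_zero:
  assumes h: "h \<in> L2_fun P" and orth: "\<And>q. hspan q \<Longrightarrow> (LINT z|P. h z * q z) = 0"
  shows "borel_list L \<Longrightarrow> hspan q \<Longrightarrow> (LINT z|P. indicator (crd_rect L) z * (h z * q z)) = 0"
proof (induction L arbitrary: q)
  case Nil
  then show ?case using orth by (simp add: crd_rect_simps)
next
  case (Cons t L)
  obtain b i A where t: "t = (b, i, A)" by (cases t)
  have A: "A \<in> sets borel" and L: "borel_list L" using Cons.prems by (auto simp: t borel_list_def)
  let ?I = "\<lambda>z. indicator (crd_rect L) z :: complex"
  have tI: "tame ?I"
    using crd_rect_borel[OF L] by (intro tame_bounded[of _ 1]) (auto simp: indicator_def)
  have int: "integrable P (\<lambda>z. \<phi> z * (?I z * (h z * q z)))" if "tame \<phi>" for \<phi>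
  proof -
    have "tame (\<lambda>z. \<phi> z * ?I z * q z)" using that tI hspan_tame[OF Cons.prems(2)] by (intro tame_mult)
    from L2_fun_mult_integrable[OF h tame_L2[OF this]] show ?thesis by (simp add: mult_ac)
  qed
  have "(LINT z|P. indicator A (crd b i z) * (?I z * (h z * q z))) = 0"
  proof (rule moments_zero_imp_indicator_zero[OF measurable_P[OF crd_measurable] _ _ _ A])
    show "integrable P (\<lambda>z. of_real (crd b i z) ^ k * (?I z * (h z * q z)))" for k
      by (rule int) (intro tame_power tame_crd)
    show "integrable P (\<lambda>z. of_real (exp (u * \<bar>crd b i z\<bar>)) * (?I z * (h z * q z)))" for u
      by (rule int[OF tame_exp_crd])
    \<comment> \<open>Powers of the coordinate are absorbed into \<open>q\<close>; this is why the
      induction is over all \<open>q\<close> in the span.\<close>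
    show "(LINT z|P. of_real (crd b i z) ^ k * (?I z * (h z * q z))) = 0" for k
      using Cons.IH[OF L hspan_crd_power[OF Cons.prems(2), of b i k]] by (simp add: mult_ac)
  qed
  moreover have "indicator (crd_rect (t # L)) z = (indicator A (crd b i z) * ?I z :: complex)" for z
    by (auto simp: t crd_rect_simps indicator_def)
  ultimately show ?case by (simp add: mult.assoc)
qed

text \<open>Orthogonality to the span passes to integrals over boxes. As boxes are stable under
  intersection, the \<pi>-\<lambda> argument extends it to all Borel sets, and a density whose
  integrals all vanish is 0.\<close>

theorem hermite_total:
  assumes h: "h \<in> L2_fun P" and orth: "\<And>p. p \<in> Idx \<Longrightarrow> L2_inner P h (hermite (fst p) (snd p)) = 0"
  shows "AE z in P. h z = 0"
proof -
  \<comment> \<open>Conjugation turns the pairing into the bilinear integral of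
    \<open>g * q\<close>, into which coordinates and indicators can be inserted.\<close>
  define g where "g z = cnj (h z)" for z
  have g: "g \<in> L2_fun P" unfolding g_def by (rule L2_fun_cnj[OF h])
  have gi: "integrable P g" using L2_fun_mult_integrable[OF g tame_L2[OF tame_const[of 1]]] by simp
  have go: "(LINT z|P. g z * q z) = 0" if "hspan q" for q
    using that
  proof (induction rule: hspan.induct)
    case (hspan_hermite \<alpha> \<beta>)
    have "L2_inner P h (hermite \<alpha> \<beta>) = 0" using orth[OF hspan_hermite] by simp
    then have "cnj (L2_inner P h (hermite \<alpha> \<beta>)) = 0" by simp
    then have "L2_inner P (hermite \<alpha> \<beta>) h = 0" by (simp only: L2_inner_cnj)
    then show ?case by (simp add: L2_inner_def g_def mult.commute)
  next
    case (hspan_add p q)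
    have "integrable P (\<lambda>z. g z * p z)" "integrable P (\<lambda>z. g z * q z)"
      using hspan_add.hyps by (auto intro!: L2_fun_mult_integrable[OF g] tame_L2 hspan_tame)
    then show ?case using hspan_add.IH by (simp add: distrib_left)
  next
    case (hspan_cmult p c)
    then show ?case by (simp add: mult.left_commute)
  qed
  have rect: "(LINT z|P. indicator (crd_rect L) z * g z) = 0" if "borel_list L" for L
    using orth_imp_rect_zero[OF g go that hspan_one] by simp
  have gB: "integrable P (\<lambda>z. indicator B z * g z)" if "B \<in> sets borel" for B
  proof (rule Bochner_Integration.integrable_bound[OF gi])
    have "(indicator B :: _ \<Rightarrow> complex) \<in> borel_measurable P" using that by (intro measurable_P) simp
    then show "(\<lambda>z. indicator B z * g z) \<in> borel_measurable P" using gi by auto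
    show "AE z in P. norm (indicator B z * g z) \<le> norm (g z)" by (intro AE_I2) (simp add: indicator_def)
  qed
  let ?G = "{crd_rect L | L. borel_list L}"
  have Gb: "B \<in> sets borel" if "B \<in> sigma_sets UNIV ?G" for B
  proof -
    have "?G \<subseteq> sets borel" using crd_rect_borel by blast
    then show ?thesis using sets.sigma_sets_subset[of ?G borel] that by auto
  qed
  have all: "(LINT z|P. indicator B z * g z) = 0" if B: "B \<in> sigma_sets UNIV ?G" for B
  proof (rule sigma_sets_induct_disjoint[OF _ _ B])
    show "Int_stable ?G"
    proof (rule Int_stableI)
      fix A B assume "A \<in> ?G" "B \<in> ?G"
      then obtain L L' where "A = crd_rect L" "B = crd_rect L'" "borel_list L" "borel_list L'" by blast
      then have "A \<inter> B = crd_rect (L @ L')" "borel_list (L @ L')" by (auto simp: crd_rect_simps borel_list_def)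
      then show "A \<inter> B \<in> ?G" by blast
    qed
    show "(LINT z|P. indicator A z * g z) = 0" if "A \<in> ?G" for A using that rect by auto
    show "(LINT z|P. indicator (UNIV - A) z * g z) = 0"
      if A: "A \<in> sigma_sets UNIV ?G" "(LINT z|P. indicator A z * g z) = 0" for A
    proof -
      have e: "indicator (UNIV - A) z * g z = g z - indicator A z * g z" for z by (simp add: indicator_def)
      have "(LINT z|P. g z) = 0" using rect[of "[]"] by (simp add: crd_rect_simps borel_list_def)
      then show ?thesis unfolding e using A(2) gi gB[OF Gb[OF A(1)]] by simp
    qed
    show "(LINT z|P. indicator (\<Union>i. A i) z * g z) = 0"
      if A: "disjoint_family A" "range A \<subseteq> sigma_sets UNIV ?G" "\<And>i::nat. (LINT z|P. indicator (A i) z * g z) = 0" for A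
    proof -
      have Ab: "A i \<in> sets borel" for i using A(2) Gb by blast
      then have U: "(\<Union>i<n. A i) \<in> sets borel" for n :: nat by blast
      have part: "(LINT z|P. indicator (\<Union>i<n. A i) z * g z) = 0" for n
      proof -
        have "indicator (\<Union>i<n. A i) z = (\<Sum>i<n. indicator (A i) z :: complex)" for z
          by (rule indicator_UN_disjoint) (use A(1) in \<open>auto simp: disjoint_family_on_def\<close>)
        then have "(LINT z|P. indicator (\<Union>i<n. A i) z * g z) = (LINT z|P. (\<Sum>i<n. indicator (A i) z * g z))"
          by (simp add: sum_distrib_right)
        also have "\<dots> = (\<Sum>i<n. LINT z|P. indicator (A i) z * g z)"
          by (rule Bochner_Integration.integral_sum) (rule gB[OF Ab])
        finally show ?thesis by (simp add: A(3))
      qed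
      have "(\<lambda>n. LINT z|P. indicator (\<Union>i<n. A i) z * g z) \<longlonglongrightarrow> (LINT z|P. indicator (\<Union>i. A i) z * g z)"
      proof (rule integral_dominated_convergence[where w = "\<lambda>z. norm (g z)"])
        show "(\<lambda>z. indicator (\<Union>i. A i) z * g z) \<in> borel_measurable P"
          by (rule borel_measurable_integrable[OF gB]) (use Ab in blast)
        show "(\<lambda>z. indicator (\<Union>i<n. A i) z * g z) \<in> borel_measurable P" for n :: nat
          by (rule borel_measurable_integrable[OF gB[OF U]])
        show "integrable P (\<lambda>z. norm (g z))" using gi by (rule integrable_norm)
        show "AE z in P. (\<lambda>n. indicator (\<Union>i<n. A i) z * g z) \<longlonglongrightarrow> indicator (\<Union>i. A i) z * g z"
          by (intro AE_I2 tendsto_mult tendsto_const LIMSEQ_indicator_UN)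
        show "AE z in P. norm (indicator (\<Union>i<n. A i) z * g z) \<le> norm (g z)" for n :: nat
          by (intro AE_I2) (simp add: indicator_def)
      qed
      then show ?thesis unfolding part by (simp add: LIMSEQ_const_iff)
    qed
  qed simp_all
  have "AE z in P. g z = 0"
  proof (rule Pm.density_zero[OF gi])
    fix A assume "A \<in> sets P"
    then obtain B where B: "B \<in> sets borel" "A = ell2 \<inter> B"
      unfolding gauss_ell2_def sets_restrict_space sets_gauss_prod by blast
    have sp: "space P = ell2" by (simp add: gauss_ell2_def space_restrict_space space_Q)
    have "set_lebesgue_integral P A g = (LINT z|P. indicator B z * g z)"
      unfolding set_lebesgue_integral_def
      by (rule Bochner_Integration.integral_cong[OF refl]) (simp add: B(2) sp indicator_def)
    then show "set_lebesgue_integral P A g = 0" using all[OF subsetD[OF sets_borel_crd_rect B(1)]] by simp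
  qed
  then show ?thesis unfolding g_def by eventually_elim simp
qed

end

subsection \<open>The Koszul identity\<close>

text \<open>For j outside J, the sign of the permutation moving j past the smaller elements of J;
  \<open>eps_eq_isgn\<close> makes the link with \<open>eps\<close>.\<close>

definition isgn :: "nat \<Rightarrow> nat set \<Rightarrow> int" where
  "isgn j J = (-1) ^ card {l \<in> J. l < j}"

text \<open>One more adjacent transposition moves j one place further to the right and changes the
  sign.\<close>

lemma permute_list_move_front:
  assumes "k \<le> length J"
  shows "\<exists>p. p permutes {..<Suc (length J)} \<and> permute_list p (j # J) = take k J @ j # drop k J \<and> sign p = (-1) ^ k"
  using assms
proof (induction k)
  case 0
  show ?case by (intro exI[of _ id] conjI) (rule permutes_id, simp_all)
next
  case (Suc k)
  then obtain p where p: "p permutes {..<Suc (length J)}" "permute_list p (j # J) = take k J @ j # drop k J" "sign p = (-1) ^ k"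
    by auto
  have k: "k < length J" using Suc.prems by simp
  define q where "q = Transposition.transpose k (Suc k)"
  have q: "q permutes {..<Suc (length J)}" unfolding q_def by (rule permutes_swap_id) (use k in auto)
  have "permute_list (p \<circ> q) (j # J) = permute_list q (take k J @ j # drop k J)"
    using permute_list_compose[of q "j # J" p] q p(2) by simp
  also have "\<dots> = take (Suc k) J @ j # drop (Suc k) J"
  proof (rule nth_equalityI)
    show "length (permute_list q (take k J @ j # drop k J)) = length (take (Suc k) J @ j # drop (Suc k) J)"
      using k by simp
    fix i assume "i < length (permute_list q (take k J @ j # drop k J))"
    then have i: "i < Suc (length J)" using k by simp
    have "permute_list q (take k J @ j # drop k J) ! i = (take k J @ j # drop k J) ! q i"
      by (rule permute_list_nth) (use q i k in auto)
    also have "\<dots> = (take (Suc k) J @ j # drop (Suc k) J) ! i"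
    proof -
      have n: "(take m J @ j # drop m J) ! l = (if l < m then J ! l else if l = m then j else J ! (l - 1))"
        if "m \<le> length J" "l < Suc (length J)" for m l
        using that by (auto simp: nth_append nth_Cons' min_absorb2)
      have qi: "q m = (if m = k then Suc k else if m = Suc k then k else m)" for m
        by (simp add: q_def Transposition.transpose_def)
      have "q i < Suc (length J)" using i k by (simp add: qi)
      then show ?thesis using n[of k "q i"] n[of "Suc k" i] i k by (simp add: qi split: if_splits)
    qed
    finally show "permute_list q (take k J @ j # drop k J) ! i = (take (Suc k) J @ j # drop (Suc k) J) ! i" .
  qed
  finally have "permute_list (p \<circ> q) (j # J) = take (Suc k) J @ j # drop (Suc k) J" .
  moreover have "p \<circ> q permutes {..<Suc (length J)}" by (rule permutes_compose[OF q p(1)])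
  moreover have "sign (p \<circ> q) = (-1) ^ Suc k"
  proof -
    have "permutation p" "permutation q" using p(1) q by (auto simp: permutation_permutes)
    then have "sign (p \<circ> q) = sign p * sign q" by (rule sign_compose)
    then show ?thesis using p(3) by (simp add: q_def sign_swap_id)
  qed
  ultimately show ?case by blast
qed

lemma sorted_wrt_filter_split:
  "sorted_wrt (<) J \<Longrightarrow> J = filter (\<lambda>l. l < j) J @ filter (\<lambda>l. \<not> l < (j :: nat)) J"
proof (induction J)
  case (Cons x J)
  show ?case
  proof (cases "x < j")
    case False
    then have "\<forall>l\<in>set J. \<not> l < j" using Cons.prems by auto
    then show ?thesis using False by simp
  qed (use Cons in auto)
qed simp

text \<open>The lengths force j outside J. Splitting J at j into \<open>A\<close> and
  \<open>B\<close> makes K equal to \<open>A @ j # B\<close>, and the permutation selected by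
  \<open>eps\<close>, being unique, is the one that moves j past \<open>A\<close>.\<close>

lemma eps_eq_isgn:
  assumes J: "J \<in> multi_indices t" and K: "K \<in> multi_indices (t + 1)" and s: "set K = set J \<union> {j}"
  shows "eps K j J = isgn j (set J)"
proof -
  have sJ: "sorted_wrt (<) J" and sK: "sorted_wrt (<) K" and l: "length J = t" "length K = t + 1"
    using J K by (auto simp: multi_indices_def)
  have dJ: "distinct J" and dK: "distinct K" using sJ sK by (auto simp: strict_sorted_iff)
  have jJ: "j \<notin> set J"
  proof
    assume "j \<in> set J"
    then have "set K = set J" using s by auto
    then show False using distinct_card[OF dJ] distinct_card[OF dK] l by simp
  qed
  define A B where "A = filter (\<lambda>l. l < j) J" and "B = filter (\<lambda>l. \<not> l < j) J"
  have JAB: "J = A @ B" unfolding A_def B_def by (rule sorted_wrt_filter_split[OF sJ])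
  have k: "length A = card {l \<in> set J. l < j}"
    using distinct_card[of A] dJ by (simp add: A_def)
  have "\<forall>l\<in>set B. j < l" using jJ by (auto simp: B_def not_less le_less)
  then have "sorted_wrt (<) (A @ j # B)"
    using sJ by (auto simp: sorted_wrt_append A_def B_def intro: sorted_wrt_filter)
  moreover have "set (A @ j # B) = set K" using s by (auto simp: JAB)
  ultimately have KAB: "K = A @ j # B" using sK strict_sorted_equal by blast
  obtain p where p: "p permutes {..<Suc (length J)}" "permute_list p (j # J) = take (length A) J @ j # drop (length A) J" "sign p = (-1) ^ length A"
    using permute_list_move_front[of "length A" J j] by (auto simp: JAB)
  have pK: "p permutes {..<length K} \<and> permute_list p (j # J) = K"
    using p(1,2) l by (simp add: JAB KAB)
  have "(THE p. p permutes {..<length K} \<and> permute_list p (j # J) = K) = p"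
    by (rule the1_equality[OF eps_perm_ex1[OF J K s]]) (rule pK)
  then show ?thesis using p(3) s by (simp add: eps_def isgn_def k)
qed

text \<open>Inserting the smaller of i and j changes the count for the larger one but not
  conversely, so exactly one of the two signs flips.\<close>

lemma isgn_anticommute:
  assumes "i \<noteq> j" "i \<notin> L" "j \<notin> L" "finite L"
  shows "isgn i (insert j L) * isgn j (insert i L) = - (isgn i L * isgn j L)"
proof -
  have c: "isgn i (insert j L) = isgn i L * (if j < i then -1 else 1)" if "j \<notin> L" for i j
  proof -
    have "{l \<in> insert j L. l < i} = (if j < i then insert j {l \<in> L. l < i} else {l \<in> L. l < i})" by auto
    then have "card {l \<in> insert j L. l < i} = card {l \<in> L. l < i} + (if j < i then 1 else 0)"
      using that assms(4) by simp
    then show ?thesis by (simp add: isgn_def)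
  qed
  show ?thesis using c[OF assms(2), of j] c[OF assms(3), of i] assms(1) by (cases "i < j") auto
qed

lemma norm_sum_expand:
  fixes x :: "'i \<Rightarrow> complex"
  assumes "finite I"
  shows "of_real ((cmod (\<Sum>i\<in>I. x i))\<^sup>2)
    = (\<Sum>i\<in>I. of_real ((cmod (x i))\<^sup>2)) + (\<Sum>i\<in>I. \<Sum>j\<in>I - {i}. x i * cnj (x j))"
proof -
  have "of_real ((cmod (\<Sum>i\<in>I. x i))\<^sup>2) = (\<Sum>i\<in>I. \<Sum>j\<in>I. x i * cnj (x j))"
    by (simp add: complex_norm_square sum_product del: of_real_power)
  also have "\<dots> = (\<Sum>i\<in>I. x i * cnj (x i) + (\<Sum>j\<in>I - {i}. x i * cnj (x j)))"
    using assms by (intro sum.cong refl) (simp add: sum.remove)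
  finally show ?thesis by (simp add: sum.distrib complex_norm_square del: of_real_power)
qed

definition ksub :: "nat set \<Rightarrow> nat \<Rightarrow> nat set set" where
  "ksub \<Gamma> k = {K. K \<subseteq> \<Gamma> \<and> card K = k}"

lemma finite_ksub: "finite \<Gamma> \<Longrightarrow> finite (ksub \<Gamma> k)"
  unfolding ksub_def by (rule finite_subset[of _ "Pow \<Gamma>"]) auto

text \<open>Expand both squares. The mixed term of K at (i, j) meets that of L = K - {i, j} at (j,
  i): the weights agree because \<open>prod \<gamma> K\<close> is \<gamma>_i \<gamma>_j
  \<open>prod \<gamma> L\<close>, and the signs are opposite. On the diagonal, J receives \<gamma>_i
  from K = J \<union> {i} for each i outside J, and for each i in J it receives \<gamma>_i from L =
  J - {i}, where \<gamma>_i^2 \<open>prod \<gamma> L\<close> is \<gamma>_i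
  \<open>prod \<gamma> J\<close>.\<close>

lemma koszul_identity:
  fixes v :: "nat set \<Rightarrow> complex" and \<gamma> :: "nat \<Rightarrow> real"
  assumes \<Gamma>: "finite \<Gamma>"
  shows "(\<Sum>K\<in>ksub \<Gamma> (t + 2). prod \<gamma> K * (cmod (\<Sum>i\<in>K. of_int (isgn i (K - {i})) * v (K - {i})))\<^sup>2)
       + (\<Sum>L\<in>ksub \<Gamma> t. prod \<gamma> L * (cmod (\<Sum>i\<in>\<Gamma> - L. of_int (isgn i L) * of_real (\<gamma> i) * v (insert i L)))\<^sup>2)
       = sum \<gamma> \<Gamma> * (\<Sum>J\<in>ksub \<Gamma> (t + 1). prod \<gamma> J * (cmod (v J))\<^sup>2)"
proof -
  have fin: "finite K" if "K \<subseteq> \<Gamma>" for K using that \<Gamma> finite_subset by blast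
  define x where "x K i = of_int (isgn i (K - {i})) * v (K - {i})" for K i
  define y where "y L i = of_int (isgn i L) * of_real (\<gamma> i) * v (insert i L)" for L i
  have sgn1: "(cmod (of_int (isgn i J)))\<^sup>2 = 1" for i J by (simp add: isgn_def norm_power)
  have nx: "(cmod (x K i))\<^sup>2 = (cmod (v (K - {i})))\<^sup>2" for K i
    unfolding x_def norm_mult power_mult_distrib sgn1 by simp
  have ny: "(cmod (y L i))\<^sup>2 = (\<gamma> i)\<^sup>2 * (cmod (v (insert i L)))\<^sup>2" for L i
    unfolding y_def norm_mult power_mult_distrib sgn1 by simp
  define S1 where "S1 = (\<Sum>K\<in>ksub \<Gamma> (t + 2). \<Sum>i\<in>K. prod \<gamma> K * (cmod (v (K - {i})))\<^sup>2)"
  define S2 where "S2 = (\<Sum>L\<in>ksub \<Gamma> t. \<Sum>i\<in>\<Gamma> - L. prod \<gamma> L * ((\<gamma> i)\<^sup>2 * (cmod (v (insert i L)))\<^sup>2))"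
  define X1 where "X1 = (\<Sum>K\<in>ksub \<Gamma> (t + 2). \<Sum>i\<in>K. \<Sum>j\<in>K - {i}. of_real (prod \<gamma> K) * (x K i * cnj (x K j)))"
  define X2 where "X2 = (\<Sum>L\<in>ksub \<Gamma> t. \<Sum>i\<in>\<Gamma> - L. \<Sum>j\<in>\<Gamma> - L - {i}. of_real (prod \<gamma> L) * (y L i * cnj (y L j)))"
  have e1: "of_real (\<Sum>K\<in>ksub \<Gamma> (t + 2). prod \<gamma> K * (cmod (\<Sum>i\<in>K. x K i))\<^sup>2) = of_real S1 + X1"
  proof -
    have "of_real (prod \<gamma> K * (cmod (\<Sum>i\<in>K. x K i))\<^sup>2) = of_real (\<Sum>i\<in>K. prod \<gamma> K * (cmod (v (K - {i})))\<^sup>2)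
        + (\<Sum>i\<in>K. \<Sum>j\<in>K - {i}. of_real (prod \<gamma> K) * (x K i * cnj (x K j)))" if "K \<in> ksub \<Gamma> (t + 2)" for K
    proof -
      have "finite K" using that fin by (auto simp: ksub_def)
      from norm_sum_expand[OF this, of "x K"] show ?thesis
        unfolding of_real_mult nx by (simp add: distrib_left sum_distrib_left del: of_real_prod)
    qed
    then show ?thesis unfolding S1_def X1_def of_real_sum[of _ "ksub \<Gamma> (t + 2)"] sum.distrib[symmetric]
      by (intro sum.cong refl) simp
  qed
  have e2: "of_real (\<Sum>L\<in>ksub \<Gamma> t. prod \<gamma> L * (cmod (\<Sum>i\<in>\<Gamma> - L. y L i))\<^sup>2) = of_real S2 + X2"
  proof -
    have "of_real (prod \<gamma> L * (cmod (\<Sum>i\<in>\<Gamma> - L. y L i))\<^sup>2) = of_real (\<Sum>i\<in>\<Gamma> - L. prod \<gamma> L * ((\<gamma> i)\<^sup>2 * (cmod (v (insert i L)))\<^sup>2))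
        + (\<Sum>i\<in>\<Gamma> - L. \<Sum>j\<in>\<Gamma> - L - {i}. of_real (prod \<gamma> L) * (y L i * cnj (y L j)))" for L
    proof -
      have "finite (\<Gamma> - L)" using \<Gamma> by simp
      from norm_sum_expand[OF this, of "y L"] show ?thesis
        unfolding of_real_mult ny by (simp add: distrib_left sum_distrib_left del: of_real_prod)
    qed
    then show ?thesis unfolding S2_def X2_def of_real_sum[of _ "ksub \<Gamma> t"] sum.distrib[symmetric]
      by (intro sum.cong refl) simp
  qed
  have X: "X1 = - X2"
  proof -
    have "X1 = (\<Sum>(K, i, j)\<in>(SIGMA K:ksub \<Gamma> (t + 2). SIGMA i:K. K - {i}). of_real (prod \<gamma> K) * (x K i * cnj (x K j)))"
      unfolding X1_def using fin finite_ksub[OF \<Gamma>] by (simp add: sum.Sigma ksub_def)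
    also have "\<dots> = (\<Sum>(L, i, j)\<in>(SIGMA L:ksub \<Gamma> t. SIGMA i:\<Gamma> - L. \<Gamma> - L - {i}). - (of_real (prod \<gamma> L) * (y L i * cnj (y L j))))"
    \<comment> \<open>The two indices are interchanged: deleting i from K leaves
      \<open>insert j L\<close>, the argument of v in the term of L with index j.\<close>
    proof (rule sum.reindex_bij_witness[where i = "\<lambda>(L, i, j). (insert i (insert j L), j, i)" and j = "\<lambda>(K, i, j). (K - {i, j}, j, i)"], goal_cases)
      case (1 a)
      then show ?case by (auto simp: ksub_def)
    next
      case (2 a)
      then obtain K i j where a: "a = (K, i, j)" "K \<subseteq> \<Gamma>" "card K = t + 2" "i \<in> K" "j \<in> K" "i \<noteq> j"
        by (auto simp: ksub_def)
      then have "card (K - {i, j}) = t" using fin by (subst card_Diff_subset) auto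
      then show ?case using a by (auto simp: ksub_def)
    next
      case (3 a)
      then show ?case by auto
    next
      case (4 a)
      then obtain L i j where a: "a = (L, i, j)" "L \<subseteq> \<Gamma>" "card L = t" "i \<in> \<Gamma>" "j \<in> \<Gamma>" "i \<notin> L" "j \<notin> L" "i \<noteq> j"
        by (auto simp: ksub_def)
      then have "card (insert i (insert j L)) = t + 2" using fin by auto
      then show ?case using a by (auto simp: ksub_def)
    next
      case (5 a)
      then obtain K i j where a: "a = (K, i, j)" "K \<subseteq> \<Gamma>" "card K = t + 2" "i \<in> K" "j \<in> K" "i \<noteq> j"
        by (auto simp: ksub_def)
      define L where "L = K - {i, j}"
      have L: "finite L" "i \<notin> L" "j \<notin> L" "K = insert i (insert j L)" using a fin by (auto simp: L_def)
      have Ki: "K - {i} = insert j L" "K - {j} = insert i L" using a L by auto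
      have pr: "prod \<gamma> K = \<gamma> i * (\<gamma> j * prod \<gamma> L)" using L a by simp
      have sg: "complex_of_int (isgn i (insert j L)) * of_int (isgn j (insert i L)) = - (of_int (isgn i L) * of_int (isgn j L))"
        using isgn_anticommute[OF a(6) L(2,3,1)] by (metis of_int_mult of_int_minus)
      have "x K i * cnj (x K j) = (complex_of_int (isgn i (insert j L)) * of_int (isgn j (insert i L))) * (v (insert j L) * cnj (v (insert i L)))"
        by (simp add: x_def Ki)
      also have "\<dots> = - (of_int (isgn i L) * of_int (isgn j L) * (v (insert j L) * cnj (v (insert i L))))"
        unfolding sg by simp
      finally have xx: "x K i * cnj (x K j) = - (of_int (isgn i L) * of_int (isgn j L) * (v (insert j L) * cnj (v (insert i L))))" .
      show ?case unfolding a(1) split_conv xx pr L_def[symmetric] y_def by (simp add: mult_ac del: of_real_prod)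
    qed
    also have "\<dots> = - X2"
      unfolding X2_def using \<Gamma> finite_ksub[OF \<Gamma>] by (simp add: sum.Sigma sum_negf split_beta')
    finally show ?thesis .
  qed
  have S1': "S1 = (\<Sum>J\<in>ksub \<Gamma> (t + 1). \<Sum>i\<in>\<Gamma> - J. \<gamma> i * (prod \<gamma> J * (cmod (v J))\<^sup>2))"
  proof -
    have "S1 = (\<Sum>(K, i)\<in>(SIGMA K:ksub \<Gamma> (t + 2). K). prod \<gamma> K * (cmod (v (K - {i})))\<^sup>2)"
      unfolding S1_def using fin finite_ksub[OF \<Gamma>] by (simp add: sum.Sigma ksub_def)
    also have "\<dots> = (\<Sum>(J, i)\<in>(SIGMA J:ksub \<Gamma> (t + 1). \<Gamma> - J). \<gamma> i * (prod \<gamma> J * (cmod (v J))\<^sup>2))"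
    proof (rule sum.reindex_bij_witness[where i = "\<lambda>(J, i). (insert i J, i)" and j = "\<lambda>(K, i). (K - {i}, i)"], goal_cases)
      case (2 a)
      then show ?case using fin by (auto simp: ksub_def)
    next
      case (4 a)
      then show ?case using fin by (auto simp: ksub_def)
    next
      case (5 a)
      then obtain K i where a: "a = (K, i)" "K \<subseteq> \<Gamma>" "i \<in> K" by (auto simp: ksub_def)
      have "prod \<gamma> K = \<gamma> i * prod \<gamma> (K - {i})" by (rule prod.remove[OF fin[OF a(2)] a(3)])
      then show ?case by (simp add: a(1))
    qed (auto simp: ksub_def insert_absorb)
    also have "\<dots> = (\<Sum>J\<in>ksub \<Gamma> (t + 1). \<Sum>i\<in>\<Gamma> - J. \<gamma> i * (prod \<gamma> J * (cmod (v J))\<^sup>2))"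
      using \<Gamma> finite_ksub[OF \<Gamma>] by (simp add: sum.Sigma)
    finally show ?thesis .
  qed
  have S2': "S2 = (\<Sum>J\<in>ksub \<Gamma> (t + 1). \<Sum>i\<in>J. \<gamma> i * (prod \<gamma> J * (cmod (v J))\<^sup>2))"
  proof -
    have "S2 = (\<Sum>(L, i)\<in>(SIGMA L:ksub \<Gamma> t. \<Gamma> - L). prod \<gamma> L * ((\<gamma> i)\<^sup>2 * (cmod (v (insert i L)))\<^sup>2))"
      unfolding S2_def using \<Gamma> finite_ksub[OF \<Gamma>] by (simp add: sum.Sigma)
    also have "\<dots> = (\<Sum>(J, i)\<in>(SIGMA J:ksub \<Gamma> (t + 1). J). \<gamma> i * (prod \<gamma> J * (cmod (v J))\<^sup>2))"
    proof (rule sum.reindex_bij_witness[where j = "\<lambda>(J, i). (insert i J, i)" and i = "\<lambda>(K, i). (K - {i}, i)"], goal_cases)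
      case (2 a)
      then show ?case using fin by (auto simp: ksub_def)
    next
      case (4 a)
      then show ?case using fin by (auto simp: ksub_def)
    next
      case (5 a)
      then obtain L i where a: "a = (L, i)" "L \<subseteq> \<Gamma>" "i \<notin> L" by (auto simp: ksub_def)
      then show ?case using fin by (simp add: power2_eq_square)
    qed (auto simp: ksub_def insert_absorb)
    also have "\<dots> = (\<Sum>J\<in>ksub \<Gamma> (t + 1). \<Sum>i\<in>J. \<gamma> i * (prod \<gamma> J * (cmod (v J))\<^sup>2))"
      using fin finite_ksub[OF \<Gamma>] by (simp add: sum.Sigma ksub_def)
    finally show ?thesis .
  qed
  have "S1 + S2 = (\<Sum>J\<in>ksub \<Gamma> (t + 1). sum \<gamma> \<Gamma> * (prod \<gamma> J * (cmod (v J))\<^sup>2))"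
    unfolding S1' S2' sum.distrib[symmetric]
  proof (rule sum.cong[OF refl])
    fix J assume "J \<in> ksub \<Gamma> (t + 1)"
    then have "J \<subseteq> \<Gamma>" by (simp add: ksub_def)
    then have "sum \<gamma> (\<Gamma> - J) + sum \<gamma> J = sum \<gamma> \<Gamma>" using sum.subset_diff[OF _ \<Gamma>] by metis
    then show "(\<Sum>i\<in>\<Gamma> - J. \<gamma> i * (prod \<gamma> J * (cmod (v J))\<^sup>2)) + (\<Sum>i\<in>J. \<gamma> i * (prod \<gamma> J * (cmod (v J))\<^sup>2))
      = sum \<gamma> \<Gamma> * (prod \<gamma> J * (cmod (v J))\<^sup>2)"
      by (simp add: sum_distrib_right[symmetric] distrib_right[symmetric])
  qed
  then have S12: "S1 + S2 = sum \<gamma> \<Gamma> * (\<Sum>J\<in>ksub \<Gamma> (t + 1). prod \<gamma> J * (cmod (v J))\<^sup>2)"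
    by (simp add: sum_distrib_left)
  have "complex_of_real ((\<Sum>K\<in>ksub \<Gamma> (t + 2). prod \<gamma> K * (cmod (\<Sum>i\<in>K. x K i))\<^sup>2)
       + (\<Sum>L\<in>ksub \<Gamma> t. prod \<gamma> L * (cmod (\<Sum>i\<in>\<Gamma> - L. y L i))\<^sup>2)) = of_real (S1 + S2)"
    unfolding of_real_add e1 e2 X by simp
  then have "(\<Sum>K\<in>ksub \<Gamma> (t + 2). prod \<gamma> K * (cmod (\<Sum>i\<in>K. x K i))\<^sup>2)
       + (\<Sum>L\<in>ksub \<Gamma> t. prod \<gamma> L * (cmod (\<Sum>i\<in>\<Gamma> - L. y L i))\<^sup>2) = S1 + S2"
    by (simp only: of_real_eq_iff)
  then show ?thesis unfolding S12 x_def y_def .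
qed

subsection \<open>Hermite coefficients of the operator and of its adjoint\<close>

definition lst :: "nat set \<Rightarrow> nat list" where "lst = sorted_list_of_set"

lemma set_lst [simp]: "finite S \<Longrightarrow> set (lst S) = S"
  by (simp add: lst_def)

lemma multi_indices_set:
  assumes "J \<in> multi_indices t" shows "lst (set J) = J" "card (set J) = t" "finite (set J)"
proof -
  have J: "sorted_wrt (<) J" "length J = t" using assms by (auto simp: multi_indices_def)
  then have d: "sorted J" "distinct J" by (auto simp: strict_sorted_iff)
  show "lst (set J) = J" unfolding lst_def using d by (rule sorted_list_of_set.idem_if_sorted_distinct)
  show "card (set J) = t" using distinct_card[OF d(2)] J(2) by simp
qed simp

lemma lst_multi_indices: "finite J \<Longrightarrow> card J = t \<Longrightarrow> lst J \<in> multi_indices t"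
  by (simp add: multi_indices_def lst_def)

text \<open>A nonzero sign forces i in K and J = K - {i}, since i in J would give J and K the same
  size. Hence every inner sum has at most one term.\<close>

lemma infsum_eps:
  fixes F :: "nat \<Rightarrow> nat list \<Rightarrow> complex"
  assumes K: "K \<in> multi_indices (t + 1)"
  shows "(\<Sum>\<^sub>\<infinity>i. \<Sum>\<^sub>\<infinity>J\<in>multi_indices t. of_int (eps K i J) * F i J)
    = (\<Sum>i\<in>set K. of_int (isgn i (set K - {i})) * F i (lst (set K - {i})))"
proof -
  note mK = multi_indices_set[OF K]
  have J0: "lst (set K - {i}) \<in> multi_indices t" if "i \<in> set K" for i
    using that mK(2,3) by (intro lst_multi_indices) auto
  have nz: "i \<in> set K \<and> J = lst (set K - {i})" if J: "J \<in> multi_indices t" and e: "eps K i J \<noteq> 0" for i J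
  proof -
    note mJ = multi_indices_set[OF J]
    have s: "set K = set J \<union> {i}" using e by (auto simp: eps_def split: if_splits)
    have "i \<notin> set J"
    proof
      assume "i \<in> set J"
      then have "set K = set J" using s by auto
      then show False using mK(2) mJ(2) by simp
    qed
    then have "set J = set K - {i}" using s by auto
    then show ?thesis using s mJ(1) by auto
  qed
  have inner: "(\<Sum>\<^sub>\<infinity>J\<in>multi_indices t. of_int (eps K i J) * F i J)
      = (if i \<in> set K then of_int (isgn i (set K - {i})) * F i (lst (set K - {i})) else 0)" for i
  proof (cases "i \<in> set K")
    case True
    have z: "of_int (eps K i J) * F i J = 0" if "J \<in> multi_indices t" "J \<noteq> lst (set K - {i})" for J
      using nz[OF that(1), of i] that(2) by (cases "eps K i J = 0") auto
    have "(\<Sum>\<^sub>\<infinity>J\<in>multi_indices t. of_int (eps K i J) * F i J)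
       = (\<Sum>\<^sub>\<infinity>J\<in>{lst (set K - {i})}. of_int (eps K i J) * F i J)"
      by (rule infsum_cong_neutral) (use z J0[OF True] in blast)+
    also have "\<dots> = of_int (eps K i (lst (set K - {i}))) * F i (lst (set K - {i}))" by simp
    also have "eps K i (lst (set K - {i})) = isgn i (set K - {i})"
      using eps_eq_isgn[OF J0[OF True] K, of i] True mK(3) by (simp add: insert_absorb)
    finally show ?thesis using True by simp
  next
    case False
    have z: "of_int (eps K i J) * F i J = 0" if "J \<in> multi_indices t" for J
      using nz[OF that, of i] False by (cases "eps K i J = 0") auto
    have "(\<Sum>\<^sub>\<infinity>J\<in>multi_indices t. of_int (eps K i J) * F i J) = (\<Sum>\<^sub>\<infinity>J\<in>multi_indices t. 0)"
      by (rule infsum_cong) (rule z)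
    then show ?thesis using False by simp
  qed
  have "(\<Sum>\<^sub>\<infinity>i. if i \<in> set K then of_int (isgn i (set K - {i})) * F i (lst (set K - {i})) else 0)
      = (\<Sum>\<^sub>\<infinity>i\<in>set K. of_int (isgn i (set K - {i})) * F i (lst (set K - {i})))"
    by (rule infsum_cong_neutral) auto
  then show ?thesis unfolding inner by simp
qed

text \<open>With \<open>add1\<close>, the passage between a degree \<beta> and \<gamma> = \<beta> +
  1_J. Subtraction is truncated, so \<open>add1\<close> undoes \<open>sub1\<close> only for J inside
  the support of \<gamma>.\<close>

definition sub1 :: "nat set \<Rightarrow> (nat \<Rightarrow> nat) \<Rightarrow> nat \<Rightarrow> nat" where
  "sub1 J \<gamma> = (\<lambda>i. if i \<in> J then \<gamma> i - 1 else \<gamma> i)"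

definition add1 :: "nat set \<Rightarrow> (nat \<Rightarrow> nat) \<Rightarrow> nat \<Rightarrow> nat" where
  "add1 J \<beta> = (\<lambda>i. if i \<in> J then \<beta> i + 1 else \<beta> i)"

lemma sub1_add1: "sub1 J (add1 J \<beta>) = \<beta>"
  by (auto simp: sub1_def add1_def fun_eq_iff)

lemma add1_sub1: "J \<subseteq> {i. \<gamma> i \<noteq> 0} \<Longrightarrow> add1 J (sub1 J \<gamma>) = \<gamma>"
  by (auto simp: sub1_def add1_def fun_eq_iff)

lemma Idx_sub1: "(\<alpha>, \<gamma>) \<in> Idx \<Longrightarrow> (\<alpha>, sub1 J \<gamma>) \<in> Idx"
proof -
  assume "(\<alpha>, \<gamma>) \<in> Idx"
  moreover have "{i. sub1 J \<gamma> i \<noteq> 0} \<subseteq> {i. \<gamma> i \<noteq> 0}" by (auto simp: sub1_def)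
  ultimately show ?thesis unfolding Idx_def by (auto intro: finite_subset)
qed

lemma Idx_add1: "(\<alpha>, \<beta>) \<in> Idx \<Longrightarrow> finite J \<Longrightarrow> (\<alpha>, add1 J \<beta>) \<in> Idx"
proof -
  assume "(\<alpha>, \<beta>) \<in> Idx" "finite J"
  then have "finite ({i. \<beta> i \<noteq> 0} \<union> J)" "finite {i. \<alpha> i \<noteq> 0}" by (auto simp: Idx_def)
  moreover have "{i. add1 J \<beta> i \<noteq> 0} \<subseteq> {i. \<beta> i \<noteq> 0} \<union> J" by (auto simp: add1_def)
  ultimately have "finite {i. add1 J \<beta> i \<noteq> 0}" "finite {i. \<alpha> i \<noteq> 0}" by (auto intro: finite_subset)
  then show ?thesis by (simp add: Idx_def)
qed

context gauss_weights begin

lemma weight_pos: "weight a I J > 0"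
proof -
  have "(\<Prod>i\<leftarrow>I. (a i)\<^sup>2) > 0" for I by (induction I) (auto intro!: mult_pos_pos zero_less_power simp: a_pos)
  then show ?thesis by (simp add: weight_def)
qed

lemma L2_formD: "f \<in> L2_form r a s t \<Longrightarrow> I \<in> multi_indices s \<Longrightarrow> J \<in> multi_indices t \<Longrightarrow> f I J \<in> L2_fun P"
  by (simp add: L2_form_def)

lemma L2_fun_signed:
  assumes f: "f \<in> L2_form r a s t" and I: "I \<in> multi_indices s" and K: "K \<in> multi_indices (t + 1)" and i: "i \<in> set K"
  shows "f I (lst (set K - {i})) \<in> L2_fun P"
  using i multi_indices_set[OF K] by (intro L2_formD[OF f I] lst_multi_indices) auto

text \<open>Brings the defining identity into the shape required by \<open>weak_extend\<close>, a
  finite sum of inner products with explicit signs.\<close>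

lemma dbar_coeffs_iff:
  assumes f: "f \<in> L2_form r a s t"
  shows "dbar_coeffs r a s t f g \<longleftrightarrow> g \<in> L2_form r a s (t + 1) \<and>
    (\<forall>I\<in>multi_indices s. \<forall>K\<in>multi_indices (t + 1). \<forall>\<phi>\<in>test_funs. L2_inner P (g I K) \<phi>
      = - (\<Sum>i\<in>set K. L2_inner P (\<lambda>z. of_int (isgn i (set K - {i})) * f I (lst (set K - {i})) z) (delta_op r a i \<phi>)))"
proof -
  have "(LINT z|P. (\<Sum>\<^sub>\<infinity>i. \<Sum>\<^sub>\<infinity>J\<in>multi_indices t. of_int (eps K i J) * f I J z * cnj (delta_op r a i \<phi> z)))
      = (\<Sum>i\<in>set K. L2_inner P (\<lambda>z. of_int (isgn i (set K - {i})) * f I (lst (set K - {i})) z) (delta_op r a i \<phi>))"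
    if I: "I \<in> multi_indices s" and K: "K \<in> multi_indices (t + 1)" and \<phi>: "\<phi> \<in> test_funs" for I K \<phi>
  proof -
    have td: "tame (delta_op r a i \<phi>)" for i
      using tame_delta[OF test_funs_wirt[OF \<phi>], of i] delta_op_wirt[OF test_funs_wirt[OF \<phi>], of i] by presburger
    have "(LINT z|P. (\<Sum>\<^sub>\<infinity>i. \<Sum>\<^sub>\<infinity>J\<in>multi_indices t. of_int (eps K i J) * f I J z * cnj (delta_op r a i \<phi> z)))
      = (LINT z|P. (\<Sum>i\<in>set K. of_int (isgn i (set K - {i})) * f I (lst (set K - {i})) z * cnj (delta_op r a i \<phi> z)))"
      using infsum_eps[OF K, of "\<lambda>i J. f I J z * cnj (delta_op r a i \<phi> z)" for z] by (simp add: mult.assoc)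
    also have "\<dots> = (\<Sum>i\<in>set K. L2_inner P (\<lambda>z. of_int (isgn i (set K - {i})) * f I (lst (set K - {i})) z) (delta_op r a i \<phi>))"
      unfolding L2_inner_def
      by (rule Bochner_Integration.integral_sum, rule L2_inner_integrable[OF L2_fun_cmult[OF L2_fun_signed[OF f I K]] tame_L2[OF td]])
    finally show ?thesis .
  qed
  then show ?thesis unfolding dbar_coeffs_def L2_inner_def[of P "g _ _"] by auto
qed

lemma dbar_coeffs_hermite:
  assumes f: "f \<in> L2_form r a s t" and d: "dbar_coeffs r a s t f g"
    and I: "I \<in> multi_indices s" and K: "K \<in> multi_indices (t + 1)" and p: "(\<alpha>, \<beta>) \<in> Idx"
  shows "L2_inner P (g I K) (hermite \<alpha> \<beta>)
    = (\<Sum>i\<in>set K. of_int (isgn i (set K - {i})) * L2_inner P (f I (lst (set K - {i}))) (hermite \<alpha> (\<beta>(i := \<beta> i + 1))))"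
proof -
  note D = d[unfolded dbar_coeffs_iff[OF f]]
  have "L2_inner P (g I K) (hermite \<alpha> \<beta>)
    = (\<Sum>i\<in>set K. L2_inner P (\<lambda>z. of_int (isgn i (set K - {i})) * f I (lst (set K - {i})) z) (hermite \<alpha> (\<beta>(i := \<beta> i + 1))))"
  proof (rule weak_extend_hermite[OF _ _ _ _ p])
    show "g I K \<in> L2_fun P" using D I K by (auto intro: L2_formD)
  qed (use D I K L2_fun_signed[OF f I K] in auto)
  then show ?thesis unfolding L2_inner_cmult_left .
qed

text \<open>Both candidates have the same Hermite coefficients, so totality identifies them. This
  makes the arbitrary choice in \<open>dbar\<close> harmless.\<close>

lemma dbar_coeffs_unique:
  assumes f: "f \<in> L2_form r a s t" and d: "dbar_coeffs r a s t f g" and d': "dbar_coeffs r a s t f g'"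
    and I: "I \<in> multi_indices s" and K: "K \<in> multi_indices (t + 1)"
  shows "AE z in P. g I K z = g' I K z"
proof -
  have g: "g I K \<in> L2_fun P" "g' I K \<in> L2_fun P"
    using d d' I K unfolding dbar_coeffs_def by (auto intro: L2_formD)
  have "AE z in P. g I K z - g' I K z = 0"
  proof (rule hermite_total[OF L2_fun_diff[OF g]])
    fix p assume "p \<in> Idx"
    then have p: "(fst p, snd p) \<in> Idx" by simp
    show "L2_inner P (\<lambda>z. g I K z - g' I K z) (hermite (fst p) (snd p)) = 0"
      unfolding L2_inner_diff_left[OF g tame_L2[OF tame_hermite[OF p]]]
        dbar_coeffs_hermite[OF f d I K p] dbar_coeffs_hermite[OF f d' I K p] by simp
  qed
  then show ?thesis by eventually_elim simp
qed

text \<open>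
  The adjoint is probed on forms with a single coefficient, a Hermite polynomial;
  \<open>gform\<close> is the image of such a form, up to the factor \<open>(-1) ^ s\<close>.
\<close>

definition uform :: "nat list \<Rightarrow> nat list \<Rightarrow> (nat \<Rightarrow> nat) \<Rightarrow> (nat \<Rightarrow> nat) \<Rightarrow> form" where
  "uform I0 L0 \<alpha> \<beta> = (\<lambda>I J. if I = I0 \<and> J = L0 then hermite \<alpha> \<beta> else (\<lambda>_. 0))"

definition gform :: "nat list \<Rightarrow> nat list \<Rightarrow> (nat \<Rightarrow> nat) \<Rightarrow> (nat \<Rightarrow> nat) \<Rightarrow> form" where
  "gform I0 L0 \<alpha> \<beta> = (\<lambda>I K z. \<Sum>i\<in>set K. if I = I0 \<and> set K - {i} = set L0
     then of_int (isgn i (set L0)) * (of_nat (\<beta> i) / of_real (vv i) * hermite \<alpha> (\<beta>(i := \<beta> i - 1)) z) else 0)"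

lemma L2_form_finite_support:
  assumes t: "\<And>I J. I \<in> multi_indices s \<Longrightarrow> J \<in> multi_indices t \<Longrightarrow> f I J \<in> L2_fun P"
    and M: "finite M" and z: "\<And>I J. I \<in> multi_indices s \<Longrightarrow> J \<in> multi_indices t \<Longrightarrow> (I, J) \<notin> M \<Longrightarrow> f I J = (\<lambda>_. 0)"
  shows "f \<in> L2_form r a s t"
  unfolding L2_form_def
proof (intro CollectI conjI ballI)
  show "f I J \<in> L2_fun P" if "I \<in> multi_indices s" "J \<in> multi_indices t" for I J by (rule t[OF that])
  show "(\<lambda>(I, J). weight a I J * (LINT z|P. (cmod (f I J z))\<^sup>2)) summable_on multi_indices s \<times> multi_indices t"
  proof (rule finite_nonzero_values_imp_summable_on, rule finite_subset[OF _ M], rule subsetI)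
    fix p assume p: "p \<in> {p \<in> multi_indices s \<times> multi_indices t. (case p of (I, J) \<Rightarrow> weight a I J * (LINT z|P. (cmod (f I J z))\<^sup>2)) \<noteq> 0}"
    obtain I J where pIJ: "p = (I, J)" by (cases p)
    show "p \<in> M"
    proof (rule ccontr)
      assume "p \<notin> M"
      then have "f I J = (\<lambda>_. 0)" using z[of I J] p pIJ by auto
      then show False using p pIJ by simp
    qed
  qed
qed

lemma uform_L2:
  assumes "(\<alpha>, \<beta>) \<in> Idx" shows "uform I0 L0 \<alpha> \<beta> \<in> L2_form r a s t"
  by (rule L2_form_finite_support[where M = "{(I0, L0)}"])
     (use tame_L2[OF tame_hermite[OF assms]] in \<open>auto simp: uform_def\<close>)

lemma gform_term_tame:
  assumes "(\<alpha>, \<beta>) \<in> Idx"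
  shows "tame (\<lambda>z. if I = I0 \<and> set K - {i} = set L0
     then of_int (isgn i (set L0)) * (of_nat (\<beta> i) / of_real (vv i) * hermite \<alpha> (\<beta>(i := \<beta> i - 1)) z) else 0)"
proof (cases "I = I0 \<and> set K - {i} = set L0")
  case True
  then show ?thesis
    by (simp only: True if_True simp_thms) (rule tame_cmult[OF wirt_tame(3)[OF wirt_hermite[OF assms, of i]]])
next
  case False
  then show ?thesis by (simp only: if_False tame_const)
qed

lemma gform_tame:
  assumes "(\<alpha>, \<beta>) \<in> Idx" shows "tame (gform I0 L0 \<alpha> \<beta> I K)"
proof -
  show ?thesis unfolding gform_def by (rule tame_sum) (rule gform_term_tame[OF assms])
qed

text \<open>A term needs K to arise from L0 by inserting some i, and it carries the factor
  \<beta>_i. Only finitely many K are left, which puts \<open>gform\<close> in the Hilbert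
  space.\<close>

lemma gform_zero:
  assumes K: "K \<in> multi_indices (t + 1)" and L0: "L0 \<in> multi_indices t"
    and n: "\<not> (I = I0 \<and> (\<exists>i\<in>{i. \<beta> i \<noteq> 0} - set L0. K = lst (insert i (set L0))))"
  shows "gform I0 L0 \<alpha> \<beta> I K = (\<lambda>_. 0)"
proof
  fix z
  show "gform I0 L0 \<alpha> \<beta> I K z = 0" unfolding gform_def
  proof (rule sum.neutral, rule ballI)
    fix i assume i: "i \<in> set K"
    have "\<beta> i = 0" if "I = I0" "set K - {i} = set L0"
    proof (rule ccontr)
      assume "\<beta> i \<noteq> 0"
      moreover have "i \<notin> set L0" using that(2) by auto
      moreover have "K = lst (insert i (set L0))"
        using that(2) i multi_indices_set(1)[OF K] by (metis insert_Diff)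
      ultimately show False using n that(1) by blast
    qed
    then show "(if I = I0 \<and> set K - {i} = set L0
       then of_int (isgn i (set L0)) * (of_nat (\<beta> i) / of_real (vv i) * hermite \<alpha> (\<beta>(i := \<beta> i - 1)) z) else 0) = 0"
      by auto
  qed
qed

lemma gform_value:
  assumes L0: "L0 \<in> multi_indices t" and i: "i \<notin> set L0"
  shows "gform I0 L0 \<alpha> \<beta> I0 (lst (insert i (set L0))) z
    = of_int (isgn i (set L0)) * (of_nat (\<beta> i) / of_real (vv i) * hermite \<alpha> (\<beta>(i := \<beta> i - 1)) z)"
proof -
  have iff: "insert i (set L0) - {j} = set L0 \<longleftrightarrow> j = i" if "j \<in> insert i (set L0)" for j
    using that i by auto
  have "gform I0 L0 \<alpha> \<beta> I0 (lst (insert i (set L0))) z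
    = (\<Sum>j\<in>insert i (set L0). if j = i then of_int (isgn i (set L0)) * (of_nat (\<beta> i) / of_real (vv i) * hermite \<alpha> (\<beta>(i := \<beta> i - 1)) z) else 0)"
    unfolding gform_def
  proof (rule sum.cong)
    fix j assume j: "j \<in> insert i (set L0)"
    have s: "set (lst (insert i (set L0))) = insert i (set L0)" by simp
    show "(if I0 = I0 \<and> set (lst (insert i (set L0))) - {j} = set L0
       then of_int (isgn j (set L0)) * (of_nat (\<beta> j) / of_real (vv j) * hermite \<alpha> (\<beta>(j := \<beta> j - 1)) z) else 0)
      = (if j = i then of_int (isgn i (set L0)) * (of_nat (\<beta> i) / of_real (vv i) * hermite \<alpha> (\<beta>(i := \<beta> i - 1)) z) else 0)"
      unfolding s iff[OF j] by simp
  qed simp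
  then show ?thesis by simp
qed

text \<open>\<open>wirt_adjoint\<close> moves the derivative from the Hermite coefficient to the
  test function; on both sides only indices i with K - {i} = L0 contribute.\<close>

lemma gform_dbar:
  assumes p: "(\<alpha>, \<beta>) \<in> Idx" and L0: "L0 \<in> multi_indices t"
  shows "dbar_coeffs r a s t (uform I0 L0 \<alpha> \<beta>) (gform I0 L0 \<alpha> \<beta>)"
  unfolding dbar_coeffs_iff[OF uform_L2[OF p]]
proof (intro conjI ballI)
  have "finite {i. \<beta> i \<noteq> 0}" using p by (simp add: Idx_def)
  then have M: "finite ({I0} \<times> (\<lambda>i. lst (insert i (set L0))) ` {i. \<beta> i \<noteq> 0})" by simp
  show "gform I0 L0 \<alpha> \<beta> \<in> L2_form r a s (t + 1)"
    by (rule L2_form_finite_support[OF tame_L2[OF gform_tame[OF p]] M], rule gform_zero[OF _ L0]) auto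
  fix I K \<phi> assume I: "I \<in> multi_indices s" and K: "K \<in> multi_indices (t + 1)" and \<phi>: "\<phi> \<in> test_funs"
  note w = test_funs_wirt[OF \<phi>]
  have d: "delta_op r a i \<phi> = (\<lambda>z. -1 * (cnj (z i) / of_real (vv i) * \<phi> z - dz i \<phi> z))" for i
    by (intro ext) (simp add: delta_op_wirt[OF w])
  have td: "tame (\<lambda>z. if I = I0 \<and> set K - {i} = set L0
     then of_int (isgn i (set L0)) * (of_nat (\<beta> i) / of_real (vv i) * hermite \<alpha> (\<beta>(i := \<beta> i - 1)) z) else 0)" for i
    by (rule gform_term_tame[OF p])
  have "L2_inner P (gform I0 L0 \<alpha> \<beta> I K) \<phi> = (\<Sum>i\<in>set K. L2_inner P (\<lambda>z. if I = I0 \<and> set K - {i} = set L0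
     then of_int (isgn i (set L0)) * (of_nat (\<beta> i) / of_real (vv i) * hermite \<alpha> (\<beta>(i := \<beta> i - 1)) z) else 0) \<phi>)"
    unfolding gform_def by (rule L2_inner_sum_left) (auto intro!: tame_L2 td wirt_tame(1)[OF w])
  also have "\<dots> = (\<Sum>i\<in>set K. - L2_inner P (\<lambda>z. of_int (isgn i (set K - {i})) * uform I0 L0 \<alpha> \<beta> I (lst (set K - {i})) z) (delta_op r a i \<phi>))"
  proof (rule sum.cong[OF refl])
    fix i assume i: "i \<in> set K"
    have iff: "lst (set K - {i}) = L0 \<longleftrightarrow> set K - {i} = set L0"
      using multi_indices_set(1)[OF L0] by (metis List.finite_set finite_Diff set_lst)
    show "L2_inner P (\<lambda>z. if I = I0 \<and> set K - {i} = set L0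
       then of_int (isgn i (set L0)) * (of_nat (\<beta> i) / of_real (vv i) * hermite \<alpha> (\<beta>(i := \<beta> i - 1)) z) else 0) \<phi>
      = - L2_inner P (\<lambda>z. of_int (isgn i (set K - {i})) * uform I0 L0 \<alpha> \<beta> I (lst (set K - {i})) z) (delta_op r a i \<phi>)"
    proof (cases "I = I0 \<and> set K - {i} = set L0")
      case True
      then have e: "I = I0" "lst (set K - {i}) = L0" "set K - {i} = set L0" using iff by auto
      have uf: "uform I0 L0 \<alpha> \<beta> I (lst (set K - {i})) = hermite \<alpha> \<beta>" using e by (simp add: uform_def)
      have lhs: "(\<lambda>z. if I = I0 \<and> set K - {i} = set L0
         then of_int (isgn i (set L0)) * (of_nat (\<beta> i) / of_real (vv i) * hermite \<alpha> (\<beta>(i := \<beta> i - 1)) z) else 0)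
        = (\<lambda>z. of_int (isgn i (set L0)) * (of_nat (\<beta> i) / of_real (vv i) * hermite \<alpha> (\<beta>(i := \<beta> i - 1)) z))"
        using True by auto
      have ad: "L2_inner P (\<lambda>z. of_nat (\<beta> i) / of_real (vv i) * hermite \<alpha> (\<beta>(i := \<beta> i - 1)) z) \<phi>
         = L2_inner P (hermite \<alpha> \<beta>) (\<lambda>z. cnj (z i) / of_real (vv i) * \<phi> z - dz i \<phi> z)"
        by (rule wirt_adjoint[OF wirt_hermite[OF p, of i] w[of i]])
      have l: "L2_inner P (\<lambda>z. of_int (isgn i (set L0)) * (of_nat (\<beta> i) / of_real (vv i) * hermite \<alpha> (\<beta>(i := \<beta> i - 1)) z)) \<phi>
         = of_int (isgn i (set L0)) * L2_inner P (hermite \<alpha> \<beta>) (\<lambda>z. cnj (z i) / of_real (vv i) * \<phi> z - dz i \<phi> z)"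
        by (subst L2_inner_cmult_left) (simp only: ad)
      show ?thesis unfolding lhs uf unfolding e(3) l unfolding d L2_inner_cmult_right L2_inner_cmult_left[of P "of_int _"] by simp
    next
      case False
      have uf: "uform I0 L0 \<alpha> \<beta> I (lst (set K - {i})) = (\<lambda>_. 0)" using False iff by (auto simp: uform_def)
      have lhs: "(\<lambda>z. if I = I0 \<and> set K - {i} = set L0
         then of_int (isgn i (set L0)) * (of_nat (\<beta> i) / of_real (vv i) * hermite \<alpha> (\<beta>(i := \<beta> i - 1)) z) else 0) = (\<lambda>z. 0)"
        by (simp only: False if_False)
      show ?thesis unfolding lhs uf by (simp add: L2_inner_def)
    qed
  qed
  finally show "L2_inner P (gform I0 L0 \<alpha> \<beta> I K) \<phi> = - (\<Sum>i\<in>set K. L2_inner P (\<lambda>z. of_int (isgn i (set K - {i})) * uform I0 L0 \<alpha> \<beta> I (lst (set K - {i})) z) (delta_op r a i \<phi>))"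
    by (simp add: sum_negf)
qed

text \<open>Pair the adjoint relation with \<open>uform\<close>: one side is a single coefficient of
  h. On the other, inserting i into L0 multiplies the weight by a_i^2 while the derivative
  contributes 1 / \<open>vv i\<close>, so every term has the same factor 1 / (2 r^2).\<close>

lemma adj_hermite:
  assumes f: "f \<in> L2_form r a s (t + 1)" and h: "is_dbar_adj r a s t f h"
    and I0: "I0 \<in> multi_indices s" and L0: "L0 \<in> multi_indices t" and p: "(\<alpha>, \<beta>) \<in> Idx"
  shows "L2_inner P (h I0 L0) (hermite \<alpha> \<beta>) = (-1) ^ s / of_real (2 * r\<^sup>2) *
    (\<Sum>i\<in>{i. \<beta> i \<noteq> 0} - set L0. of_int (isgn i (set L0)) * of_nat (\<beta> i) *
        L2_inner P (f I0 (lst (insert i (set L0)))) (hermite \<alpha> (\<beta>(i := \<beta> i - 1))))"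
proof -
  let ?u = "uform I0 L0 \<alpha> \<beta>" and ?g = "gform I0 L0 \<alpha> \<beta>"
  define B where "B = {i. \<beta> i \<noteq> 0} - set L0"
  have B: "finite B" using p by (simp add: B_def Idx_def)
  have Lf: "finite (set L0)" "card (set L0) = t" using multi_indices_set[OF L0] by auto
  have ug: "dbar_coeffs r a s t ?u ?g" by (rule gform_dbar[OF p L0])
  define G where "G = (SOME g. dbar_coeffs r a s t ?u g)"
  have G: "dbar_coeffs r a s t ?u G" unfolding G_def by (rule someI[of "dbar_coeffs r a s t ?u", OF ug])
  have du: "dbar r a s t ?u = (\<lambda>I K z. (-1) ^ s * G I K z)" by (simp add: dbar_def G_def)
  have ud: "?u \<in> dom_dbar r a s t" unfolding dom_dbar_def using ug uform_L2[OF p] by blast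
  have eq: "form_inner r a s (t + 1) (dbar r a s t ?u) f = form_inner r a s t ?u h"
    using h ud unfolding is_dbar_adj_def by blast
  have r: "form_inner r a s t ?u h = of_real (weight a I0 L0) * L2_inner P (hermite \<alpha> \<beta>) (h I0 L0)"
  proof -
    have "form_inner r a s t ?u h = (\<Sum>\<^sub>\<infinity>(I, J)\<in>{(I0, L0)}. of_real (weight a I J) * (LINT z|P. ?u I J z * cnj (h I J z)))"
      unfolding form_inner_def
    proof (rule infsum_cong_neutral, goal_cases)
      case (2 x)
      then obtain I J where x: "x = (I, J)" "(I, J) \<noteq> (I0, L0)" by (cases x) auto
      then have "?u I J = (\<lambda>_. 0)" by (auto simp: uform_def)
      then show ?case by (simp add: x(1))
    qed (use I0 L0 in auto)
    then show ?thesis by (simp add: uform_def L2_inner_def)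
  qed
  \<comment> \<open>\<open>dbar\<close> yields the chosen \<open>G\<close>, not
    \<open>gform\<close>; the two agree almost everywhere, which is enough under the
    integral.\<close>
  have GI: "(LINT z|P. (-1) ^ s * G I K z * cnj (f I K z)) = (-1) ^ s * L2_inner P (?g I K) (f I K)"
    if I: "I \<in> multi_indices s" and K: "K \<in> multi_indices (t + 1)" for I K
  proof -
    have [measurable]: "G I K \<in> borel_measurable P" "?g I K \<in> borel_measurable P" "f I K \<in> borel_measurable P"
      using G ug f I K unfolding dbar_coeffs_def by (auto intro!: L2_fun_measurable L2_formD)
    have "(LINT z|P. G I K z * cnj (f I K z)) = L2_inner P (?g I K) (f I K)"
      unfolding L2_inner_def
    proof (rule integral_cong_AE)
      show "AE z in P. G I K z * cnj (f I K z) = ?g I K z * cnj (f I K z)"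
        using dbar_coeffs_unique[OF uform_L2[OF p] G ug I K] by eventually_elim simp
    qed measurable
    then show ?thesis by (simp add: mult.assoc)
  qed
  define F where "F i = of_real (weight a I0 L0) * ((-1) ^ s / of_real (2 * r\<^sup>2)) * (of_int (isgn i (set L0)) * of_nat (\<beta> i) *
        L2_inner P (hermite \<alpha> (\<beta>(i := \<beta> i - 1))) (f I0 (lst (insert i (set L0)))))" for i
  have l: "form_inner r a s (t + 1) (dbar r a s t ?u) f = (\<Sum>i\<in>B. F i)"
  proof -
    have mem: "lst (insert i (set L0)) \<in> multi_indices (t + 1)" if "i \<in> B" for i
      using that Lf by (intro lst_multi_indices) (auto simp: B_def)
    have "form_inner r a s (t + 1) (dbar r a s t ?u) f
      = (\<Sum>\<^sub>\<infinity>(I, K)\<in>(\<lambda>i. (I0, lst (insert i (set L0)))) ` B. of_real (weight a I K) * ((-1) ^ s * L2_inner P (?g I K) (f I K)))"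
      unfolding form_inner_def du
    proof (rule infsum_cong_neutral, goal_cases)
      case (1 x)
      then show ?case using I0 mem by auto
    next
      case (2 x)
      then obtain I K where x: "x = (I, K)" "I \<in> multi_indices s" "K \<in> multi_indices (t + 1)" "(I, K) \<notin> (\<lambda>i. (I0, lst (insert i (set L0)))) ` B"
        by auto
      have "?g I K = (\<lambda>_. 0)"
        by (rule gform_zero[OF x(3) L0]) (use x(4) in \<open>auto simp: B_def\<close>)
      then show ?case using GI[OF x(2,3)] by (simp add: x(1) L2_inner_def)
    next
      case (3 x)
      then show ?case using GI by auto
    qed
    also have "\<dots> = (\<Sum>(I, K)\<in>(\<lambda>i. (I0, lst (insert i (set L0)))) ` B. of_real (weight a I K) * ((-1) ^ s * L2_inner P (?g I K) (f I K)))"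
      using B by (intro infsum_finite) simp
    also have "\<dots> = (\<Sum>i\<in>B. of_real (weight a I0 (lst (insert i (set L0)))) * ((-1) ^ s * L2_inner P (?g I0 (lst (insert i (set L0)))) (f I0 (lst (insert i (set L0))))))"
    proof (subst sum.reindex)
      show "inj_on (\<lambda>i. (I0, lst (insert i (set L0)))) B"
      proof (rule inj_onI)
        fix i j assume ij: "i \<in> B" "j \<in> B" "(I0, lst (insert i (set L0))) = (I0, lst (insert j (set L0)))"
        then have "set (lst (insert i (set L0))) = set (lst (insert j (set L0)))" by simp
        then have "insert i (set L0) = insert j (set L0)" by simp
        then show "i = j" using ij by (auto simp: B_def)
      qed
    qed simp
    also have "\<dots> = (\<Sum>i\<in>B. F i)"
    proof (rule sum.cong[OF refl])
      fix i assume i: "i \<in> B"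
      then have iL: "i \<notin> set L0" by (simp add: B_def)
      have "weight a I0 (lst (insert i (set L0))) = weight a I0 L0 * (a i)\<^sup>2"
      proof -
        have pl: "(\<Prod>j\<leftarrow>lst S. (a j)\<^sup>2) = (\<Prod>j\<in>S. (a j)\<^sup>2)" if "finite S" for S
          using prod.distinct_set_conv_list[of "lst S" "\<lambda>j. (a j)\<^sup>2"] that by (simp add: lst_def)
        have "(\<Prod>j\<leftarrow>L0. (a j)\<^sup>2) = (\<Prod>j\<in>set L0. (a j)\<^sup>2)" using pl[of "set L0"] multi_indices_set(1)[OF L0] by simp
        then show ?thesis using pl[of "insert i (set L0)"] iL by (simp add: weight_def mult_ac)
      qed
      then have w: "complex_of_real (weight a I0 (lst (insert i (set L0)))) / of_real (vv i) = of_real (weight a I0 L0) / of_real (2 * r\<^sup>2)"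
        using a_pos[of i] r_pos by (simp add: vv_def)
      have "L2_inner P (?g I0 (lst (insert i (set L0)))) (f I0 (lst (insert i (set L0))))
        = of_int (isgn i (set L0)) * (of_nat (\<beta> i) / of_real (vv i)) * L2_inner P (hermite \<alpha> (\<beta>(i := \<beta> i - 1))) (f I0 (lst (insert i (set L0))))"
        unfolding gform_value[OF L0 iL, abs_def] mult.assoc[symmetric] L2_inner_cmult_left ..
      then have "of_real (weight a I0 (lst (insert i (set L0)))) * ((-1) ^ s * L2_inner P (?g I0 (lst (insert i (set L0)))) (f I0 (lst (insert i (set L0)))))
        = (of_real (weight a I0 (lst (insert i (set L0)))) / of_real (vv i)) * ((-1) ^ s * of_int (isgn i (set L0)) * of_nat (\<beta> i) * L2_inner P (hermite \<alpha> (\<beta>(i := \<beta> i - 1))) (f I0 (lst (insert i (set L0)))))"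
        by simp
      also have "\<dots> = F i" unfolding w F_def by simp
      finally show "of_real (weight a I0 (lst (insert i (set L0)))) * ((-1) ^ s * L2_inner P (?g I0 (lst (insert i (set L0)))) (f I0 (lst (insert i (set L0))))) = F i" .
    qed
    finally show ?thesis .
  qed
  have "of_real (weight a I0 L0) * L2_inner P (hermite \<alpha> \<beta>) (h I0 L0) = of_real (weight a I0 L0) * ((-1) ^ s / of_real (2 * r\<^sup>2) *
     (\<Sum>i\<in>B. of_int (isgn i (set L0)) * of_nat (\<beta> i) * L2_inner P (hermite \<alpha> (\<beta>(i := \<beta> i - 1))) (f I0 (lst (insert i (set L0))))))"
    using eq unfolding r l F_def by (simp only: sum_distrib_left mult.assoc)
  then have "L2_inner P (hermite \<alpha> \<beta>) (h I0 L0) = (-1) ^ s / of_real (2 * r\<^sup>2) *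
     (\<Sum>i\<in>B. of_int (isgn i (set L0)) * of_nat (\<beta> i) * L2_inner P (hermite \<alpha> (\<beta>(i := \<beta> i - 1))) (f I0 (lst (insert i (set L0)))))"
    by (rule mult_left_cancel[THEN iffD1, rotated]) (use weight_pos[of I0 L0] in simp)
  \<comment> \<open>So far the Hermite polynomial stands in the first argument; conjugation
    exchanges the arguments, and all scalar factors are real.\<close>
  then have "cnj (L2_inner P (hermite \<alpha> \<beta>) (h I0 L0)) = (-1) ^ s / of_real (2 * r\<^sup>2) *
     (\<Sum>i\<in>B. of_int (isgn i (set L0)) * of_nat (\<beta> i) * cnj (L2_inner P (hermite \<alpha> (\<beta>(i := \<beta> i - 1))) (f I0 (lst (insert i (set L0))))))"
    by simp
  then show ?thesis unfolding L2_inner_cnj B_def .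
qed

end

subsection \<open>The basic estimate\<close>

lemma has_sum_finite_sum:
  fixes g :: "'p \<Rightarrow> 'q \<Rightarrow> real"
  assumes "finite X" "\<And>p. p \<in> X \<Longrightarrow> (g p has_sum c p) A"
  shows "((\<lambda>q. \<Sum>p\<in>X. g p q) has_sum (\<Sum>p\<in>X. c p)) A"
  using assms by (induction X) (auto intro!: has_sum_0 has_sum_add)

lemma form_norm_sq:
  assumes "\<And>i. a i > (0::real)"
  shows "(form_norm r a s t f)\<^sup>2 = (\<Sum>\<^sub>\<infinity>(I, J)\<in>multi_indices s \<times> multi_indices t.
      weight a I J * (LINT z|gauss_ell2 r a. (cmod (f I J z))\<^sup>2))"
proof -
  have "(\<Prod>i\<leftarrow>I. (a i)\<^sup>2) \<ge> 0" for I by (induction I) auto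
  then have "weight a I J \<ge> 0" for I J by (simp add: weight_def)
  then have "0 \<le> (\<Sum>\<^sub>\<infinity>(I, J)\<in>multi_indices s \<times> multi_indices t.
      weight a I J * (LINT z|gauss_ell2 r a. (cmod (f I J z))\<^sup>2))"
    by (intro infsum_nonneg) (auto intro!: mult_nonneg_nonneg)
  then show ?thesis unfolding form_norm_def by (rule real_sqrt_pow2)
qed

context gauss_weights begin

text \<open>The share of one Hermite term in the squared form norm, which by Parseval is the sum of
  these shares.\<close>

definition hcoef :: "form \<Rightarrow> nat list \<Rightarrow> nat list \<Rightarrow> (nat \<Rightarrow> nat) \<Rightarrow> (nat \<Rightarrow> nat) \<Rightarrow> real" where
  "hcoef f I J \<alpha> \<beta> = weight a I J * ((cmod (L2_inner P (f I J) (hermite \<alpha> \<beta>)))\<^sup>2 / hermite_norm_sq \<alpha> \<beta>)"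

lemma hcoef_nonneg: "hcoef f I J \<alpha> \<beta> \<ge> 0"
  unfolding hcoef_def using weight_pos[of I J] hermite_norm_sq_pos[of \<alpha> \<beta>] by (intro mult_nonneg_nonneg) auto

lemma hermite_orth:
  assumes "p \<in> Idx" "q \<in> Idx"
  shows "L2_inner P (hermite (fst p) (snd p)) (hermite (fst q) (snd q)) = (if p = q then of_real (hermite_norm_sq (fst p) (snd p)) else 0)"
  using hermite_inner[of "fst p" "snd p" "fst q" "snd q"] assms by (auto simp: prod_eq_iff)

lemma hermite_L2: "p \<in> Idx \<Longrightarrow> hermite (fst p) (snd p) \<in> L2_fun P"
  by (rule tame_L2[OF tame_hermite]) simp

text \<open>Enlarging \<open>F\<close> to the product of its two projections only adds nonnegative
  terms and lets Bessel's inequality act on each (I, J) separately.\<close>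

lemma bessel_form:
  assumes f: "f \<in> L2_form r a s t" and F: "finite F" "F \<subseteq> (multi_indices s \<times> multi_indices t) \<times> Idx"
  shows "(\<Sum>((I, J), (\<alpha>, \<beta>))\<in>F. hcoef f I J \<alpha> \<beta>) \<le> (form_norm r a s t f)\<^sup>2"
proof -
  let ?n = "\<lambda>(I, J). weight a I J * (LINT z|P. (cmod (f I J z))\<^sup>2)"
  have sf: "?n summable_on multi_indices s \<times> multi_indices t" using f by (simp add: L2_form_def)
  have FF: "fst ` F \<subseteq> multi_indices s \<times> multi_indices t" "snd ` F \<subseteq> Idx" using F(2) by auto
  have "(\<Sum>((I, J), (\<alpha>, \<beta>))\<in>F. hcoef f I J \<alpha> \<beta>) \<le> (\<Sum>((I, J), (\<alpha>, \<beta>))\<in>fst ` F \<times> snd ` F. hcoef f I J \<alpha> \<beta>)"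
    by (rule sum_mono2[OF _ subset_fst_snd]) (use F(1) hcoef_nonneg in auto)
  also have "\<dots> = (\<Sum>p\<in>fst ` F. \<Sum>q\<in>snd ` F. hcoef f (fst p) (snd p) (fst q) (snd q))"
    by (simp add: sum.cartesian_product split_beta')
  also have "\<dots> \<le> (\<Sum>p\<in>fst ` F. ?n p)"
  proof (rule sum_mono)
    fix p assume p: "p \<in> fst ` F"
    then have fp: "f (fst p) (snd p) \<in> L2_fun P" using FF(1) by (intro L2_formD[OF f]) auto
    have "(\<Sum>q\<in>snd ` F. (cmod (L2_inner P (f (fst p) (snd p)) (hermite (fst q) (snd q))))\<^sup>2 / hermite_norm_sq (fst q) (snd q))
        \<le> (LINT z|P. (cmod (f (fst p) (snd p) z))\<^sup>2)"
      by (rule L2_bessel[OF fp _ hermite_L2 hermite_norm_sq_pos hermite_orth]) (use F(1) FF(2) in \<open>blast intro: finite_imageI\<close>)+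
    then have "weight a (fst p) (snd p) * (\<Sum>q\<in>snd ` F. (cmod (L2_inner P (f (fst p) (snd p)) (hermite (fst q) (snd q))))\<^sup>2 / hermite_norm_sq (fst q) (snd q))
        \<le> weight a (fst p) (snd p) * (LINT z|P. (cmod (f (fst p) (snd p) z))\<^sup>2)"
      using weight_pos[of "fst p" "snd p"] by (intro mult_left_mono) auto
    then show "(\<Sum>q\<in>snd ` F. hcoef f (fst p) (snd p) (fst q) (snd q)) \<le> ?n p"
      by (simp add: hcoef_def sum_distrib_left split_beta')
  qed
  also have "\<dots> \<le> infsum ?n (multi_indices s \<times> multi_indices t)"
    by (rule finite_sum_le_infsum[OF sf])
       (use F(1) FF(1) weight_pos in \<open>auto intro!: mult_nonneg_nonneg simp: less_imp_le\<close>)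
  finally show ?thesis unfolding form_norm_sq[OF a_pos] .
qed

text \<open>Totality enters here: by Parseval, bounds on finite sums of Hermite terms pass to all
  degrees for finitely many (I, J), and then to all (I, J).\<close>

lemma form_norm_le:
  assumes f: "f \<in> L2_form r a s t"
    and b: "\<And>F. finite F \<Longrightarrow> F \<subseteq> (multi_indices s \<times> multi_indices t) \<times> Idx \<Longrightarrow> (\<Sum>((I, J), (\<alpha>, \<beta>))\<in>F. hcoef f I J \<alpha> \<beta>) \<le> B"
  shows "(form_norm r a s t f)\<^sup>2 \<le> B"
  unfolding form_norm_sq[OF a_pos]
proof (rule infsum_le_finite_sums)
  show "(\<lambda>(I, J). weight a I J * (LINT z|P. (cmod (f I J z))\<^sup>2)) summable_on multi_indices s \<times> multi_indices t"
    using f by (simp add: L2_form_def)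
  fix X assume X: "finite X" "X \<subseteq> multi_indices s \<times> multi_indices t"
  have "((\<lambda>q. \<Sum>p\<in>X. hcoef f (fst p) (snd p) (fst q) (snd q)) has_sum
      (\<Sum>p\<in>X. weight a (fst p) (snd p) * (LINT z|P. (cmod (f (fst p) (snd p) z))\<^sup>2))) Idx"
  proof (rule has_sum_finite_sum[OF X(1)])
    fix p assume p: "p \<in> X"
    then have fp: "f (fst p) (snd p) \<in> L2_fun P" using X(2) by (intro L2_formD[OF f]) auto
    have "((\<lambda>q. (cmod (L2_inner P (f (fst p) (snd p)) (hermite (fst q) (snd q))))\<^sup>2 / hermite_norm_sq (fst q) (snd q))
        has_sum (LINT z|P. (cmod (f (fst p) (snd p) z))\<^sup>2)) Idx"
      by (rule L2_parseval[OF Pm.prob_space_axioms fp hermite_L2 hermite_norm_sq_pos hermite_orth hermite_total])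
    then show "((\<lambda>q. hcoef f (fst p) (snd p) (fst q) (snd q)) has_sum weight a (fst p) (snd p) * (LINT z|P. (cmod (f (fst p) (snd p) z))\<^sup>2)) Idx"
      unfolding hcoef_def by (rule has_sum_cmult_right)
  qed
  then have "(\<Sum>p\<in>X. weight a (fst p) (snd p) * (LINT z|P. (cmod (f (fst p) (snd p) z))\<^sup>2)) \<le> B"
  proof (rule has_sum_le_finite_sums)
    fix Y assume Y: "finite Y" "Y \<subseteq> Idx"
    have "(\<Sum>q\<in>Y. \<Sum>p\<in>X. hcoef f (fst p) (snd p) (fst q) (snd q)) = (\<Sum>((I, J), (\<alpha>, \<beta>))\<in>X \<times> Y. hcoef f I J \<alpha> \<beta>)"
      by (subst sum.swap) (simp add: sum.cartesian_product split_beta')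
    also have "\<dots> \<le> B" by (rule b) (use X Y in auto)
    finally show "(\<Sum>q\<in>Y. \<Sum>p\<in>X. hcoef f (fst p) (snd p) (fst q) (snd q)) \<le> B" .
  qed
  then show "(\<Sum>(I, J)\<in>X. weight a I J * (LINT z|P. (cmod (f I J z))\<^sup>2)) \<le> B"
    by (simp add: split_beta')
qed

text \<open>Each i in J contributes a_i^2 to the weight and \<open>vv i\<close> / \<gamma>_i to the
  squared norm, so a_i cancels and \<gamma>_i / (2 r^2) remains.\<close>

lemma weight_over_norm_sq:
  assumes p: "(\<alpha>, \<gamma>) \<in> Idx" and J: "J \<subseteq> {i. \<gamma> i \<noteq> 0}"
  shows "weight a I (lst J) / hermite_norm_sq \<alpha> (sub1 J \<gamma>)
    = weight a I [] / hermite_norm_sq \<alpha> \<gamma> * (\<Prod>i\<in>J. real (\<gamma> i)) / (2 * r\<^sup>2) ^ card J"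
proof -
  have fJ: "finite J" using J p by (auto simp: Idx_def intro: finite_subset)
  have e1: "weight a I (lst J) = weight a I [] * (\<Prod>i\<in>J. (a i)\<^sup>2)"
    using prod.distinct_set_conv_list[of "lst J" "\<lambda>j. (a j)\<^sup>2"] fJ by (simp add: lst_def weight_def)
  have e2: "hermite_norm_sq \<alpha> (sub1 J \<gamma>) * (\<Prod>i\<in>J. real (\<gamma> i)) = hermite_norm_sq \<alpha> \<gamma> * (\<Prod>i\<in>J. vv i)"
  proof -
    define S where "S = {i. \<alpha> i \<noteq> 0 \<or> \<gamma> i \<noteq> 0}"
    have S: "finite S" using p by (simp add: S_def Idx_def Collect_disj_eq)
    have JS: "J \<subseteq> S" using J by (auto simp: S_def)
    \<comment> \<open>Factors 1 outside J bring all products to the index set \<open>S\<close>,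
      where they are compared factor by factor.\<close>
    have ext: "(\<Prod>i\<in>J. g i) = (\<Prod>i\<in>S. if i \<in> J then g i else 1)" for g :: "nat \<Rightarrow> real"
      using prod.inter_restrict[OF S, of g J] Int_absorb1[OF JS] by simp
    have "hermite_norm_sq \<alpha> (sub1 J \<gamma>) * (\<Prod>i\<in>J. real (\<gamma> i))
      = (\<Prod>i\<in>S. (fact (\<alpha> i) * vv i ^ \<alpha> i * fact (sub1 J \<gamma> i) / vv i ^ sub1 J \<gamma> i) * (if i \<in> J then real (\<gamma> i) else 1))"
      unfolding ext prod.distrib
      by (subst hermite_norm_sq_eq_prod[OF S]) (auto simp: S_def sub1_def)
    also have "\<dots> = (\<Prod>i\<in>S. (fact (\<alpha> i) * vv i ^ \<alpha> i * fact (\<gamma> i) / vv i ^ \<gamma> i) * (if i \<in> J then vv i else 1))"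
    proof (rule prod.cong[OF refl])
      fix i
      show "(fact (\<alpha> i) * vv i ^ \<alpha> i * fact (sub1 J \<gamma> i) / vv i ^ sub1 J \<gamma> i) * (if i \<in> J then real (\<gamma> i) else 1)
        = (fact (\<alpha> i) * vv i ^ \<alpha> i * fact (\<gamma> i) / vv i ^ \<gamma> i) * (if i \<in> J then vv i else 1)"
      proof (cases "i \<in> J")
        case True
        then have "\<gamma> i \<noteq> 0" using J by auto
        then obtain k where k: "\<gamma> i = Suc k" by (cases "\<gamma> i") auto
        show ?thesis using True vv_pos[of i] by (simp add: sub1_def k field_simps)
      qed (simp add: sub1_def)
    qed
    also have "\<dots> = hermite_norm_sq \<alpha> \<gamma> * (\<Prod>i\<in>J. vv i)"
      unfolding ext prod.distrib by (subst hermite_norm_sq_eq_prod[OF S]) (auto simp: S_def)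
    finally show ?thesis .
  qed
  have e3: "(\<Prod>i\<in>J. vv i) = (2 * r\<^sup>2) ^ card J * (\<Prod>i\<in>J. (a i)\<^sup>2)"
    by (simp add: vv_def prod.distrib)
  define R where "R = (2 * r\<^sup>2) ^ card J"
  have R: "R > 0" using r_pos by (simp add: R_def)
  have "weight a I (lst J) * (hermite_norm_sq \<alpha> \<gamma> * R) = weight a I [] * (hermite_norm_sq \<alpha> \<gamma> * (R * (\<Prod>i\<in>J. (a i)\<^sup>2)))"
    by (simp add: e1 mult_ac)
  also have "\<dots> = weight a I [] * (hermite_norm_sq \<alpha> (sub1 J \<gamma>) * (\<Prod>i\<in>J. real (\<gamma> i)))"
    by (simp only: e2 e3 R_def)
  finally have "weight a I (lst J) * (hermite_norm_sq \<alpha> \<gamma> * R) = weight a I [] * (\<Prod>i\<in>J. real (\<gamma> i)) * hermite_norm_sq \<alpha> (sub1 J \<gamma>)"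
    by (simp only: mult_ac)
  then have "weight a I (lst J) / hermite_norm_sq \<alpha> (sub1 J \<gamma>) = weight a I [] * (\<Prod>i\<in>J. real (\<gamma> i)) / (hermite_norm_sq \<alpha> \<gamma> * R)"
    using hermite_norm_sq_pos[of \<alpha> "sub1 J \<gamma>"] hermite_norm_sq_pos[of \<alpha> \<gamma>] R by (subst frac_eq_eq) auto
  then show ?thesis by (simp add: R_def)
qed

lemma hcoef_sub1:
  assumes p: "(\<alpha>, \<gamma>) \<in> Idx" and J: "J \<subseteq> {i. \<gamma> i \<noteq> 0}"
  shows "hcoef f I (lst J) \<alpha> (sub1 J \<gamma>) = weight a I [] / hermite_norm_sq \<alpha> \<gamma> / (2 * r\<^sup>2) ^ card J *
    ((\<Prod>i\<in>J. real (\<gamma> i)) * (cmod (L2_inner P (f I (lst J)) (hermite \<alpha> (sub1 J \<gamma>))))\<^sup>2)"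
proof -
  have "hcoef f I (lst J) \<alpha> (sub1 J \<gamma>) = (weight a I (lst J) / hermite_norm_sq \<alpha> (sub1 J \<gamma>)) * (cmod (L2_inner P (f I (lst J)) (hermite \<alpha> (sub1 J \<gamma>))))\<^sup>2"
    by (simp add: hcoef_def)
  then show ?thesis unfolding weight_over_norm_sq[OF assms] by simp
qed

text \<open>All terms of the block share \<kappa>. Those of f carry 1 / R^(t + 1) and those of g
  carry 1 / R^(t + 2); those of h carry 1 / R^t from their weights and 1 / R^2 from the squared
  factor in \<open>adj_hermite\<close>. So \<open>koszul_identity\<close> applies to g and h
  together, with one factor 1 / R left against f.\<close>

lemma block_estimate:
  assumes f: "f \<in> L2_form r a s (t + 1)" and g: "dbar_coeffs r a s (t + 1) f g" and h: "is_dbar_adj r a s t f h"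
    and I: "I \<in> multi_indices s" and p: "(\<alpha>, \<gamma>) \<in> Idx"
  defines "\<Gamma> \<equiv> {i. \<gamma> i \<noteq> 0}"
  shows "(real t + 1) / (2 * r\<^sup>2) * (\<Sum>J\<in>ksub \<Gamma> (t + 1). hcoef f I (lst J) \<alpha> (sub1 J \<gamma>))
    \<le> (\<Sum>L\<in>ksub \<Gamma> t. hcoef h I (lst L) \<alpha> (sub1 L \<gamma>)) + (\<Sum>K\<in>ksub \<Gamma> (t + 2). hcoef g I (lst K) \<alpha> (sub1 K \<gamma>))"
proof -
  have \<Gamma>: "finite \<Gamma>" using p by (simp add: \<Gamma>_def Idx_def)
  define R where "R = 2 * r\<^sup>2"
  have R: "R > 0" using r_pos by (simp add: R_def)
  define \<kappa> where "\<kappa> = weight a I [] / hermite_norm_sq \<alpha> \<gamma>"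
  have \<kappa>: "\<kappa> \<ge> 0" using weight_pos[of I "[]"] hermite_norm_sq_pos[of \<alpha> \<gamma>] by (simp add: \<kappa>_def)
  define v where "v J = L2_inner P (f I (lst J)) (hermite \<alpha> (sub1 J \<gamma>))" for J
  let ?\<gamma> = "\<lambda>i. real (\<gamma> i)"
  have fin: "finite J" if "J \<subseteq> \<Gamma>" for J using that \<Gamma> finite_subset by blast
  have hf: "hcoef f I (lst J) \<alpha> (sub1 J \<gamma>) = \<kappa> / R ^ (t + 1) * (prod ?\<gamma> J * (cmod (v J))\<^sup>2)" if "J \<in> ksub \<Gamma> (t + 1)" for J
    using that hcoef_sub1[OF p, of J f I] unfolding ksub_def \<Gamma>_def \<kappa>_def R_def v_def by simp
  have hg: "hcoef g I (lst K) \<alpha> (sub1 K \<gamma>) = \<kappa> / R ^ (t + 2) * (prod ?\<gamma> K * (cmod (\<Sum>i\<in>K. of_int (isgn i (K - {i})) * v (K - {i})))\<^sup>2)"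
    if "K \<in> ksub \<Gamma> (t + 2)" for K
  proof -
    have K: "K \<subseteq> \<Gamma>" "card K = t + 2" "finite K" using that fin by (auto simp: ksub_def)
    have Km: "lst K \<in> multi_indices (t + 1 + 1)" by (rule lst_multi_indices) (use K in auto)
    have "L2_inner P (g I (lst K)) (hermite \<alpha> (sub1 K \<gamma>)) = (\<Sum>i\<in>K. of_int (isgn i (K - {i})) * v (K - {i}))"
      unfolding dbar_coeffs_hermite[OF f g I Km Idx_sub1[OF p]] set_lst[OF K(3)]
    proof (rule sum.cong[OF refl])
      fix i assume i: "i \<in> K"
      \<comment> \<open>Raising at i in K undoes the subtraction there and leads to K - {i} in the
        same block; subtraction being truncated, this requires \<gamma>_i nonzero.\<close>
      then have "\<gamma> i \<noteq> 0" using K(1) by (auto simp: \<Gamma>_def)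
      then have "(sub1 K \<gamma>)(i := sub1 K \<gamma> i + 1) = sub1 (K - {i}) \<gamma>"
        using i by (auto simp: sub1_def fun_eq_iff)
      then show "of_int (isgn i (K - {i})) * L2_inner P (f I (lst (K - {i}))) (hermite \<alpha> ((sub1 K \<gamma>)(i := sub1 K \<gamma> i + 1)))
        = of_int (isgn i (K - {i})) * v (K - {i})" by (simp only: v_def)
    qed
    then show ?thesis using hcoef_sub1[OF p, of K g I] K(1,2) unfolding \<Gamma>_def \<kappa>_def R_def by simp
  qed
  have hh: "hcoef h I (lst L) \<alpha> (sub1 L \<gamma>) = \<kappa> / R ^ (t + 2) * (prod ?\<gamma> L * (cmod (\<Sum>i\<in>\<Gamma> - L. of_int (isgn i L) * of_real (?\<gamma> i) * v (insert i L)))\<^sup>2)"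
    if "L \<in> ksub \<Gamma> t" for L
  proof -
    have L: "L \<subseteq> \<Gamma>" "card L = t" "finite L" using that fin by (auto simp: ksub_def)
    have Lm: "lst L \<in> multi_indices t" by (rule lst_multi_indices) (use L in auto)
    have supp: "{i. sub1 L \<gamma> i \<noteq> 0} - L = \<Gamma> - L" by (auto simp: sub1_def \<Gamma>_def)
    have "L2_inner P (h I (lst L)) (hermite \<alpha> (sub1 L \<gamma>)) = (-1) ^ s / of_real R *
        (\<Sum>i\<in>\<Gamma> - L. of_int (isgn i L) * of_real (?\<gamma> i) * v (insert i L))"
      unfolding adj_hermite[OF f h I Lm Idx_sub1[OF p]] set_lst[OF L(3)] supp R_def
    proof (rule arg_cong[where f = "\<lambda>x. _ * x"], rule sum.cong[OF refl])
      fix i assume i: "i \<in> \<Gamma> - L"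
      then have "(sub1 L \<gamma>)(i := sub1 L \<gamma> i - 1) = sub1 (insert i L) \<gamma>" "sub1 L \<gamma> i = \<gamma> i"
        by (auto simp: sub1_def fun_eq_iff)
      then show "of_int (isgn i L) * of_nat (sub1 L \<gamma> i) * L2_inner P (f I (lst (insert i L))) (hermite \<alpha> ((sub1 L \<gamma>)(i := sub1 L \<gamma> i - 1)))
        = of_int (isgn i L) * of_real (?\<gamma> i) * v (insert i L)" by (simp only: v_def of_real_of_nat_eq)
    qed
    then have "(cmod (L2_inner P (h I (lst L)) (hermite \<alpha> (sub1 L \<gamma>))))\<^sup>2
      = (cmod (\<Sum>i\<in>\<Gamma> - L. of_int (isgn i L) * of_real (?\<gamma> i) * v (insert i L)))\<^sup>2 / R\<^sup>2"
      using R by (simp add: norm_mult norm_divide norm_power power_divide)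
    then show ?thesis using hcoef_sub1[OF p, of L h I] L(1,2) R unfolding \<Gamma>_def \<kappa>_def R_def[symmetric]
      by (simp add: power2_eq_square)
  qed
  define V where "V = (\<Sum>J\<in>ksub \<Gamma> (t + 1). prod ?\<gamma> J * (cmod (v J))\<^sup>2)"
  have V0: "V \<ge> 0" unfolding V_def by (intro sum_nonneg mult_nonneg_nonneg prod_nonneg) auto
  have rhs: "(\<Sum>L\<in>ksub \<Gamma> t. hcoef h I (lst L) \<alpha> (sub1 L \<gamma>)) + (\<Sum>K\<in>ksub \<Gamma> (t + 2). hcoef g I (lst K) \<alpha> (sub1 K \<gamma>))
    = \<kappa> / R ^ (t + 2) * (sum ?\<gamma> \<Gamma> * V)"
  proof -
    have "(\<Sum>L\<in>ksub \<Gamma> t. hcoef h I (lst L) \<alpha> (sub1 L \<gamma>)) + (\<Sum>K\<in>ksub \<Gamma> (t + 2). hcoef g I (lst K) \<alpha> (sub1 K \<gamma>))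
      = \<kappa> / R ^ (t + 2) * ((\<Sum>K\<in>ksub \<Gamma> (t + 2). prod ?\<gamma> K * (cmod (\<Sum>i\<in>K. of_int (isgn i (K - {i})) * v (K - {i})))\<^sup>2)
       + (\<Sum>L\<in>ksub \<Gamma> t. prod ?\<gamma> L * (cmod (\<Sum>i\<in>\<Gamma> - L. of_int (isgn i L) * of_real (?\<gamma> i) * v (insert i L)))\<^sup>2))"
      by (simp only: sum.cong[OF refl hg] sum.cong[OF refl hh] sum_distrib_left[symmetric] distrib_left[symmetric] add.commute)
    then show ?thesis unfolding V_def by (simp only: koszul_identity[OF \<Gamma>, of ?\<gamma> v t])
  qed
  have lhs: "(\<Sum>J\<in>ksub \<Gamma> (t + 1). hcoef f I (lst J) \<alpha> (sub1 J \<gamma>)) = \<kappa> / R ^ (t + 1) * V"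
    unfolding V_def sum_distrib_left by (rule sum.cong[OF refl hf])
  \<comment> \<open>A block without any J of size t + 1 has V = 0. Otherwise such a J inside the
    support provides t + 1 indices, each of degree at least 1.\<close>
  have tV: "(real t + 1) * V \<le> sum ?\<gamma> \<Gamma> * V"
  proof (cases "ksub \<Gamma> (t + 1) = {}")
    case True then show ?thesis by (simp add: V_def)
  next
    case False
    then obtain J where "J \<subseteq> \<Gamma>" "card J = t + 1" by (auto simp: ksub_def)
    then have "t + 1 \<le> card \<Gamma>" using card_mono[OF \<Gamma>] by metis
    then have "real t + 1 \<le> real (card \<Gamma>)" by linarith
    also have "\<dots> = (\<Sum>i\<in>\<Gamma>. 1)" by simp
    also have "\<dots> \<le> sum ?\<gamma> \<Gamma>" by (rule sum_mono) (auto simp: \<Gamma>_def)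
    finally show ?thesis using V0 by (rule mult_right_mono)
  qed
  have "(real t + 1) / R * (\<kappa> / R ^ (t + 1) * V) = \<kappa> / R ^ (t + 2) * ((real t + 1) * V)"
    using R by (simp add: field_simps)
  also have "\<dots> \<le> \<kappa> / R ^ (t + 2) * (sum ?\<gamma> \<Gamma> * V)"
    using \<kappa> R by (intro mult_left_mono tV) simp
  finally show ?thesis unfolding rhs lhs R_def .
qed

text \<open>Distinct blocks use distinct Hermite terms, because \<gamma> is recovered from K and the
  lowered degree by \<open>add1\<close>. The double sum therefore runs over a finite set of terms to
  which \<open>bessel_form\<close> applies.\<close>

lemma sum_blocks_le:
  assumes g: "g \<in> L2_form r a s m" and G: "finite G" "\<And>I \<alpha> \<gamma>. (I, \<alpha>, \<gamma>) \<in> G \<Longrightarrow> I \<in> multi_indices s \<and> (\<alpha>, \<gamma>) \<in> Idx"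
  shows "(\<Sum>(I, \<alpha>, \<gamma>)\<in>G. \<Sum>K\<in>ksub {i. \<gamma> i \<noteq> 0} m. hcoef g I (lst K) \<alpha> (sub1 K \<gamma>)) \<le> (form_norm r a s m g)\<^sup>2"
proof -
  define T where "T = (SIGMA (I, \<alpha>, \<gamma>):G. ksub {i. \<gamma> i \<noteq> 0} m)"
  define \<Phi> where "\<Phi> = (\<lambda>((I :: nat list, \<alpha> :: nat \<Rightarrow> nat, \<gamma>), K). ((I, lst K), (\<alpha>, sub1 K \<gamma>)))"
  have fin\<gamma>: "finite {i. \<gamma> i \<noteq> 0}" if "(I, \<alpha>, \<gamma>) \<in> G" for I \<alpha> \<gamma> using G(2)[OF that] by (simp add: Idx_def)
  have fks: "finite (ksub {i. \<gamma> i \<noteq> 0} m)" if "(I, \<alpha>, \<gamma>) \<in> G" for I \<alpha> \<gamma> using finite_ksub[OF fin\<gamma>[OF that]] .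
  have T: "finite T" unfolding T_def by (rule finite_SigmaI[OF G(1)]) (use fks in auto)
  have fK: "finite K" if "((I, \<alpha>, \<gamma>), K) \<in> T" for I \<alpha> \<gamma> K
    using that fin\<gamma> by (auto simp: T_def ksub_def intro: finite_subset)
  have inj: "inj_on \<Phi> T"
  proof (rule inj_on_inverseI[where g = "\<lambda>((I, L), (\<alpha>, \<beta>)). ((I, \<alpha>, add1 (set L) \<beta>), set L)"])
    fix x assume x: "x \<in> T"
    obtain I \<alpha> \<gamma> K where e: "x = ((I, \<alpha>, \<gamma>), K)" by (metis prod.exhaust)
    have K: "K \<subseteq> {i. \<gamma> i \<noteq> 0}" "finite K"
    proof -
      have xT: "((I, \<alpha>, \<gamma>), K) \<in> T" using x e by simp
      then show "K \<subseteq> {i. \<gamma> i \<noteq> 0}" by (simp add: T_def ksub_def)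
      show "finite K" by (rule fK[OF xT])
    qed
    show "(\<lambda>((I, L), (\<alpha>, \<beta>)). ((I, \<alpha>, add1 (set L) \<beta>), set L)) (\<Phi> x) = x"
      using add1_sub1[OF K(1)] K(2) by (simp add: e \<Phi>_def)
  qed
  have "(\<Sum>(I, \<alpha>, \<gamma>)\<in>G. \<Sum>K\<in>ksub {i. \<gamma> i \<noteq> 0} m. hcoef g I (lst K) \<alpha> (sub1 K \<gamma>))
      = (\<Sum>x\<in>G. \<Sum>K\<in>(case x of (I, \<alpha>, \<gamma>) \<Rightarrow> ksub {i. \<gamma> i \<noteq> 0} m). case x of (I, \<alpha>, \<gamma>) \<Rightarrow> hcoef g I (lst K) \<alpha> (sub1 K \<gamma>))"
    by (intro sum.cong refl) auto
  also have "\<dots> = (\<Sum>(x, K)\<in>T. case x of (I, \<alpha>, \<gamma>) \<Rightarrow> hcoef g I (lst K) \<alpha> (sub1 K \<gamma>))"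
    unfolding T_def by (rule sum.Sigma[OF G(1)]) (use fks in auto)
  also have "\<dots> = (\<Sum>y\<in>T. (\<lambda>((I, J), (\<alpha>, \<beta>)). hcoef g I J \<alpha> \<beta>) (\<Phi> y))"
    by (intro sum.cong refl) (auto simp: \<Phi>_def)
  also have "\<dots> = (\<Sum>((I, J), (\<alpha>, \<beta>))\<in>\<Phi> ` T. hcoef g I J \<alpha> \<beta>)"
    by (simp only: sum.reindex[OF inj] o_def)
  also have "\<dots> \<le> (form_norm r a s m g)\<^sup>2"
  proof (rule bessel_form[OF g])
    show "finite (\<Phi> ` T)" using T by simp
    show "\<Phi> ` T \<subseteq> (multi_indices s \<times> multi_indices m) \<times> Idx"
    proof
      fix y assume "y \<in> \<Phi> ` T"
      then obtain x where x: "x \<in> T" "y = \<Phi> x" by blast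
      obtain I \<alpha> \<gamma> K where "x = ((I, \<alpha>, \<gamma>), K)" by (metis prod.exhaust)
      then have e: "((I, \<alpha>, \<gamma>), K) \<in> T" "y = \<Phi> ((I, \<alpha>, \<gamma>), K)" using x by simp_all
      have "(I, \<alpha>, \<gamma>) \<in> G" "card K = m" using e(1) by (auto simp: T_def ksub_def)
      then show "y \<in> (multi_indices s \<times> multi_indices m) \<times> Idx"
        using G(2) Idx_sub1 lst_multi_indices[OF fK[OF e(1)]] by (simp add: e(2) \<Phi>_def)
    qed
  qed
  finally show ?thesis .
qed

text \<open>\<open>block_estimate\<close> speaks of whole blocks, so a finite set of terms of f is
  first completed to the finitely many blocks it meets, adding nonnegative terms. For g and h the
  same blocks give finite sums bounded by their norms.\<close>

lemma basic_estimate: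
  assumes f: "f \<in> L2_form r a s (t + 1)" and g: "dbar_coeffs r a s (t + 1) f g" and h: "is_dbar_adj r a s t f h"
  shows "(real t + 1) / (2 * r\<^sup>2) * (form_norm r a s (t + 1) f)\<^sup>2
    \<le> (form_norm r a s t h)\<^sup>2 + (form_norm r a s (t + 2) g)\<^sup>2"
proof -
  define c where "c = (real t + 1) / (2 * r\<^sup>2)"
  have c: "c > 0" using r_pos by (simp add: c_def add_pos_nonneg)
  define B where "B = (form_norm r a s t h)\<^sup>2 + (form_norm r a s (t + 2) g)\<^sup>2"
  have gL: "g \<in> L2_form r a s (t + 2)" using g by (simp add: dbar_coeffs_def)
  have hL: "h \<in> L2_form r a s t" using h by (simp add: is_dbar_adj_def)
  have "(form_norm r a s (t + 1) f)\<^sup>2 \<le> B / c"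
  proof (rule form_norm_le[OF f])
    fix F assume F: "finite F" "F \<subseteq> (multi_indices s \<times> multi_indices (t + 1)) \<times> Idx"
    \<comment> \<open>\<open>\<Psi>\<close> records the block (I, \<alpha>, \<gamma>) of a term and
      its position J inside it; \<open>\<Phi>\<close> recovers the term.\<close>
    define \<Psi> where "\<Psi> = (\<lambda>((I, J :: nat list), (\<alpha> :: nat \<Rightarrow> nat, \<beta>)). ((I :: nat list, \<alpha>, add1 (set J) \<beta>), set J))"
    define \<Phi> where "\<Phi> = (\<lambda>((I :: nat list, \<alpha> :: nat \<Rightarrow> nat, \<gamma>), K). ((I, lst K), (\<alpha>, sub1 K \<gamma>)))"
    define A where "A = (\<lambda>((I, J), (\<alpha>, \<beta>)). hcoef f I J \<alpha> \<beta>)"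
    define G where "G = fst ` \<Psi> ` F"
    have G: "finite G" using F(1) by (simp add: G_def)
    have GI: "I \<in> multi_indices s \<and> (\<alpha>, \<gamma>) \<in> Idx" if "(I, \<alpha>, \<gamma>) \<in> G" for I \<alpha> \<gamma>
      using that F(2) by (auto simp: G_def \<Psi>_def intro!: Idx_add1)
    have fin\<gamma>: "finite {i. \<gamma> i \<noteq> 0}" if "(I, \<alpha>, \<gamma>) \<in> G" for I \<alpha> \<gamma> using GI[OF that] by (simp add: Idx_def)
    define T where "T = (SIGMA (I, \<alpha>, \<gamma>):G. ksub {i. \<gamma> i \<noteq> 0} (t + 1))"
    have fks: "finite (ksub {i. \<gamma> i \<noteq> 0} (t + 1))" if "(I, \<alpha>, \<gamma>) \<in> G" for I \<alpha> \<gamma> using finite_ksub[OF fin\<gamma>[OF that]] .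
    have T: "finite T" unfolding T_def by (rule finite_SigmaI[OF G]) (use fks in auto)
    have inv: "\<Phi> (\<Psi> x) = x" if "x \<in> F" for x
    proof -
      obtain I J \<alpha> \<beta> where e: "x = ((I, J), (\<alpha>, \<beta>))" by (metis prod.exhaust)
      have "J \<in> multi_indices (t + 1)" using F(2) that e by auto
      then show ?thesis using multi_indices_set(1) by (simp add: e \<Phi>_def \<Psi>_def sub1_add1)
    qed
    have sub: "\<Psi> ` F \<subseteq> T"
    proof
      fix y assume "y \<in> \<Psi> ` F"
      then obtain I J \<alpha> \<beta> where e: "((I, J), (\<alpha>, \<beta>)) \<in> F" "y = \<Psi> ((I, J), (\<alpha>, \<beta>))" by (metis imageE prod.exhaust)
      have J: "J \<in> multi_indices (t + 1)" using F(2) e(1) by auto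
      have "fst y \<in> G" using e by (auto simp: G_def)
      moreover have "set J \<in> ksub {i. add1 (set J) \<beta> i \<noteq> 0} (t + 1)"
        using multi_indices_set(2)[OF J] by (auto simp: ksub_def add1_def)
      ultimately show "y \<in> T" using e(2) by (simp add: T_def \<Psi>_def)
    qed
    have A0: "A x \<ge> 0" for x unfolding A_def by (auto simp: hcoef_nonneg split: prod.splits)
    have "(\<Sum>((I, J), (\<alpha>, \<beta>))\<in>F. hcoef f I J \<alpha> \<beta>) = (\<Sum>x\<in>F. A x)" by (simp add: A_def)
    also have "\<dots> = (\<Sum>x\<in>F. A (\<Phi> (\<Psi> x)))" by (rule sum.cong) (simp_all add: inv)
    also have "\<dots> = (\<Sum>y\<in>\<Psi> ` F. A (\<Phi> y))"
      using sum.reindex[OF inj_on_inverseI[of F \<Phi> \<Psi>, OF inv], of "\<lambda>y. A (\<Phi> y)"] by (simp add: o_def)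
    also have "\<dots> \<le> (\<Sum>y\<in>T. A (\<Phi> y))" by (rule sum_mono2[OF T sub A0])
    also have "\<dots> = (\<Sum>(x, K)\<in>T. case x of (I, \<alpha>, \<gamma>) \<Rightarrow> hcoef f I (lst K) \<alpha> (sub1 K \<gamma>))"
      by (intro sum.cong refl) (auto simp: \<Phi>_def A_def)
    also have "\<dots> = (\<Sum>x\<in>G. \<Sum>K\<in>(case x of (I, \<alpha>, \<gamma>) \<Rightarrow> ksub {i. \<gamma> i \<noteq> 0} (t + 1)). case x of (I, \<alpha>, \<gamma>) \<Rightarrow> hcoef f I (lst K) \<alpha> (sub1 K \<gamma>))"
      unfolding T_def by (rule sum.Sigma[OF G, symmetric]) (use fks in auto)
    also have "\<dots> = (\<Sum>(I, \<alpha>, \<gamma>)\<in>G. \<Sum>J\<in>ksub {i. \<gamma> i \<noteq> 0} (t + 1). hcoef f I (lst J) \<alpha> (sub1 J \<gamma>))"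
      by (intro sum.cong refl) auto
    finally have "c * (\<Sum>((I, J), (\<alpha>, \<beta>))\<in>F. hcoef f I J \<alpha> \<beta>)
      \<le> c * (\<Sum>(I, \<alpha>, \<gamma>)\<in>G. \<Sum>J\<in>ksub {i. \<gamma> i \<noteq> 0} (t + 1). hcoef f I (lst J) \<alpha> (sub1 J \<gamma>))"
      using c by (intro mult_left_mono) auto
    also have "\<dots> = (\<Sum>(I, \<alpha>, \<gamma>)\<in>G. c * (\<Sum>J\<in>ksub {i. \<gamma> i \<noteq> 0} (t + 1). hcoef f I (lst J) \<alpha> (sub1 J \<gamma>)))"
      by (simp add: sum_distrib_left[of c _ G] split_beta')
    also have "\<dots> \<le> (\<Sum>(I, \<alpha>, \<gamma>)\<in>G. (\<Sum>L\<in>ksub {i. \<gamma> i \<noteq> 0} t. hcoef h I (lst L) \<alpha> (sub1 L \<gamma>))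
        + (\<Sum>K\<in>ksub {i. \<gamma> i \<noteq> 0} (t + 2). hcoef g I (lst K) \<alpha> (sub1 K \<gamma>)))"
    proof (rule sum_mono)
      fix x assume x: "x \<in> G"
      obtain I \<alpha> \<gamma> where e: "x = (I, \<alpha>, \<gamma>)" by (metis prod.exhaust)
      have "I \<in> multi_indices s" "(\<alpha>, \<gamma>) \<in> Idx" using GI x e by auto
      from block_estimate[OF f g h this]
      show "(case x of (I, \<alpha>, \<gamma>) \<Rightarrow> c * (\<Sum>J\<in>ksub {i. \<gamma> i \<noteq> 0} (t + 1). hcoef f I (lst J) \<alpha> (sub1 J \<gamma>)))
        \<le> (case x of (I, \<alpha>, \<gamma>) \<Rightarrow> (\<Sum>L\<in>ksub {i. \<gamma> i \<noteq> 0} t. hcoef h I (lst L) \<alpha> (sub1 L \<gamma>))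
        + (\<Sum>K\<in>ksub {i. \<gamma> i \<noteq> 0} (t + 2). hcoef g I (lst K) \<alpha> (sub1 K \<gamma>)))"
        unfolding e c_def split_conv .
    qed
    also have "\<dots> = (\<Sum>(I, \<alpha>, \<gamma>)\<in>G. \<Sum>L\<in>ksub {i. \<gamma> i \<noteq> 0} t. hcoef h I (lst L) \<alpha> (sub1 L \<gamma>))
        + (\<Sum>(I, \<alpha>, \<gamma>)\<in>G. \<Sum>K\<in>ksub {i. \<gamma> i \<noteq> 0} (t + 2). hcoef g I (lst K) \<alpha> (sub1 K \<gamma>))"
      by (simp add: sum.distrib split_beta')
    also have "\<dots> \<le> B"
      unfolding B_def by (rule add_mono[OF sum_blocks_le[OF hL G GI] sum_blocks_le[OF gL G GI]])
    finally show "(\<Sum>((I, J), (\<alpha>, \<beta>))\<in>F. hcoef f I J \<alpha> \<beta>) \<le> B / c"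
      using c by (simp add: pos_le_divide_eq mult.commute)
  qed
  then have "c * (form_norm r a s (t + 1) f)\<^sup>2 \<le> B" using c by (simp add: pos_le_divide_eq mult.commute)
  then show ?thesis unfolding c_def B_def .
qed

end

theorem corollary127:
  fixes r :: real and a :: "nat \<Rightarrow> real" and s t :: nat and f :: form
  assumes "r > 0" and "\<And>i. a i > 0" and "summable a"
    and "f \<in> dom_dbar r a s (t + 1) \<inter> dom_dbar_adj r a s t"
  shows "(form_norm r a s t (dbar_adj r a s t f))\<^sup>2
       + (form_norm r a s (t + 2) (dbar r a s (t + 1) f))\<^sup>2
       \<ge> (real t + 1) / (2 * r\<^sup>2) * (form_norm r a s (t + 1) f)\<^sup>2"
proof -
  interpret gauss_weights r a using assms(1-3) by unfold_locales
  have f: "f \<in> L2_form r a s (t + 1)" using assms(4) by (simp add: dom_dbar_def)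
  define g where "g = (SOME g. dbar_coeffs r a s (t + 1) f g)"
  have "\<exists>g. dbar_coeffs r a s (t + 1) f g" using assms(4) by (simp add: dom_dbar_def)
  then have g: "dbar_coeffs r a s (t + 1) f g" unfolding g_def by (rule someI_ex)
  have "\<exists>h. is_dbar_adj r a s t f h" using assms(4) by (simp add: dom_dbar_adj_def)
  then have h: "is_dbar_adj r a s t f (dbar_adj r a s t f)" unfolding dbar_adj_def by (rule someI_ex)
  \<comment> \<open>The factor (-1)^s in \<open>dbar\<close> has modulus 1.\<close>
  have "form_norm r a s (t + 2) (dbar r a s (t + 1) f) = form_norm r a s (t + 2) g"
    unfolding form_norm_def dbar_def g_def[symmetric] by (simp add: norm_mult norm_power)
  then show ?thesis using basic_estimate[OF f g h] by simp
qed

end
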